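(* Let $p(n)$ denote the number of partitions of $n$ and let $q(n)=p(n)/n$ for $n\ge 1$. Then the sequence $\{q(n)\}_{n\ge 31}$ is log-concave, i.e., $q(n)^2 \ge q(n-1)\,q(n+1)$ for all integers $n\ge 32$.
   Context: $p(n)$ is the partition function: the number of ways of writing $n$ as an unordered sum of positive integers. A sequence $(a_n)$ is log-concave if $a_n^2-a_{n-1}a_{n+1}\ge 0$ for all admissible $n$. *)

theory Defs
  imports Complex_Main "HOL-Library.Multiset"
begin

definition int_partitions :: "nat \<Rightarrow> nat multiset set" where
  "int_partitions n = {M. (\<forall>x \<in># M. 0 < x) \<and> sum_mset M = n}"

definition partition_number :: "nat \<Rightarrow> nat" where
  "partition_number n = card (int_partitions n)"

definition q :: "nat \<Rightarrow> real" where
  "q n = real (partition_number n) / real n"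

end

theory Submission
  imports Defs "HOL-Complex_Analysis.Complex_Analysis" "HOL-Probability.Distributions"
begin

text \<open>
  The claim is \<open>n\<^sup>2 p(n-1) p(n+1) \<le> (n\<^sup>2 - 1) p(n)\<^sup>2\<close>. For large n it follows from the leading term of
  Rademacher's formula with an explicit error. Put \<open>\<mu> = (\<pi> / 6) sqrt (24 n - 1)\<close>. The generating
  function P satisfies \<open>P(exp(-2\<pi>z)) = sqrt z exp(\<pi>/12 (1/z - z)) P(exp(-2\<pi>/z))\<close> for \<open>Re z > 0\<close>, and
  p(n) is the integral of \<open>P(exp(-2\<pi>z)) exp(2\<pi>nz)\<close> over a segment of length 1 of a vertical line.
  Near the real axis the factor \<open>P(exp(-2\<pi>/z))\<close> is almost 1; without it the integrand can be moved to
  the circle through the saddle point, where it becomes a Gaussian integral with value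
  \<open>M = \<pi>\<^sup>2 / (6 sqrt 3) (\<mu> - 1) exp(\<mu>) / \<mu>\<^sup>3\<close>. Away from the real axis P is small. In total
  \<open>p(n) = M (1 + O(1 / \<mu>\<^sup>3))\<close> with constant 1 as soon as \<open>\<mu> \<ge> 72\<close>, while the second difference of
  ln M is at most \<open>- 9 / \<mu>\<^sup>3\<close>, which beats the errors and the factor \<open>1 - 1 / n\<^sup>2\<close>.
  The condition \<open>\<mu> \<ge> 72\<close> holds for \<open>n \<ge> 789\<close>; below that the values of p are computed from Euler's
  pentagonal recurrence.
\<close>

section \<open>The generating function of the partition numbers\<close>

text \<open>Every error is balanced at \<open>exp (2 / 3 * \<mu>)\<close>. The path of integration
  is the line Re z = 2 \<rho> / 3, not the line Re z = \<rho> through the saddle point, because it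
  cuts the circle |z| = \<rho>. On the chord inside the circle the factor
  \<open>P(exp(-2\<pi>/z))\<close> can be replaced by 1. Outside the circle \<rho> Re (1/z) is at
  most 2/3, so the modulus of the integrand alone is small enough and no oscillation has to be used
  there. The arc over the chord has half-angle arccos (2/3), and the Gaussian tails lost at its ends
  are again of size \<open>exp (2 / 3 * \<mu>)\<close>. Relative to M this is \<mu>^2 exp (-
  \<mu>/3) up to a constant; demanding 1/\<mu>^3 for it produces the threshold 72. The second
  difference of ln M is about - (pi^2/3)^2 / \<mu>^3, that is - 10.8 / \<mu>^3. The four relative
  errors and 1/n^2 cost about 5 / \<mu>^3, so rough constants suffice. The transformation formula is
  proved for positive real z only, where it is an identity between double series of positive terms;
  analytic continuation does the rest.\<close>

definition bounded_partitions :: "nat \<Rightarrow> nat \<Rightarrow> nat multiset set" where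
  "bounded_partitions m n = {M \<in> int_partitions n. \<forall>x\<in>#M. x \<le> m}"

text \<open>With bounded part sizes the generating function is a finite product, and the coefficient
  of x^n is constant from m = n on. Both the analytic product and Euler's recurrence are derived
  from this family.\<close>

definition bounded_partition_number :: "nat \<Rightarrow> nat \<Rightarrow> nat" where
  "bounded_partition_number m n = card (bounded_partitions m n)"

lemma bounded_partitions_0: "bounded_partitions 0 n = (if n = 0 then {{#}} else {})"
proof -
  have "M = {#}" if "M \<in> bounded_partitions 0 n" for M
    using that multiset_nonemptyE[of M] by (fastforce simp: bounded_partitions_def int_partitions_def)
  note * = this
  show ?thesis
  proof (cases "n = 0")
    case True
    have "{#} \<in> bounded_partitions 0 0"
      by (simp add: bounded_partitions_def int_partitions_def)
    thus ?thesis using * True by auto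
  next
    case False
    hence "{#} \<notin> bounded_partitions 0 n"
      by (simp add: bounded_partitions_def int_partitions_def)
    thus ?thesis using * False by auto
  qed
qed

lemma bounded_partitions_Suc:
  "bounded_partitions (Suc m) n = bounded_partitions m n \<union>
     (if Suc m \<le> n then add_mset (Suc m) ` bounded_partitions (Suc m) (n - Suc m) else {})"
proof (intro equalityI subsetI)
  fix M assume M: "M \<in> bounded_partitions (Suc m) n"
  show "M \<in> bounded_partitions m n \<union>
     (if Suc m \<le> n then add_mset (Suc m) ` bounded_partitions (Suc m) (n - Suc m) else {})"
  proof (cases "Suc m \<in># M")
    case False
    hence "\<forall>x\<in>#M. x \<le> m"
      using M by (metis (mono_tags, lifting) bounded_partitions_def le_Suc_eq mem_Collect_eq)
    thus ?thesis using M by (auto simp: bounded_partitions_def)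
  next
    case True
    then obtain N where N: "M = add_mset (Suc m) N"
      by (metis insert_DiffM)
    hence "N \<in> bounded_partitions (Suc m) (n - Suc m)" "Suc m \<le> n"
      using M by (auto simp: bounded_partitions_def int_partitions_def)
    thus ?thesis using N by auto
  qed
next
  fix M assume "M \<in> bounded_partitions m n \<union>
     (if Suc m \<le> n then add_mset (Suc m) ` bounded_partitions (Suc m) (n - Suc m) else {})"
  thus "M \<in> bounded_partitions (Suc m) n"
    by (auto simp: bounded_partitions_def int_partitions_def split: if_splits)
qed

text \<open>Needed because \<open>card\<close> is 0 on infinite sets. The recurrence lowers m or n,
  hence the nested inductions.\<close>

lemma finite_bounded_partitions [simp]: "finite (bounded_partitions m n)"
proof (induction m arbitrary: n)
  case 0
  show ?case by (simp add: bounded_partitions_0)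
next
  case (Suc m)
  show ?case
  proof (induction n rule: less_induct)
    case (less n)
    have "finite (if Suc m \<le> n then add_mset (Suc m) ` bounded_partitions (Suc m) (n - Suc m) else {})"
      using less[of "n - Suc m"] by auto
    thus ?case by (subst bounded_partitions_Suc) (use Suc in auto)
  qed
qed

lemma bounded_partition_number_0: "bounded_partition_number 0 n = (if n = 0 then 1 else 0)"
  by (simp add: bounded_partition_number_def bounded_partitions_0)

lemma bounded_partition_number_Suc:
  "bounded_partition_number (Suc m) n = bounded_partition_number m n +
     (if Suc m \<le> n then bounded_partition_number (Suc m) (n - Suc m) else 0)"
proof (cases "Suc m \<le> n")
  case True
  have "bounded_partitions m n \<inter> add_mset (Suc m) ` bounded_partitions (Suc m) (n - Suc m) = {}"
    by (auto simp: bounded_partitions_def)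
  moreover have "inj_on (add_mset (Suc m)) A" for A
    by (auto simp: inj_on_def)
  ultimately show ?thesis using True
    unfolding bounded_partition_number_def
    by (subst bounded_partitions_Suc) (simp add: card_Un_disjoint card_image)
next
  case False
  thus ?thesis
    unfolding bounded_partition_number_def by (subst bounded_partitions_Suc) simp
qed

lemma bounded_partition_number_eq:
  assumes "n \<le> m"
  shows   "bounded_partition_number m n = partition_number n"
proof -
  have "x \<le> m" if "M \<in> int_partitions n" "x \<in># M" for M x
    using that assms multi_member_split[OF that(2)] by (auto simp: int_partitions_def)
  hence "bounded_partitions m n = int_partitions n"
    by (auto simp: bounded_partitions_def)
  thus ?thesis by (simp add: bounded_partition_number_def partition_number_def)
qed

lemma bounded_partition_number_le: "bounded_partition_number m n \<le> partition_number n"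
proof -
  have "bounded_partitions m n \<subseteq> bounded_partitions (max m n) n"
    by (auto simp: bounded_partitions_def)
  hence "bounded_partition_number m n \<le> bounded_partition_number (max m n) n"
    unfolding bounded_partition_number_def by (intro card_mono) auto
  thus ?thesis by (simp add: bounded_partition_number_eq)
qed

lemma partition_number_0 [simp]: "partition_number 0 = 1"
  using bounded_partition_number_eq[of 0 0] by (simp add: bounded_partition_number_0)

lemma power_Suc_lt_one:
  fixes r :: real
  assumes "0 \<le> r" "r < 1"
  shows "r ^ Suc k < 1"
  using assms mult_left_le[of "r ^ k" r] power_le_one[of r k] by simp

text \<open>The recurrence bounds the truncated sum by r^(m+1) times itself plus the previous
  truncated sum; solving for it gives one more factor. All sums are finite, so no convergence is
  presupposed: convergence is deduced from this bound.\<close>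

lemma sum_bounded_partition_number_le:
  fixes r :: real
  assumes "0 \<le> r" "r < 1"
  shows "(\<Sum>n\<le>N. bounded_partition_number m n * r ^ n) \<le> (\<Prod>k=1..m. 1 / (1 - r ^ k))"
proof (induction m)
  case 0
  have "(\<Sum>n\<le>N. bounded_partition_number 0 n * r ^ n) = (\<Sum>n\<in>{0}. r ^ n)"
    by (rule sum.mono_neutral_cong_right) (auto simp: bounded_partition_number_0)
  thus ?case by simp
next
  case (Suc m)
  let ?a = "\<lambda>n. real (bounded_partition_number (Suc m) n)"
  let ?S = "\<Sum>n\<le>N. ?a n * r ^ n"
  have "?S = (\<Sum>n\<le>N. bounded_partition_number m n * r ^ n) +
             (\<Sum>n\<le>N. if Suc m \<le> n then ?a (n - Suc m) * r ^ n else 0)"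
    unfolding sum.distrib [symmetric]
    by (intro sum.cong refl, subst bounded_partition_number_Suc) (auto simp: algebra_simps)
  also have "(\<Sum>n\<le>N. if Suc m \<le> n then ?a (n - Suc m) * r ^ n else 0) =
             (\<Sum>n | n \<le> N \<and> Suc m \<le> n. ?a (n - Suc m) * r ^ n)"
    by (subst sum.inter_filter [symmetric]) auto
  also have "\<dots> = (\<Sum>n | n + Suc m \<le> N. ?a n * r ^ (n + Suc m))"
    by (rule sum.reindex_bij_witness[of _ "\<lambda>n. n + Suc m" "\<lambda>n. n - Suc m"]) auto
  \<comment> \<open>Extending the range back to n <= N makes the shifted sum a multiple of
    \<open>?S\<close>; all terms are nonnegative.\<close>
  also have "\<dots> \<le> (\<Sum>n\<le>N. ?a n * r ^ (n + Suc m))"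
    using assms by (intro sum_mono2) auto
  also have "\<dots> = r ^ Suc m * ?S"
    by (simp add: sum_distrib_left power_add mult_ac)
  finally have "?S * (1 - r ^ Suc m) \<le> (\<Sum>n\<le>N. bounded_partition_number m n * r ^ n)"
    by (simp add: algebra_simps)
  also note Suc
  finally have "?S * (1 - r ^ Suc m) \<le> (\<Prod>k=1..m. 1 / (1 - r ^ k))" .
  moreover have "r ^ Suc m < 1"
    using assms by (rule power_Suc_lt_one)
  ultimately show ?case by (simp add: field_simps)
qed

lemma minus_ln_one_minus_le:
  fixes x :: real
  assumes "0 \<le> x" "x \<le> r" "r < 1"
  shows "- ln (1 - x) \<le> x / (1 - r)"
proof -
  have "- ln (1 - x) = ln (1 / (1 - x))" using assms by (simp add: ln_div)
  also have "\<dots> \<le> 1 / (1 - x) - 1" using assms by (intro ln_le_minus_one) auto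
  also have "\<dots> = x / (1 - x)" using assms by (simp add: field_simps)
  also have "\<dots> \<le> x / (1 - r)" using assms by (intro divide_left_mono) auto
  finally show ?thesis .
qed

lemma summable_minus_ln_power:
  fixes r :: real
  assumes "0 \<le> r" "r < 1"
  shows "summable (\<lambda>k. - ln (1 - r ^ Suc k))"
proof (rule summable_comparison_test')
  show "summable (\<lambda>k. r ^ Suc k / (1 - r))"
    using assms by (intro summable_divide) (simp add: summable_geometric)
  fix k :: nat
  have "r ^ Suc k \<le> r" using assms by (simp add: power_Suc_le_self mult_left_le power_le_one)
  thus "norm (- ln (1 - r ^ Suc k)) \<le> r ^ Suc k / (1 - r)"
    using minus_ln_one_minus_le[of "r ^ Suc k" r] assms by simp
qed

lemma prod_inverse_eq_exp:
  fixes r :: real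
  assumes "0 \<le> r" "r < 1"
  shows "(\<Prod>k=1..m. 1 / (1 - r ^ k)) = exp (\<Sum>k<m. - ln (1 - r ^ Suc k))"
proof (induction m)
  case (Suc m)
  have "r ^ Suc m < 1"
    using assms by (rule power_Suc_lt_one)
  thus ?case using Suc by (simp add: exp_diff)
qed auto

text \<open>A partial sum up to N involves only parts of size at most N. It is therefore below a
  finite product, and these products stay below the infinite one.\<close>

lemma summable_partition_number:
  fixes r :: real
  assumes "0 \<le> r" "r < 1"
  shows "summable (\<lambda>n. partition_number n * r ^ n)"
proof (rule bounded_imp_summable)
  fix N
  have nn: "- ln (1 - r ^ Suc k) \<ge> 0" for k
    using assms power_Suc_lt_one[of r k] zero_le_power[of r "Suc k"] by (simp add: ln_le_zero_iff del: power_Suc)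
  have "(\<Sum>n\<le>N. partition_number n * r ^ n) = (\<Sum>n\<le>N. bounded_partition_number N n * r ^ n)"
    by (intro sum.cong) (auto simp: bounded_partition_number_eq)
  also have "\<dots> \<le> exp (\<Sum>k<N. - ln (1 - r ^ Suc k))"
    using sum_bounded_partition_number_le[OF assms] prod_inverse_eq_exp[OF assms] by metis
  also have "\<dots> \<le> exp (\<Sum>k. - ln (1 - r ^ Suc k))"
    unfolding exp_le_cancel_iff using assms nn
    by (intro sum_le_suminf summable_minus_ln_power) auto
  finally show "(\<Sum>n\<le>N. partition_number n * r ^ n) \<le> exp (\<Sum>k. - ln (1 - r ^ Suc k))" .
qed (use assms in auto)

section \<open>The power series of p, its infinite product and bounds for both\<close>

definition partition_gf :: "complex \<Rightarrow> complex" where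
  "partition_gf z = (\<Sum>n. of_nat (partition_number n) * z ^ n)"

lemma sums_bounded_partition_number:
  fixes z :: complex
  assumes "norm z < 1"
  shows "(\<lambda>n. of_nat (bounded_partition_number m n) * z ^ n) sums (\<Prod>k=1..m. 1 / (1 - z ^ k))"
proof -
  have summ: "summable (\<lambda>n. of_nat (bounded_partition_number m n) * z ^ n)" for m
  proof (rule summable_comparison_test')
    show "summable (\<lambda>n. partition_number n * norm z ^ n)"
      using assms by (intro summable_partition_number) auto
    show "norm (of_nat (bounded_partition_number m n) * z ^ n) \<le> partition_number n * norm z ^ n" for n
      using bounded_partition_number_le[of m n] by (auto simp: norm_mult norm_power intro!: mult_right_mono)
  qed
  show ?thesis
  proof (induction m)
    case 0
    have "(\<lambda>n. of_nat (bounded_partition_number 0 n) * z ^ n) = (\<lambda>n. if n = 0 then 1 else 0)"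
      by (auto simp: bounded_partition_number_0)
    thus ?case using sums_single[of 0 "\<lambda>_. 1 :: complex"] by simp
  next
    case (Suc m)
    define a where "a = (\<lambda>n. of_nat (bounded_partition_number (Suc m) n) * z ^ n)"
    define b where "b = (\<lambda>n. if Suc m \<le> n then z ^ Suc m * a (n - Suc m) else 0)"
    have "b sums (z ^ Suc m * suminf a)"
    proof -
      have "(\<lambda>n. b (n + Suc m)) sums (z ^ Suc m * suminf a)"
        unfolding b_def using sums_mult[OF summable_sums[OF summ[of "Suc m"]], of "z ^ Suc m"]
        by (simp add: a_def)
      thus ?thesis
        by (subst (asm) sums_iff_shift) (auto simp: b_def)
    qed
    from sums_add[OF Suc this]
    have "(\<lambda>n. of_nat (bounded_partition_number m n) * z ^ n + b n) sums
            ((\<Prod>k=1..m. 1 / (1 - z ^ k)) + z ^ Suc m * suminf a)" .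
    also have "(\<lambda>n. of_nat (bounded_partition_number m n) * z ^ n + b n) = a"
      unfolding a_def b_def fun_eq_iff
    proof
      fix n
      show "of_nat (bounded_partition_number m n) * z ^ n +
           (if Suc m \<le> n then z ^ Suc m * (of_nat (bounded_partition_number (Suc m) (n - Suc m)) *
              z ^ (n - Suc m)) else 0) = of_nat (bounded_partition_number (Suc m) n) * z ^ n"
        by (subst bounded_partition_number_Suc[of m n])
           (auto simp: algebra_simps simp flip: power_add power_Suc)
    qed
    \<comment> \<open>Convergence is already known by comparison with p, so the shift relation can
      be solved for the sum.\<close>
    finally have "suminf a = (\<Prod>k=1..m. 1 / (1 - z ^ k)) + z ^ Suc m * suminf a"
      by (simp add: sums_iff)
    moreover have "z ^ Suc m \<noteq> 1"
    proof
      assume "z ^ Suc m = 1"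
      hence "norm z ^ Suc m = 1" by (metis norm_one norm_power)
      thus False using power_Suc_lt_one[of "norm z" m] assms by simp
    qed
    ultimately have "suminf a = (\<Prod>k=1..Suc m. 1 / (1 - z ^ k))"
      by (simp add: field_simps)
    thus ?case using summable_sums[OF summ[of "Suc m"]] by (simp add: a_def)
  qed
qed

text \<open>Tannery's theorem: each coefficient is eventually constant in m, and p(n) |z|^n is a
  summable majorant for all m.\<close>

lemma partition_gf_product:
  assumes "norm z < 1"
  shows "(\<lambda>m. \<Prod>k=1..m. 1 / (1 - z ^ k)) \<longlonglongrightarrow> partition_gf z"
proof -
  have "(\<lambda>m. \<Sum>n. of_nat (bounded_partition_number m n) * z ^ n) \<longlonglongrightarrow>
          (\<Sum>n. of_nat (partition_number n) * z ^ n)"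
  proof (rule tannerys_theorem[THEN conjunct2, THEN conjunct2])
    show "summable (\<lambda>n. partition_number n * norm z ^ n)"
      using assms by (intro summable_partition_number) auto
    show "\<forall>\<^sub>F (k, n) in sequentially \<times>\<^sub>F sequentially.
       norm (of_nat (bounded_partition_number n k) * z ^ k) \<le> partition_number k * norm z ^ k"
      using bounded_partition_number_le
      by (intro always_eventually) (auto simp: norm_mult norm_power intro!: mult_right_mono)
    fix n
    have "\<forall>\<^sub>F m in sequentially. of_nat (bounded_partition_number m n) * z ^ n = of_nat (partition_number n) * z ^ n"
      using eventually_ge_at_top[of n] by eventually_elim (simp add: bounded_partition_number_eq)
    thus "(\<lambda>m. of_nat (bounded_partition_number m n) * z ^ n) \<longlonglongrightarrow> of_nat (partition_number n) * z ^ n"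
      by (rule tendsto_eventually)
  qed auto
  also have "(\<lambda>m. \<Sum>n. of_nat (bounded_partition_number m n) * z ^ n) = (\<lambda>m. \<Prod>k=1..m. 1 / (1 - z ^ k))"
    using sums_bounded_partition_number[OF assms] by (simp add: sums_iff)
  finally show ?thesis by (simp add: partition_gf_def)
qed

lemma partition_gf_of_real_eq_suminf:
  fixes r :: real
  assumes "0 \<le> r" "r < 1"
  shows "partition_gf (of_real r) = of_real (\<Sum>n. partition_number n * r ^ n)"
  unfolding partition_gf_def
  using suminf_of_real[OF summable_partition_number[OF assms], where 'a = complex] by simp

lemma partition_gf_of_real:
  fixes r :: real
  assumes "0 \<le> r" "r < 1"
  shows "partition_gf (of_real r) = of_real (exp (\<Sum>k. - ln (1 - r ^ Suc k)))"
proof -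
  have "(\<lambda>m. \<Prod>k=1..m. 1 / (1 - complex_of_real r ^ k)) =
        (\<lambda>m. complex_of_real (exp (\<Sum>k<m. - ln (1 - r ^ Suc k))))"
    using assms by (subst prod_inverse_eq_exp [symmetric]) auto
  moreover have "(\<lambda>m. complex_of_real (exp (\<Sum>k<m. - ln (1 - r ^ Suc k)))) \<longlonglongrightarrow>
      of_real (exp (\<Sum>k. - ln (1 - r ^ Suc k)))"
    using summable_minus_ln_power[OF assms] by (intro tendsto_intros summable_LIMSEQ)
  ultimately show ?thesis
    using partition_gf_product[of "of_real r"] assms LIMSEQ_unique by fastforce
qed

lemma norm_partition_gf_le:
  fixes r :: real
  assumes "norm z \<le> r" "r < 1"
  shows "norm (partition_gf z) \<le> (\<Sum>n. partition_number n * r ^ n)"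
proof -
  have r: "0 \<le> r" using assms norm_ge_zero order_trans by blast
  have le: "norm (of_nat (partition_number n) * z ^ n) \<le> partition_number n * r ^ n" for n
    using assms by (auto simp: norm_mult norm_power intro!: mult_left_mono power_mono)
  show ?thesis unfolding partition_gf_def
    using summable_partition_number[OF r assms(2)] le by (intro norm_suminf_le) auto
qed

text \<open>As in Schwarz's lemma, the missing constant term yields the factor |z| / r.\<close>

lemma norm_partition_gf_minus_one_le:
  fixes r :: real
  assumes "norm z \<le> r" "0 < r" "r < 1"
  shows "norm (partition_gf z - 1) \<le> norm z / r * ((\<Sum>n. partition_number n * r ^ n) - 1)"
proof -
  have "summable (\<lambda>n. partition_number n * r ^ n)"
    using assms by (intro summable_partition_number) auto
  hence r1: "summable (\<lambda>n. partition_number (Suc n) * r ^ Suc n)"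
    by (subst summable_Suc_iff)
  have s: "(\<Sum>n. partition_number (Suc n) * r ^ Suc n) = (\<Sum>n. partition_number n * r ^ n) - 1"
    using suminf_split_head[OF \<open>summable (\<lambda>n. partition_number n * r ^ n)\<close>] by simp
  have sz: "summable (\<lambda>n. of_nat (partition_number n) * z ^ n)"
  proof (rule summable_comparison_test')
    show "summable (\<lambda>n. partition_number n * r ^ n)" by fact
    show "norm (of_nat (partition_number n) * z ^ n) \<le> partition_number n * r ^ n" for n
      using assms by (auto simp: norm_mult norm_power intro!: mult_left_mono power_mono)
  qed
  have "norm (\<Sum>n. of_nat (partition_number (Suc n)) * z ^ Suc n) \<le>
          (\<Sum>n. norm z / r * (partition_number (Suc n) * r ^ Suc n))"
  proof (rule norm_suminf_le)
    show "summable (\<lambda>n. norm z / r * (partition_number (Suc n) * r ^ Suc n))"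
      using r1 by (rule summable_mult)
    fix n
    have "norm z ^ n \<le> r ^ n" using assms by (intro power_mono) auto
    thus "norm (of_nat (partition_number (Suc n)) * z ^ Suc n) \<le>
            norm z / r * (partition_number (Suc n) * r ^ Suc n)"
      using assms mult_left_mono[of "norm z ^ n" "r ^ n" "partition_number (Suc n) * norm z"]
      by (simp add: norm_mult norm_power mult_ac)
  qed
  also have "(\<Sum>n. of_nat (partition_number (Suc n)) * z ^ Suc n) = partition_gf z - 1"
    unfolding partition_gf_def using suminf_split_head[OF sz] by simp
  also have "(\<Sum>n. norm z / r * (partition_number (Suc n) * r ^ Suc n)) =
               norm z / r * ((\<Sum>n. partition_number n * r ^ n) - 1)"
    using suminf_mult[OF r1, of "norm z / r"] s by simp
  finally show ?thesis .
qed

lemma holomorphic_partition_gf: "partition_gf holomorphic_on ball 0 1"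
proof (rule power_series_holomorphic)
  fix w :: complex assume w: "w \<in> ball 0 1"
  have "summable (\<lambda>n. of_nat (partition_number n) * w ^ n)"
  proof (rule summable_comparison_test')
    show "summable (\<lambda>n. partition_number n * norm w ^ n)"
      using w by (intro summable_partition_number) auto
  qed (auto simp: norm_mult norm_power)
  thus "(\<lambda>n. of_nat (partition_number n) * (w - 0) ^ n) sums partition_gf w"
    by (simp add: partition_gf_def summable_sums)
qed

lemma minus_Ln_one_minus_sums:
  fixes w :: complex
  assumes "norm w < 1"
  shows "(\<lambda>n. w ^ Suc n / of_nat (Suc n)) sums (- Ln (1 - w))"
proof -
  have "(\<lambda>n. (-1)^Suc n / of_nat n * (-w)^n) sums Ln (1 + (-w))"
    by (rule Ln_series) (use assms in auto)
  hence "(\<lambda>n. - ((-1)^Suc n / of_nat n * (-w)^n)) sums (- Ln (1 - w))"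
    using sums_minus by fastforce
  also have "(\<lambda>n. - ((-1)^Suc n / of_nat n * (-w)^n)) = (\<lambda>n. w ^ n / of_nat n)"
  proof
    fix n
    have "- ((-1)^Suc n / of_nat n * (-w)^n) = ((-1)^n * (-w)^n) / of_nat n" by simp
    also have "(-1)^n * (-w)^n = w ^ n" by (simp flip: power_mult_distrib)
    finally show "- ((-1)^Suc n / of_nat n * (-w)^n) = w ^ n / of_nat n" .
  qed
  finally show ?thesis by (subst sums_Suc_iff) simp
qed

lemma minus_ln_one_minus_sums:
  fixes x :: real
  assumes "0 \<le> x" "x < 1"
  shows "(\<lambda>n. x ^ Suc n / of_nat (Suc n)) sums (- ln (1 - x))"
proof -
  have "Ln (1 - of_real x) = of_real (ln (1 - x))"
    using assms Ln_of_real[of "1 - x"] by simp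
  thus ?thesis
    using minus_Ln_one_minus_sums[of "of_real x"] assms
      sums_of_real_iff[where ?'a = complex, of "\<lambda>n. x ^ Suc n / of_nat (Suc n)" "- ln (1 - x)"]
    by simp
qed

text \<open>Split the series of - Ln (1 - w) after its first term; the real part of each later term
  is at most its modulus.\<close>

lemma minus_ln_norm_one_minus_le:
  assumes "norm w < 1"
  shows "- ln (norm (1 - w)) \<le> Re w + (- ln (1 - norm w) - norm w)"
proof -
  have "1 - w \<noteq> 0" using assms by auto
  have s1: "(\<lambda>n. Re (w ^ Suc n / of_nat (Suc n))) sums (- ln (norm (1 - w)))"
    using sums_Re[OF minus_Ln_one_minus_sums[OF assms]] \<open>1 - w \<noteq> 0\<close> by simp
  have s2: "(\<lambda>n. norm w ^ Suc n / of_nat (Suc n)) sums (- ln (1 - norm w))"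
    using minus_ln_one_minus_sums[of "norm w"] assms by simp
  have t1: "(\<lambda>n. Re (w ^ Suc (Suc n) / of_nat (Suc (Suc n)))) sums (- ln (norm (1 - w)) - Re w)"
    using s1 by (subst sums_Suc_iff) simp
  have t2: "(\<lambda>n. norm w ^ Suc (Suc n) / of_nat (Suc (Suc n))) sums (- ln (1 - norm w) - norm w)"
    using s2 by (subst sums_Suc_iff) simp
  have "Re (w ^ Suc (Suc n) / of_nat (Suc (Suc n))) \<le> norm w ^ Suc (Suc n) / of_nat (Suc (Suc n))" for n
    using complex_Re_le_cmod[of "w ^ Suc (Suc n) / of_nat (Suc (Suc n))"]
    by (simp only: norm_divide norm_power norm_of_nat)
  from sums_le[OF this t1 t2] show ?thesis by linarith
qed

text \<open>Only the linear term of the logarithm of each factor is estimated with its oscillation; all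
  higher terms are bounded by their values at the modulus.\<close>
lemma norm_partition_gf_minor_le:
  assumes z: "norm z < 1" "z \<noteq> 0"
  defines "r \<equiv> norm z"
  shows "norm (partition_gf z) \<le> exp ((\<Sum>k. - ln (1 - r ^ Suc k)) - r / (1 - r) + norm (z / (1 - z)))"
proof -
  have r: "0 < r" "r < 1" using z by (auto simp: r_def)
  have rs: "(\<lambda>k. r ^ Suc k) sums (r / (1 - r))"
    using sums_mult[OF geometric_sums[of r], of r] r by (simp add: field_simps)
  \<comment> \<open>The linear terms add up to z / (1 - z). The gain over the trivial bound is the
    replacement of r / (1 - r) by the modulus of this number, which is much smaller when z is far
    from 1.\<close>
  have zs: "(\<lambda>k. z ^ Suc k) sums (z / (1 - z))"
    using sums_mult[OF geometric_sums[of z], of z] z by (simp add: field_simps)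
  have zk: "norm (z ^ Suc k) < 1" for k
    using r power_Suc_lt_one[of r k] by (simp add: norm_power norm_mult r_def)
  let ?b = "\<lambda>k. Re (z ^ Suc k) + (- ln (1 - r ^ Suc k) - r ^ Suc k)"
  have bs: "?b sums (Re (z / (1 - z)) + ((\<Sum>k. - ln (1 - r ^ Suc k)) - r / (1 - r)))"
    using r by (intro sums_add sums_diff sums_Re zs rs summable_sums summable_minus_ln_power) auto
  have "(\<lambda>m. norm (\<Prod>k=1..m. 1 / (1 - z ^ k))) \<longlonglongrightarrow> norm (partition_gf z)"
    using z by (intro tendsto_intros partition_gf_product)
  moreover have "(\<lambda>m. exp (\<Sum>k<m. ?b k)) \<longlonglongrightarrow>
      exp (Re (z / (1 - z)) + ((\<Sum>k. - ln (1 - r ^ Suc k)) - r / (1 - r)))"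
    using bs unfolding sums_def by (intro tendsto_exp)
  moreover have "norm (\<Prod>k=1..m. 1 / (1 - z ^ k)) \<le> exp (\<Sum>k<m. ?b k)" for m
  proof (induction m)
    case (Suc m)
    have "z ^ Suc m \<noteq> 1" using zk[of m] by auto
    hence "norm (1 / (1 - z ^ Suc m)) = exp (- ln (norm (1 - z ^ Suc m)))"
      by (simp add: exp_minus norm_divide field_simps)
    also have "\<dots> \<le> exp (?b m)"
      using minus_ln_norm_one_minus_le[OF zk[of m]] by (simp add: norm_power norm_mult r_def)
    finally have le: "norm (1 / (1 - z ^ Suc m)) \<le> exp (?b m)" .
    have "norm (\<Prod>k=1..Suc m. 1 / (1 - z ^ k)) = norm (\<Prod>k=1..m. 1 / (1 - z ^ k)) * norm (1 / (1 - z ^ Suc m))"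
      by (simp add: norm_mult norm_divide)
    also have "\<dots> \<le> exp (\<Sum>k<m. ?b k) * exp (?b m)"
      using Suc le by (intro mult_mono) auto
    also have "\<dots> = exp (\<Sum>k<Suc m. ?b k)" by (simp add: exp_add)
    finally show ?case .
  qed auto
  ultimately have "norm (partition_gf z) \<le> exp (Re (z / (1 - z)) + ((\<Sum>k. - ln (1 - r ^ Suc k)) - r / (1 - r)))"
    by (intro LIMSEQ_le[of "\<lambda>m. norm (\<Prod>k=1..m. 1 / (1 - z ^ k))"]) auto
  also have "\<dots> \<le> exp ((\<Sum>k. - ln (1 - r ^ Suc k)) - r / (1 - r) + norm (z / (1 - z)))"
    using complex_Re_le_cmod[of "z / (1 - z)"] by simp
  finally show ?thesis .
qed

section \<open>The modular transformation on the positive reals\<close>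

text \<open>The logarithm of Euler's sine product at the point i x.\<close>

lemma sums_ln_sinh:
  fixes x :: real
  assumes "x > 0"
  shows "(\<lambda>m. ln (1 + x\<^sup>2 / (real (Suc m))\<^sup>2)) sums ln (sinh (pi * x) / (pi * x))"
proof -
  have pos: "1 + x\<^sup>2 / (real k)\<^sup>2 > 0" for k
    by (rule add_pos_nonneg) auto
  have "(\<lambda>n. of_real pi * (\<i> * of_real x) * (\<Prod>k=1..n. 1 - (\<i> * of_real x)^2 / of_nat k^2)) \<longlonglongrightarrow>
          sin (of_real pi * (\<i> * of_real x))"
    by (rule sin_product_formula_complex)
  also have "(\<lambda>n. of_real pi * (\<i> * of_real x) * (\<Prod>k=1..n. 1 - (\<i> * of_real x)^2 / of_nat k^2)) =
             (\<lambda>n. \<i> * of_real (pi * x * (\<Prod>k=1..n. 1 + x\<^sup>2 / (real k)\<^sup>2)))"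
    by (simp add: power_mult_distrib fun_eq_iff)
  also have "sin (of_real pi * (\<i> * of_real x)) = \<i> * of_real (sinh (pi * x))"
    using sin_i_times[of "of_real (pi * x)"] by (simp add: sinh_field_def exp_minus mult_ac flip: exp_of_real)
  finally have "(\<lambda>n. \<i> * of_real (pi * x * (\<Prod>k=1..n. 1 + x\<^sup>2 / (real k)\<^sup>2))) \<longlonglongrightarrow>
                  \<i> * complex_of_real (sinh (pi * x))" .
  hence "(\<lambda>n. - \<i> * (\<i> * of_real (pi * x * (\<Prod>k=1..n. 1 + x\<^sup>2 / (real k)\<^sup>2)))) \<longlonglongrightarrow>
                  - \<i> * (\<i> * complex_of_real (sinh (pi * x)))"
    by (rule tendsto_mult_left)
  hence "(\<lambda>n. complex_of_real (pi * x * (\<Prod>k=1..n. 1 + x\<^sup>2 / (real k)\<^sup>2))) \<longlonglongrightarrow> of_real (sinh (pi * x))"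
    by (simp flip: mult.assoc)
  hence "(\<lambda>n. pi * x * (\<Prod>k=1..n. 1 + x\<^sup>2 / (real k)\<^sup>2)) \<longlonglongrightarrow> sinh (pi * x)"
    by (simp only: tendsto_of_real_iff)
  hence "(\<lambda>n. pi * x * (\<Prod>k=1..n. 1 + x\<^sup>2 / (real k)\<^sup>2) / (pi * x)) \<longlonglongrightarrow> sinh (pi * x) / (pi * x)"
    using assms by (intro tendsto_divide tendsto_const) auto
  hence "(\<lambda>n. \<Prod>k=1..n. 1 + x\<^sup>2 / (real k)\<^sup>2) \<longlonglongrightarrow> sinh (pi * x) / (pi * x)"
    using assms by simp
  hence "(\<lambda>n. ln (\<Prod>k=1..n. 1 + x\<^sup>2 / (real k)\<^sup>2)) \<longlonglongrightarrow> ln (sinh (pi * x) / (pi * x))"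
    using assms by (intro tendsto_ln) auto
  also have "(\<lambda>n. ln (\<Prod>k=1..n. 1 + x\<^sup>2 / (real k)\<^sup>2)) = (\<lambda>n. \<Sum>m<n. ln (1 + x\<^sup>2 / (real (Suc m))\<^sup>2))"
  proof
    fix n
    show "ln (\<Prod>k=1..n. 1 + x\<^sup>2 / (real k)\<^sup>2) = (\<Sum>m<n. ln (1 + x\<^sup>2 / (real (Suc m))\<^sup>2))"
    proof (induction n)
      case (Suc n)
      have "(\<Prod>k=1..n. 1 + x\<^sup>2 / (real k)\<^sup>2) > 0"
        using pos by (intro prod_pos) auto
      hence "ln (\<Prod>k=1..Suc n. 1 + x\<^sup>2 / (real k)\<^sup>2) =
               ln (\<Prod>k=1..n. 1 + x\<^sup>2 / (real k)\<^sup>2) + ln (1 + x\<^sup>2 / (real (Suc n))\<^sup>2)"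
        using pos[of "Suc n"] by (subst ln_mult_pos [symmetric]) auto
      thus ?case using Suc by simp
    qed auto
  qed
  finally show ?thesis by (simp add: sums_def)
qed

lemma summable_inverse_Suc_squares: "summable (\<lambda>m. 1 / (real (Suc m))\<^sup>2)"
  using inverse_squares_sums by (simp add: sums_iff add_ac)

text \<open>The logarithmic derivative of the product for sinh, taken term by term. Working on a
  bounded interval gives the majorant 2 (x + 1) / m^2 for the derivatives.\<close>

lemma coth_partial_fractions:
  fixes x :: real
  assumes x: "x > 0"
  shows "(\<lambda>m. 2 * x / (x\<^sup>2 + (real (Suc m))\<^sup>2)) sums (pi * cosh (pi * x) / sinh (pi * x) - 1 / x)"
proof -
  define f where "f = (\<lambda>m x. ln (1 + x\<^sup>2 / (real (Suc m))\<^sup>2))"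
  define f' where "f' = (\<lambda>m x. 2 * x / (x\<^sup>2 + (real (Suc m))\<^sup>2))"
  let ?S = "{0<..<x + 1}"
  have der: "(f m has_field_derivative f' m y) (at y within ?S)" for m y
  proof -
    define c where "c = (real (Suc m))\<^sup>2"
    have c: "c > 0" by (simp add: c_def)
    have pos: "1 + y\<^sup>2 / c > 0" using c by (intro add_pos_nonneg) auto
    have "((\<lambda>y. ln (1 + y\<^sup>2 / c)) has_field_derivative (inverse (1 + y\<^sup>2 / c) * (2 * y / c))) (at y within ?S)"
      using pos c by (auto intro!: derivative_eq_intros simp: field_simps)
    also have "inverse (1 + y\<^sup>2 / c) * (2 * y / c) = 2 * y / (c * (1 + y\<^sup>2 / c))"
      by (simp add: divide_inverse mult_ac)
    also have "c * (1 + y\<^sup>2 / c) = y\<^sup>2 + c" using c by (simp add: field_simps)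
    finally show ?thesis by (simp add: f_def f'_def c_def)
  qed
  have bound: "norm (f' m y) \<le> 2 * (x + 1) * (1 / (real (Suc m))\<^sup>2)" if "y \<in> ?S" for m y
  proof -
    have "f' m y \<le> 2 * (x + 1) / (real (Suc m))\<^sup>2"
      unfolding f'_def using that x by (intro frac_le) auto
    moreover have "f' m y \<ge> 0" unfolding f'_def using that by auto
    ultimately show ?thesis by simp
  qed
  have unif: "uniformly_convergent_on ?S (\<lambda>n y. \<Sum>i<n. f' i y)"
  proof (rule Weierstrass_m_test')
    show "summable (\<lambda>m. 2 * (x + 1) * (1 / (real (Suc m))\<^sup>2))"
      by (intro summable_mult summable_inverse_Suc_squares)
  qed (rule bound)
  have summ: "summable (\<lambda>m. f m y)" if "y > 0" for y
    using sums_ln_sinh[OF that] by (simp add: f_def sums_iff)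
  have *: "((\<lambda>y. \<Sum>m. f m y) has_field_derivative (\<Sum>m. f' m x)) (at x)"
    by (rule has_field_derivative_series'(2)[of ?S f f' x]) (use x der unif summ in auto)
  have "eventually (\<lambda>y. y \<in> {0<..}) (nhds x)"
    using x by (intro eventually_nhds_in_open) auto
  hence "eventually (\<lambda>y. (\<Sum>m. f m y) = ln (sinh (pi * y) / (pi * y))) (nhds x)"
    by eventually_elim (use sums_ln_sinh in \<open>auto simp: f_def sums_iff\<close>)
  with * have **: "((\<lambda>y. ln (sinh (pi * y) / (pi * y))) has_field_derivative (\<Sum>m. f' m x)) (at x)"
    by (subst (asm) DERIV_cong_ev) auto
  have "((\<lambda>y. ln (sinh (pi * y) / (pi * y))) has_field_derivative
          (pi * cosh (pi * x) / sinh (pi * x) - 1 / x)) (at x)"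
    using x by (auto intro!: derivative_eq_intros simp: field_simps power2_eq_square)
  with ** have "(\<Sum>m. f' m x) = pi * cosh (pi * x) / sinh (pi * x) - 1 / x"
    by (rule DERIV_unique)
  moreover have "summable (\<lambda>m. f' m x)"
  proof (rule summable_comparison_test')
    show "summable (\<lambda>m. 2 * (x + 1) * (1 / (real (Suc m))\<^sup>2))"
      by (intro summable_mult summable_inverse_Suc_squares)
  qed (use bound x in auto)
  ultimately show ?thesis by (simp add: sums_iff f'_def)
qed

text \<open>With \<open>a(k, m) = t / (\<pi> (k\<^sup>2 t\<^sup>2 + m\<^sup>2))\<close>, the partial fractions of coth turn the difference of
  the two logarithms into the sum over k of the sum over m of \<open>a(k, m) - a(m, k)\<close>. This iterated
  sum does not vanish: cutting k off at K, the square \<open>m \<le> K\<close> cancels and the strip \<open>m > K\<close>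
  contributes \<open>ln t / 2\<close> in the limit.\<close>
definition transform_term :: "real \<Rightarrow> nat \<Rightarrow> nat \<Rightarrow> real" where
  "transform_term t k m = t / (pi * ((real k * t)\<^sup>2 + (real m)\<^sup>2))"

lemma transform_term_swap:
  assumes "t > 0"
  shows "transform_term (1 / t) k m = transform_term t m k"
  using assms unfolding transform_term_def by (simp add: field_simps power2_eq_square)

text \<open>From coth (pi k t) = 1 + 2 / (exp (2 pi k t) - 1). Of the three terms the first belongs
  to the Lambert series of ln P, the second leads to the sum of 1/k^2, and the third does not depend
  on t, so it cancels against its counterpart for 1/t.\<close>

lemma transform_term_sums:
  fixes k :: nat and t :: real
  assumes t: "t > 0" and "k > 0"
  shows "(\<lambda>m. transform_term t k (Suc m)) sums
           (1 / k * (1 / (exp (2 * pi * k * t) - 1)) - 1 / (2 * pi * t) * (1 / k\<^sup>2) + 1 / (2 * k))"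
proof -
  let ?x = "k * t"
  have x: "?x > 0" using assms by simp
  have "(\<lambda>m. 1 / (2 * pi * k) * (2 * ?x / (?x\<^sup>2 + (real (Suc m))\<^sup>2))) sums
          (1 / (2 * pi * k) * (pi * cosh (pi * ?x) / sinh (pi * ?x) - 1 / ?x))"
    by (intro sums_mult coth_partial_fractions x)
  also have "(\<lambda>m. 1 / (2 * pi * k) * (2 * ?x / (?x\<^sup>2 + (real (Suc m))\<^sup>2))) = (\<lambda>m. transform_term t k (Suc m))"
    using assms by (simp add: transform_term_def fun_eq_iff del: of_nat_Suc)
  also have "pi * cosh (pi * ?x) / sinh (pi * ?x) = pi * (2 / (exp (2 * pi * k * t) - 1) + 1)"
  proof -
    define e where "e = exp (pi * ?x)"
    have e: "e > 1" using x by (simp add: e_def)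
    have e2: "e\<^sup>2 > 1" using e by (simp add: one_less_power)
    have 1: "exp (2 * pi * k * t) = e\<^sup>2"
      unfolding e_def by (simp add: power2_eq_square mult_ac flip: exp_add)
    have 2: "cosh (pi * ?x) = (e + 1 / e) / 2" "sinh (pi * ?x) = (e - 1 / e) / 2"
      by (simp_all add: cosh_field_def sinh_field_def e_def exp_minus field_simps)
    have "(e + 1 / e) / 2 / ((e - 1 / e) / 2) = 2 / (e\<^sup>2 - 1) + 1"
    proof -
      have "e * e \<noteq> 1" using e2 by (simp add: power2_eq_square)
      thus ?thesis using e by (simp add: divide_simps power2_eq_square)
    qed
    thus ?thesis unfolding times_divide_eq_right [symmetric] 1 2 by simp
  qed
  also have "1 / (2 * pi * k) * (pi * (2 / (exp (2 * pi * k * t) - 1) + 1) - 1 / ?x) =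
     1 / k * (1 / (exp (2 * pi * k * t) - 1)) - 1 / (2 * pi * t) * (1 / k\<^sup>2) + 1 / (2 * k)"
  proof -
    have "1 / (2 * pi * c) * (pi * (2 / a + 1) - 1 / (c * t)) =
          1 / c * (1 / a) - 1 / (2 * pi * t) * (1 / c\<^sup>2) + 1 / (2 * c)" if "c > 0" "a > 0" for a c :: real
      using that t by (simp add: field_simps power2_eq_square)
    thus ?thesis using assms by simp
  qed
  finally show ?thesis .
qed

text \<open>Comparison with an integral: \<open>H y\<close> is the integral of the decreasing
  function \<open>h\<close> from y to infinity, so the tail differs from \<open>H K\<close> by at
  most \<open>h K\<close>.\<close>

lemma transform_term_tail:
  fixes k K :: nat and t :: real
  assumes t: "t > 0" and k: "k > 0" and K: "K > 0"
  shows "\<bar>(\<Sum>m. transform_term t k (Suc (m + K))) - arctan (k * t / K) / (pi * k)\<bar> \<le> t / (pi * (real K)\<^sup>2)"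
proof -
  define H where "H = (\<lambda>y::real. arctan (k * t / y) / (pi * k))"
  define h where "h = (\<lambda>y::real. t / (pi * ((k * t)\<^sup>2 + y\<^sup>2)))"
  have der: "(H has_real_derivative - h y) (at y)" if "y > 0" for y
  proof -
    have "1 + (k * t / y)\<^sup>2 > 0" by (rule add_pos_nonneg) auto
    moreover have "(k * t)\<^sup>2 + y\<^sup>2 > 0" using that by (intro add_nonneg_pos) auto
    ultimately show ?thesis
      unfolding H_def h_def using that k
      by (auto intro!: derivative_eq_intros simp: divide_simps power2_eq_square)
  qed
  have h_mono: "h y \<le> h x" if "0 < x" "x \<le> y" for x y
    unfolding h_def using that t
    by (intro divide_left_mono mult_left_mono add_left_mono power_mono mult_pos_pos add_nonneg_pos) auto
  have step: "h (y + 1) \<le> H y - H (y + 1)" "H y - H (y + 1) \<le> h y" if "y > 0" for y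
  proof -
    have "\<And>x. y \<le> x \<Longrightarrow> x \<le> y + 1 \<Longrightarrow> (H has_real_derivative - h x) (at x)"
      using der that by auto
    from MVT2[of y "y + 1" H "\<lambda>x. - h x", OF _ this] obtain \<xi> where \<xi>: "\<xi> > y" "\<xi> < y + 1" "H (y + 1) - H y = (y + 1 - y) * (- h \<xi>)"
      by auto
    show "h (y + 1) \<le> H y - H (y + 1)" "H y - H (y + 1) \<le> h y"
      using \<xi> h_mono[of \<xi> "y + 1"] h_mono[of y \<xi>] that by auto
  qed
  have h_eq: "transform_term t k m = h (real m)" for m
    by (simp add: transform_term_def h_def)
  have "(\<lambda>m. H (real (m + K))) \<longlonglongrightarrow> arctan 0 / (pi * k)"
    unfolding H_def using k
    by (intro tendsto_intros tendsto_divide_0[OF tendsto_const] filterlim_at_top_imp_at_infinity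
          filterlim_compose[OF filterlim_real_sequentially filterlim_add_const_nat_at_top]) auto
  from telescope_sums'[OF this]
  have tel: "(\<lambda>m. H (real (m + K)) - H (real (m + K) + 1)) sums H (real K)"
    by (simp add: add_ac)
  have s1: "summable (\<lambda>m. transform_term t k (Suc m))"
    using transform_term_sums[OF t k] by (simp add: sums_iff)
  have s2: "summable (\<lambda>m. h (real (m + K) + 1))"
    using summable_ignore_initial_segment[OF s1, of K] by (simp add: h_eq add_ac)
  have s3: "summable (\<lambda>m. h (real (m + K)))"
    using s2 summable_Suc_iff[of "\<lambda>m. h (real (m + K))"] by (simp add: add_ac)
  have a: "(\<Sum>m. h (real (m + K) + 1)) \<le> H (real K)"
    using sums_le[OF _ summable_sums[OF s2] tel] step(1) K by simp
  have b: "H (real K) \<le> (\<Sum>m. h (real (m + K)))"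
    using sums_le[OF _ tel summable_sums[OF s3]] step(2) K by simp
  have c: "(\<Sum>m. h (real (m + K))) = h (real K) + (\<Sum>m. h (real (m + K) + 1))"
    using suminf_split_head[OF s3] by (simp add: add_ac)
  have d: "h (real K) \<le> t / (pi * (real K)\<^sup>2)"
    unfolding h_def using t K by (intro divide_left_mono mult_left_mono mult_pos_pos add_nonneg_pos) auto
  have e: "(\<Sum>m. transform_term t k (Suc (m + K))) = (\<Sum>m. h (real (m + K) + 1))"
    by (simp add: h_eq add_ac)
  show ?thesis using a b c d unfolding e H_def by linarith
qed

text \<open>The integral lies between the right and the left Riemann sum, whose difference
  telescopes. The explicit error is what makes the estimate uniform in a parameter of
  \<open>f\<close>.\<close>

lemma antitone_riemann_sum:
  fixes F f :: "real \<Rightarrow> real" and K :: nat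
  assumes der: "\<And>x. 0 \<le> x \<Longrightarrow> x \<le> 1 \<Longrightarrow> (F has_real_derivative f x) (at x)"
      and anti: "\<And>x y. 0 \<le> x \<Longrightarrow> x \<le> y \<Longrightarrow> y \<le> 1 \<Longrightarrow> f y \<le> f x" and K: "K > 0"
  shows "\<bar>(\<Sum>k=1..K. f (k / K)) / K - (F 1 - F 0)\<bar> \<le> (f 0 - f 1) / K"
proof -
  have step: "f (Suc i / K) / K \<le> F (Suc i / K) - F (i / K) \<and> F (Suc i / K) - F (i / K) \<le> f (i / K) / K"
    if "i < K" for i :: nat
  proof -
    have le: "real i / K < real (Suc i) / K" "real (Suc i) / K \<le> 1" "0 \<le> real i / K"
      using that K by (auto simp: divide_simps)
    obtain \<xi> where \<xi>: "\<xi> > i / K" "\<xi> < Suc i / K" "F (Suc i / K) - F (i / K) = (Suc i / K - i / K) * f \<xi>"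
      using MVT2[of "i / K" "Suc i / K" F f] der le by (metis order_trans)
    have "real (Suc i) / K - real i / K = 1 / K" by (simp flip: diff_divide_distrib)
    moreover have "f (Suc i / K) \<le> f \<xi>" "f \<xi> \<le> f (i / K)"
      by (rule anti; use \<xi>(1,2) le in linarith)+
    ultimately show ?thesis using \<xi>(3) K by (auto intro: divide_right_mono)
  qed
  have tel: "(\<Sum>i<K. F (Suc i / K) - F (i / K)) = F 1 - F 0"
    using sum_lessThan_telescope[of "\<lambda>i. F (real i / K)" K] K by simp
  have up: "(\<Sum>i<K. f (Suc i / K) / K) \<le> F 1 - F 0"
    unfolding tel [symmetric] using step by (intro sum_mono) auto
  have lo: "F 1 - F 0 \<le> (\<Sum>i<K. f (i / K) / K)"
    unfolding tel [symmetric] using step by (intro sum_mono) auto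
  have eq1: "(\<Sum>k=1..K. f (k / K)) / K = (\<Sum>i<K. f (Suc i / K) / K)"
    unfolding sum_divide_distrib
    by (rule sum.reindex_bij_witness[of _ Suc "\<lambda>i. i - 1"]) auto
  have eq2: "(\<Sum>i<K. f (Suc i / K) / K) - (\<Sum>i<K. f (i / K) / K) = f 1 / K - f 0 / K"
    using sum_lessThan_telescope[of "\<lambda>i. f (real i / K) / K" K] K by (simp add: sum_subtractf)
  show ?thesis using up lo eq1 eq2 by (simp add: diff_divide_distrib)
qed

text \<open>The sum vanishes at t = 1. Its derivative at s is a Riemann sum over x = k/K of 1 / (1 +
  s^2 x^2) + 1 / (s^2 + x^2), whose integral over [0, 1] is (arctan s + arctan (1/s)) / s = pi / (2
  s). The error is O(1/K) uniformly in s, so it survives integration from 1 to t.\<close>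

lemma arctan_sum_limit:
  fixes t :: real
  assumes t: "t > 0"
  shows "(\<lambda>K. \<Sum>k=1..K. (arctan (real k * t / real K) - arctan (real k * (1 / t) / real K)) / real k) \<longlonglongrightarrow> pi / 2 * ln t"
proof -
  define E where "E = (\<lambda>(K::nat) s. \<Sum>k=1..K. (arctan (real k * s / real K) - arctan (real k * (1 / s) / real K)) / real k)"
  define E' where "E' = (\<lambda>(K::nat) s. (\<Sum>k=1..K. (1 / (1 + (s * (k / K))\<^sup>2) + 1 / (s\<^sup>2 + (k / K)\<^sup>2))) / K)"
  \<comment> \<open>A convex domain containing 1 and t and bounded away from 0, where the derivative
    bound degenerates.\<close>
  define lo where "lo = min 1 t"
  have lo: "lo > 0" using t by (simp add: lo_def)
  have derE: "(E K has_real_derivative E' K s) (at s)" if "s > 0" "K > 0" for s and K :: nat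
    unfolding E_def E'_def sum_divide_distrib
  proof (rule DERIV_sum)
    fix k assume k: "k \<in> {1..K}"
    have "1 + (k * s / K)\<^sup>2 > 0" "1 + (k / (s * K))\<^sup>2 > 0" "1 + (k * (1 / s) / K)\<^sup>2 > 0"
      "1 + (s * (k / K))\<^sup>2 > 0" by (rule add_pos_nonneg; simp)+
    moreover have "s\<^sup>2 + (k / K)\<^sup>2 > 0" using that by (intro add_pos_nonneg) auto
    moreover have D1: "((\<lambda>s. arctan (k * s / K) / k) has_real_derivative 1 / (1 + (s * (k / K))\<^sup>2) / K) (at s)"
      using k that by (auto intro!: derivative_eq_intros simp: divide_simps power2_eq_square add_nonneg_eq_0_iff) 
    moreover have D2: "((\<lambda>s. arctan (k * (1 / s) / K) / k) has_real_derivative - 1 / (s\<^sup>2 + (k / K)\<^sup>2) / K) (at s)"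
    proof -
      have "((\<lambda>s. arctan (k * (1 / s) / K) / k) has_real_derivative
              (inverse (1 + (k * (1 / s) / K)\<^sup>2) * (k * (- 1 / s\<^sup>2) / K)) / k) (at s)"
        using that by (auto intro!: derivative_eq_intros simp: power2_eq_square)
      also have "(inverse (1 + (k * (1 / s) / K)\<^sup>2) * (k * (- 1 / s\<^sup>2) / K)) / k =
                  - (1 / (s\<^sup>2 * (1 + (k * (1 / s) / K)\<^sup>2))) / K"
      proof -
        have *: "(inverse a * (c * (- 1 / d) / b)) / c = - (1 / (d * a)) / b" if "c \<noteq> 0" for a b c d :: real
          using that by (simp add: divide_inverse mult_ac)
        show ?thesis by (rule *) (use k in auto)
      qed
      also have "s\<^sup>2 * (1 + (k * (1 / s) / K)\<^sup>2) = s\<^sup>2 + (k / K)\<^sup>2"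
        using that by (simp add: distrib_left power_mult_distrib power_divide)
      finally show ?thesis by simp
    qed
    ultimately show "((\<lambda>s. (arctan (k * s / K) - arctan (k * (1 / s) / K)) / k) has_real_derivative
           (1 / (1 + (s * (k / K))\<^sup>2) + 1 / (s\<^sup>2 + (k / K)\<^sup>2)) / K) (at s)"
      using DERIV_diff[OF D1 D2] by (simp add: diff_divide_distrib add_divide_distrib)
  qed
  have E'_bound: "\<bar>E' K s - pi / (2 * s)\<bar> \<le> (1 + 1 / lo\<^sup>2) / K" if s: "s \<ge> lo" and K: "K > 0" for s and K :: nat
  proof -
    have s0: "s > 0" using s lo by linarith
    define F where "F = (\<lambda>x. arctan (s * x) / s + arctan (x / s) / s)"
    define f where "f = (\<lambda>x. 1 / (1 + (s * x)\<^sup>2) + 1 / (s\<^sup>2 + x\<^sup>2))"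
    have "\<bar>(\<Sum>k=1..K. f (k / K)) / K - (F 1 - F 0)\<bar> \<le> (f 0 - f 1) / K"
    proof (rule antitone_riemann_sum[OF _ _ K])
      fix x :: real
      have D1: "((\<lambda>x. arctan (s * x) / s) has_real_derivative 1 / (1 + (s * x)\<^sup>2)) (at x)"
        using s0 by (auto intro!: derivative_eq_intros simp: divide_simps add_nonneg_eq_0_iff)
      have D2: "((\<lambda>x. arctan (x / s) / s) has_real_derivative 1 / (s\<^sup>2 + x\<^sup>2)) (at x)"
      proof -
        have "((\<lambda>x. arctan (x / s) / s) has_real_derivative (inverse (1 + (x / s)\<^sup>2) * (1 / s)) / s) (at x)"
          using s0 by (auto intro!: derivative_eq_intros)
        also have "(inverse (1 + (x / s)\<^sup>2) * (1 / s)) / s = 1 / (s\<^sup>2 * (1 + (x / s)\<^sup>2))"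
          by (simp add: divide_inverse power2_eq_square mult_ac)
        also have "s\<^sup>2 * (1 + (x / s)\<^sup>2) = s\<^sup>2 + x\<^sup>2" using s0 by (simp add: distrib_left power_divide)
        finally show ?thesis .
      qed
      show "(F has_real_derivative f x) (at x)"
        unfolding F_def f_def by (intro DERIV_add D1 D2)
    next
      fix x y :: real assume "0 \<le> x" "x \<le> y" "y \<le> 1"
      thus "f y \<le> f x" unfolding f_def using s0
        by (intro add_mono divide_left_mono add_left_mono power_mono mult_left_mono mult_pos_pos
              add_pos_nonneg) auto
    qed
    also have "(f 0 - f 1) / K \<le> (1 + 1 / lo\<^sup>2) / K"
    proof -
      have "1 / s\<^sup>2 \<le> 1 / lo\<^sup>2" using s lo by (intro divide_left_mono power_mono) auto
      moreover have "f 1 \<ge> 0" unfolding f_def by (intro add_nonneg_nonneg divide_nonneg_nonneg) auto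
      moreover have "f 0 = 1 + 1 / s\<^sup>2" by (simp add: f_def)
      ultimately have "f 0 - f 1 \<le> 1 + 1 / lo\<^sup>2" by linarith
      thus ?thesis by (rule divide_right_mono) auto
    qed
    also have "(\<Sum>k=1..K. f (k / K)) / K = E' K s" by (simp add: E'_def f_def)
    also have "F 1 - F 0 = (arctan s + arctan (1 / s)) / s" by (simp add: F_def add_divide_distrib)
    also have "arctan s + arctan (1 / s) = pi / 2"
      using arctan_inverse[of s] s0 by (simp add: sgn_if inverse_eq_divide)
    finally show ?thesis by simp
  qed
  define G where "G = (\<lambda>K s. E K s - pi / 2 * ln s)"
  have G: "norm (G K t) \<le> (1 + 1 / lo\<^sup>2) * \<bar>t - 1\<bar> * (1 / K)" if K: "K > 0" for K
  proof -
    have "norm (G K t - G K 1) \<le> (1 + 1 / lo\<^sup>2) / K * norm (t - 1)"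
    proof (rule field_differentiable_bound[where S = "{lo..}" and f' = "\<lambda>s. E' K s - pi / (2 * s)"])
      fix s assume s: "s \<in> {lo..}"
      hence s0: "s > 0" using lo by auto
      show "(G K has_field_derivative E' K s - pi / (2 * s)) (at s within {lo..})"
      proof -
        have "((\<lambda>s. pi / 2 * ln s) has_real_derivative pi / 2 * (1 / s)) (at s)"
          using s0 by (intro DERIV_cmult DERIV_ln_divide)
        from DERIV_diff[OF derE[OF s0 K] this]
        have "(G K has_real_derivative E' K s - pi / 2 * (1 / s)) (at s)"
          unfolding G_def .
        moreover have "pi / 2 * (1 / s) = pi / (2 * s)" by simp
        ultimately show ?thesis by (simp only: has_field_derivative_at_within)
      qed
      show "norm (E' K s - pi / (2 * s)) \<le> (1 + 1 / lo\<^sup>2) / K"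
        using E'_bound[of s K] s K by simp
    qed (auto simp: lo_def)
    moreover have "G K 1 = 0" by (simp add: G_def E_def)
    ultimately show ?thesis by (simp add: mult_ac)
  qed
  have "(\<lambda>K. G K t) \<longlonglongrightarrow> 0"
  proof (rule Lim_null_comparison)
    show "eventually (\<lambda>K. norm (G K t) \<le> (1 + 1 / lo\<^sup>2) * \<bar>t - 1\<bar> * (1 / K)) sequentially"
      using eventually_gt_at_top[of 0] by eventually_elim (rule G)
    show "(\<lambda>K. (1 + 1 / lo\<^sup>2) * \<bar>t - 1\<bar> * (1 / real K)) \<longlonglongrightarrow> 0"
      by (intro tendsto_mult_right_zero lim_1_over_n)
  qed
  hence "(\<lambda>K. G K t + pi / 2 * ln t) \<longlonglongrightarrow> 0 + pi / 2 * ln t"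
    by (intro tendsto_intros)
  thus ?thesis by (simp add: G_def E_def)
qed

text \<open>Once the square has cancelled, only the tails m > K remain. Each is an arctan up to
  O(1/K^2), uniformly in k <= K, so the K errors together tend to 0.\<close>

lemma transform_sum_limit:
  assumes t: "t > 0"
  shows "(\<lambda>K. \<Sum>k=1..K. (\<Sum>m. transform_term t k (Suc m)) - (\<Sum>m. transform_term (1 / t) k (Suc m)))
           \<longlonglongrightarrow> ln t / 2"
proof -
  define tl where "tl = (\<lambda>t k K. \<Sum>m. transform_term t k (Suc (m + K)))"
  define S where "S = (\<lambda>K. \<Sum>k=1..K. (\<Sum>m. transform_term t k (Suc m)) - (\<Sum>m. transform_term (1 / t) k (Suc m)))"
  define R where "R = (\<lambda>K. \<Sum>k=1..K. (arctan (real k * t / real K) - arctan (real k * (1 / t) / real K)) / real k)"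
  have t': "1 / t > 0" using t by simp
  have split: "(\<Sum>m. transform_term u k (Suc m)) = tl u k K + (\<Sum>m=1..K. transform_term u k m)"
    if "u > 0" "k > 0" for u k K
  proof -
    have "summable (\<lambda>m. transform_term u k (Suc m))"
      using transform_term_sums[OF that] by (simp add: sums_iff)
    from suminf_split_initial_segment[OF this, of K]
    have "(\<Sum>m. transform_term u k (Suc m)) = tl u k K + (\<Sum>m<K. transform_term u k (Suc m))"
      by (simp add: tl_def)
    also have "(\<Sum>m<K. transform_term u k (Suc m)) = (\<Sum>m=1..K. transform_term u k m)"
      by (rule sum.reindex_bij_witness[of _ "\<lambda>i. i - 1" Suc]) auto
    finally show ?thesis .
  qed
  have S_eq: "S K = (\<Sum>k=1..K. tl t k K - tl (1 / t) k K)" for K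
  proof -
    have "S K = (\<Sum>k=1..K. (tl t k K - tl (1 / t) k K) +
                  ((\<Sum>m=1..K. transform_term t k m) - (\<Sum>m=1..K. transform_term (1 / t) k m)))"
      unfolding S_def using split[OF t, of _ K] split[OF t', of _ K] by (intro sum.cong) auto
    also have "\<dots> = (\<Sum>k=1..K. tl t k K - tl (1 / t) k K) +
          ((\<Sum>k=1..K. \<Sum>m=1..K. transform_term t k m) - (\<Sum>k=1..K. \<Sum>m=1..K. transform_term t m k))"
      by (simp only: sum.distrib sum_subtractf transform_term_swap[OF t])
    also have "(\<Sum>k=1..K. \<Sum>m=1..K. transform_term t m k) = (\<Sum>k=1..K. \<Sum>m=1..K. transform_term t k m)"
      by (rule sum.swap)
    finally show ?thesis by simp
  qed
  have bound: "norm (S K - R K / pi) \<le> (t + 1 / t) / pi * (1 / K)" if K: "K > 0" for K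
  proof -
    have S_R: "S K - R K / pi = (\<Sum>k=1..K. (tl t k K - arctan (k * t / K) / (pi * k)) -
                              (tl (1 / t) k K - arctan (k * (1 / t) / K) / (pi * k)))"
      unfolding S_eq R_def sum_divide_distrib sum_subtractf [symmetric]
      by (intro sum.cong) (auto simp: diff_divide_distrib mult_ac)
    have "norm (S K - R K / pi) \<le> (\<Sum>k=1..K. t / (pi * (real K)\<^sup>2) + (1 / t) / (pi * (real K)\<^sup>2))"
      unfolding S_R
    proof (rule sum_norm_le)
      fix k assume "k \<in> {1..K}"
      hence k: "k > 0" by simp
      show "norm ((tl t k K - arctan (k * t / K) / (pi * k)) -
                  (tl (1 / t) k K - arctan (k * (1 / t) / K) / (pi * k))) \<le>
            t / (pi * (real K)\<^sup>2) + (1 / t) / (pi * (real K)\<^sup>2)"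
        using transform_term_tail[OF t k K] transform_term_tail[OF t' k K]
        unfolding tl_def real_norm_def by linarith
    qed
    also have "(\<Sum>k=1..K. t / (pi * (real K)\<^sup>2) + (1 / t) / (pi * (real K)\<^sup>2)) = (t + 1 / t) / pi * (1 / K)"
    proof -
      have *: "c * (a / (p * c\<^sup>2) + b / (p * c\<^sup>2)) = (a + b) / p * (1 / c)"
        if "c \<noteq> 0" for a b c p :: real
        unfolding add_divide_distrib [symmetric] using that by (simp add: power2_eq_square)
      have "(\<Sum>k=1..K. t / (pi * (real K)\<^sup>2) + (1 / t) / (pi * (real K)\<^sup>2)) =
            real K * (t / (pi * (real K)\<^sup>2) + (1 / t) / (pi * (real K)\<^sup>2))"
        by (simp only: sum_constant card_atLeastAtMost) simp
      thus ?thesis using *[of "real K" t pi "1 / t"] K by (simp only:)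
    qed
    finally show ?thesis .
  qed
  have "(\<lambda>K. S K - R K / pi) \<longlonglongrightarrow> 0"
  proof (rule Lim_null_comparison)
    show "eventually (\<lambda>K. norm (S K - R K / pi) \<le> (t + 1 / t) / pi * (1 / K)) sequentially"
      using eventually_gt_at_top[of 0] by eventually_elim (rule bound)
    show "(\<lambda>K. (t + 1 / t) / pi * (1 / real K)) \<longlonglongrightarrow> 0"
      by (intro tendsto_mult_right_zero lim_1_over_n)
  qed
  moreover have "(\<lambda>K. R K / pi) \<longlonglongrightarrow> pi / 2 * ln t / pi"
    unfolding R_def by (intro tendsto_intros arctan_sum_limit t) auto
  ultimately have "(\<lambda>K. (S K - R K / pi) + R K / pi) \<longlonglongrightarrow> 0 + pi / 2 * ln t / pi"
    by (rule tendsto_add)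
  thus ?thesis by (simp add: S_def)
qed

text \<open>Fubini for the nonnegative double series of r^(k j) / j: summing over j first gives the
  logarithms, summing over k first gives the Lambert terms.\<close>

lemma ln_partition_gf_lambert:
  fixes t :: real
  assumes t: "t > 0"
  defines "r \<equiv> exp (- 2 * pi * t)"
  shows "(\<lambda>j. 1 / real (Suc j) * (1 / (exp (2 * pi * Suc j * t) - 1))) sums (\<Sum>k. - ln (1 - r ^ Suc k))"
proof -
  have r: "0 < r" "r < 1" using t by (auto simp: r_def)
  define f where "f = (\<lambda>(k::nat, j::nat). r ^ (Suc k * Suc j) / real (Suc j))"
  have f_nonneg: "f kj \<ge> 0" for kj using r by (auto simp: f_def split: prod.splits)
  have row: "((\<lambda>j. f (k, j)) has_sum (- ln (1 - r ^ Suc k))) UNIV" for k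
  proof (rule sums_nonneg_imp_has_sum)
    show "(\<lambda>j. f (k, j)) sums (- ln (1 - r ^ Suc k))"
      using minus_ln_one_minus_sums[of "r ^ Suc k"] power_Suc_lt_one[of r k] r
      by (simp add: f_def flip: power_mult power_Suc)
  qed (use f_nonneg in auto)
  have col: "((\<lambda>k. f (k, j)) has_sum (1 / real (Suc j) * (1 / (exp (2 * pi * Suc j * t) - 1)))) UNIV" for j
  proof (rule sums_nonneg_imp_has_sum)
    let ?s = "r ^ Suc j"
    have s: "0 < ?s" "?s < 1" using power_Suc_lt_one[of r j] r by auto
    have "(\<lambda>k. ?s / real (Suc j) * ?s ^ k) sums (?s / real (Suc j) * (1 / (1 - ?s)))"
      using s by (intro sums_mult geometric_sums) auto
    also have "(\<lambda>k. ?s / real (Suc j) * ?s ^ k) = (\<lambda>k. f (k, j))"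
      by (simp add: f_def fun_eq_iff mult_ac flip: power_mult power_add power_Suc)
         (simp add: power_add power_mult algebra_simps)
    also have "?s / real (Suc j) * (1 / (1 - ?s)) = 1 / real (Suc j) * (1 / (1 / ?s - 1))"
    proof -
      have "x / c * (1 / (1 - x)) = 1 / c * (1 / (1 / x - 1))" if "0 < x" "x < 1" for x c :: real
        using that by (simp add: divide_simps)
      from this[OF s] show ?thesis .
    qed
    also have "1 / ?s = exp (2 * pi * Suc j * t)"
      unfolding r_def by (simp add: exp_minus field_simps flip: exp_of_nat_mult exp_add)
    finally show "(\<lambda>k. f (k, j)) sums (1 / real (Suc j) * (1 / (exp (2 * pi * Suc j * t) - 1)))" .
  qed (use f_nonneg in auto)
  have nn: "- ln (1 - r ^ Suc k) \<ge> 0" for k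
    using row[of k] f_nonneg by (rule has_sum_nonneg)
  have rs: "((\<lambda>k. - ln (1 - r ^ Suc k)) has_sum (\<Sum>k. - ln (1 - r ^ Suc k))) UNIV"
    by (rule sums_nonneg_imp_has_sum) (use nn summable_minus_ln_power[of r] r in auto)
  have "f summable_on UNIV \<times> UNIV"
    by (rule summable_on_SigmaI[where g = "\<lambda>k. - ln (1 - r ^ Suc k)"])
       (use row rs f_nonneg in \<open>auto simp: summable_on_def\<close>)
  hence summ: "(f has_sum (infsum f (UNIV \<times> UNIV))) (UNIV \<times> UNIV)" by simp
  have "((\<lambda>k. - ln (1 - r ^ Suc k)) has_sum (infsum f (UNIV \<times> UNIV))) UNIV"
    by (rule has_sum_SigmaD[OF summ]) (use row in auto)
  with rs have tot: "infsum f (UNIV \<times> UNIV) = (\<Sum>k. - ln (1 - r ^ Suc k))"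
    using has_sum_unique by blast
  have "((\<lambda>(j, k). f (k, j)) has_sum (infsum f (UNIV \<times> UNIV))) (UNIV \<times> UNIV)"
    using summ by (subst has_sum_swap) simp
  hence "((\<lambda>j. 1 / real (Suc j) * (1 / (exp (2 * pi * Suc j * t) - 1))) has_sum (infsum f (UNIV \<times> UNIV))) UNIV"
    by (rule has_sum_SigmaD) (use col in auto)
  thus ?thesis unfolding tot by (rule has_sum_imp_sums)
qed

lemma ln_partition_gf_transform:
  fixes t :: real
  assumes t: "t > 0"
  shows "(\<Sum>k. - ln (1 - exp (- 2 * pi * t) ^ Suc k)) =
         (\<Sum>k. - ln (1 - exp (- 2 * pi * (1 / t)) ^ Suc k)) + pi / 12 * (1 / t - t) + ln t / 2"
proof -
  define L where "L = (\<lambda>t. \<Sum>k. - ln (1 - exp (- 2 * pi * t) ^ Suc k))"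
  define A where "A = (\<lambda>t k. \<Sum>m. transform_term t k (Suc m))"
  have t': "1 / t > 0" using t by simp
  have lam: "(\<lambda>K. \<Sum>k=1..K. 1 / real k * (1 / (exp (2 * pi * k * u) - 1))) \<longlonglongrightarrow> L u" if "u > 0" for u
  proof -
    have "(\<lambda>K. \<Sum>j<K. 1 / real (Suc j) * (1 / (exp (2 * pi * Suc j * u) - 1))) \<longlonglongrightarrow> L u"
      using ln_partition_gf_lambert[OF that] by (simp add: sums_def L_def)
    also have "(\<lambda>K. \<Sum>j<K. 1 / real (Suc j) * (1 / (exp (2 * pi * Suc j * u) - 1))) =
               (\<lambda>K. \<Sum>k=1..K. 1 / real k * (1 / (exp (2 * pi * k * u) - 1)))"
      by (intro ext sum.reindex_bij_witness[of _ "\<lambda>i. i - 1" Suc]) auto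
    finally show ?thesis .
  qed
  have sq: "(\<lambda>K. \<Sum>k=1..K. 1 / (real k)\<^sup>2) \<longlonglongrightarrow> pi\<^sup>2 / 6"
  proof -
    have "(\<lambda>K. \<Sum>j<K. 1 / (1 + real j)\<^sup>2) \<longlonglongrightarrow> pi\<^sup>2 / 6"
      using inverse_squares_sums by (simp add: sums_def)
    also have "(\<lambda>K. \<Sum>j<K. 1 / (1 + real j)\<^sup>2) = (\<lambda>K. \<Sum>k=1..K. 1 / (real k)\<^sup>2)"
      by (intro ext sum.reindex_bij_witness[of _ "\<lambda>i. i - 1" Suc]) auto
    finally show ?thesis .
  qed
  have A_eq: "A u k = 1 / k * (1 / (exp (2 * pi * k * u) - 1)) - 1 / (2 * pi * u) * (1 / k\<^sup>2) + 1 / (2 * k)"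
    if "u > 0" "k > 0" for u and k :: nat
    using transform_term_sums[OF that] by (simp add: A_def sums_iff)
  \<comment> \<open>The harmonic parts 1 / (2 k), which would diverge, cancel between t and 1/t;
    each remaining sum has a limit of its own.\<close>
  have "(\<Sum>k=1..K. A t k - A (1 / t) k) =
          (\<Sum>k=1..K. 1 / real k * (1 / (exp (2 * pi * k * t) - 1))) -
          (\<Sum>k=1..K. 1 / real k * (1 / (exp (2 * pi * k * (1 / t)) - 1))) -
          (1 / (2 * pi * t) - 1 / (2 * pi * (1 / t))) * (\<Sum>k=1..K. 1 / (real k)\<^sup>2)" for K
    unfolding sum_distrib_left sum_subtractf [symmetric]
    by (intro sum.cong refl) (auto simp: A_eq[OF t] A_eq[OF t'] left_diff_distrib diff_divide_distrib)
  hence "(\<lambda>K. \<Sum>k=1..K. A t k - A (1 / t) k) \<longlonglongrightarrow>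
           L t - L (1 / t) - (1 / (2 * pi * t) - 1 / (2 * pi * (1 / t))) * (pi\<^sup>2 / 6)"
    by (simp only:) (intro tendsto_intros lam t t' sq)
  moreover have "(\<lambda>K. \<Sum>k=1..K. A t k - A (1 / t) k) \<longlonglongrightarrow> ln t / 2"
    unfolding A_def by (rule transform_sum_limit[OF t])
  ultimately have "L t - L (1 / t) - (1 / (2 * pi * t) - 1 / (2 * pi * (1 / t))) * (pi\<^sup>2 / 6) = ln t / 2"
    by (rule LIMSEQ_unique)
  moreover have "(1 / (2 * pi * t) - 1 / (2 * pi * (1 / t))) * (pi\<^sup>2 / 6) = pi / 12 * (1 / t - t)"
    using t by (simp add: field_simps power2_eq_square)
  ultimately show ?thesis unfolding L_def by linarith
qed

section \<open>The complex transformation and the coefficient integral\<close>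

lemma norm_exp_neg_lt_one:
  fixes z :: complex
  assumes "Re z > 0"
  shows "norm (exp (- 2 * pi * z)) < 1"
  using assms by simp

lemma partition_gf_transform_real:
  fixes z :: complex
  assumes t: "t > 0" and z: "z = of_real t"
  shows "partition_gf (exp (- 2 * pi * z)) =
           csqrt z * exp (pi / 12 * (1 / z - z)) * partition_gf (exp (- 2 * pi / z))"
proof -
  have t': "1 / t > 0" using t by simp
  have *: "partition_gf (of_real (exp (- 2 * pi * u))) =
             of_real (exp (\<Sum>k. - ln (1 - exp (- 2 * pi * u) ^ Suc k)))" if "u > 0" for u
    using that by (intro partition_gf_of_real) auto
  have "exp (\<Sum>k. - ln (1 - exp (- 2 * pi * t) ^ Suc k)) =
        exp (\<Sum>k. - ln (1 - exp (- 2 * pi * (1 / t)) ^ Suc k)) * exp (pi / 12 * (1 / t - t)) * exp (ln t / 2)"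
    by (subst ln_partition_gf_transform[OF t]) (simp only: exp_add)
  also have "exp (ln t / 2) = sqrt t"
    using t by (simp add: ln_sqrt [symmetric])
  finally have "complex_of_real (exp (\<Sum>k. - ln (1 - exp (- 2 * pi * t) ^ Suc k))) =
      of_real (exp (\<Sum>k. - ln (1 - exp (- 2 * pi * (1 / t)) ^ Suc k))) *
      of_real (exp (pi / 12 * (1 / t - t))) * of_real (sqrt t)"
    by (simp only: of_real_mult)
  hence "partition_gf (of_real (exp (- 2 * pi * t))) =
      of_real (sqrt t) * of_real (exp (pi / 12 * (1 / t - t))) * partition_gf (of_real (exp (- 2 * pi * (1 / t))))"
    unfolding *[OF t] *[OF t'] by (simp only: mult_ac)
  moreover have "exp (- 2 * pi * z) = of_real (exp (- 2 * pi * t))"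
    by (simp add: z flip: exp_of_real)
  moreover have "exp (- 2 * pi / z) = of_real (exp (- 2 * pi * (1 / t)))"
    by (simp add: z flip: exp_of_real)
  moreover have "exp (pi / 12 * (1 / z - z)) = of_real (exp (pi / 12 * (1 / t - t)))"
    by (simp add: z flip: exp_of_real)
  moreover have "csqrt z = of_real (sqrt t)" using t z by simp
  ultimately show ?thesis by (simp only:)
qed

text \<open>Identity theorem on the right half-plane: both sides are holomorphic there and agree on
  the positive reals, which accumulate at 1.\<close>

lemma partition_gf_transform:
  fixes z :: complex
  assumes z: "Re z > 0"
  shows "partition_gf (exp (- 2 * pi * z)) =
           csqrt z * exp (pi / 12 * (1 / z - z)) * partition_gf (exp (- 2 * pi / z))"
proof -
  define S where "S = {z::complex. Re z > 0}"
  define f where "f = (\<lambda>z::complex. partition_gf (exp (- 2 * pi * z)) -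
           csqrt z * exp (pi / 12 * (1 / z - z)) * partition_gf (exp (- 2 * pi / z)))"
  have [simp]: "open S" unfolding S_def by (rule open_halfspace_Re_gt)
  have conv: "convex S" unfolding S_def by (rule convex_halfspace_Re_gt)
  have nz: "z \<noteq> 0" "z \<notin> \<real>\<^sub>\<le>\<^sub>0" if "z \<in> S" for z
    using that by (auto simp: S_def complex_nonpos_Reals_iff)
  have inv: "Re (1 / z) > 0" if "z \<in> S" for z
    using that nz(1)[OF that] by (simp add: S_def Re_divide complex_neq_0 field_simps)
  have hol1: "(\<lambda>z. partition_gf (exp (- 2 * pi * z))) holomorphic_on S"
    by (rule holomorphic_on_compose_gen[OF _ holomorphic_partition_gf, unfolded o_def])
       (auto intro!: holomorphic_intros simp: S_def)
  have hol2: "(\<lambda>z. partition_gf (exp (- 2 * pi / z))) holomorphic_on S"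
  proof (rule holomorphic_on_compose_gen[OF _ holomorphic_partition_gf, unfolded o_def])
    show "(\<lambda>z. exp (- 2 * pi / z)) holomorphic_on S"
      using nz by (auto intro!: holomorphic_intros)
    show "(\<lambda>z. exp (- 2 * pi / z)) ` S \<subseteq> ball 0 1"
    proof
      fix w assume "w \<in> (\<lambda>z::complex. exp (- 2 * pi / z)) ` S"
      then obtain z :: complex where z: "z \<in> S" "w = exp (- 2 * pi / z)" by auto
      have "w = exp (- 2 * pi * (1 / z))" using z by simp
      thus "w \<in> ball 0 1" using norm_exp_neg_lt_one[OF inv[OF z(1)]] by simp
    qed
  qed
  have hol: "f holomorphic_on S"
    unfolding f_def using nz by (intro holomorphic_intros hol1 hol2) auto
  have "f z = 0"
  proof (rule analytic_continuation[OF hol])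
    show "connected S" using conv by (rule convex_connected)
    show "of_real ` {0<..} \<subseteq> S" by (auto simp: S_def)
    show "1 \<in> S" "z \<in> S" using z by (auto simp: S_def)
    show "(1::complex) islimpt of_real ` {0<..}"
    proof -
      have "(1::real) islimpt {0<..}"
        by (rule open_imp_islimpt) auto
      hence "\<forall>e>0. \<exists>x'\<in>{0<..}. x' \<noteq> 1 \<and> dist x' (1::real) < e"
        by (simp add: islimpt_approachable)
      thus ?thesis
        unfolding islimpt_approachable
        by (metis dist_of_real imageI of_real_1 of_real_eq_1_iff)
    qed
    show "f w = 0" if "w \<in> of_real ` {0<..}" for w
      using that partition_gf_transform_real by (auto simp: f_def)
  qed auto
  thus ?thesis by (simp add: f_def)
qed

section \<open>p(n) as a Fourier coefficient\<close>

lemma has_integral_exp_period: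
  fixes m :: int
  shows "((\<lambda>x::real. exp (2 * pi * \<i> * m * x)) has_integral (if m = 0 then 1 else 0)) {-1/2..1/2}"
proof (cases "m = 0")
  case True
  thus ?thesis using has_integral_const_real[of "1::complex" "-1/2" "1/2"] by simp
next
  case False
  define c where "c = 2 * pi * \<i> * m"
  have c: "c \<noteq> 0" using False by (simp add: c_def)
  have "((\<lambda>x::real. exp (c * x)) has_integral (exp (c * of_real (1/2)) / c - exp (c * of_real (-1/2)) / c)) {-1/2..1/2}"
  proof (rule fundamental_theorem_of_calculus)
    fix x :: real
    have "((\<lambda>w. exp (c * w) / c) has_field_derivative exp (c * of_real x)) (at (of_real x))"
      using c by (auto intro!: derivative_eq_intros)
    hence "((\<lambda>x. exp (c * of_real x) / c) has_vector_derivative exp (c * x)) (at x)"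
      using has_vector_derivative_real_field by blast
    thus "((\<lambda>x. exp (c * of_real x) / c) has_vector_derivative exp (c * x)) (at x within {-1/2..1/2})"
      by (rule has_vector_derivative_at_within)
  qed auto
  moreover have "exp (c * of_real (1/2)) = exp (c * of_real (-1/2))"
    unfolding exp_eq by (intro exI[of _ m]) (simp add: c_def)
  ultimately show ?thesis using False by (simp add: c_def)
qed

text \<open>On the line Re z = \<eta> the power series converges uniformly and can be integrated
  term by term over one period; only the term k = n survives.\<close>

lemma partition_number_has_integral:
  fixes \<eta> :: real
  assumes \<eta>: "\<eta> > 0"
  shows "((\<lambda>x. partition_gf (exp (- 2 * pi * Complex \<eta> x)) * exp (2 * pi * n * Complex \<eta> x))
           has_integral of_nat (partition_number n)) {-1/2..1/2}"
proof -
  define r where "r = exp (- 2 * pi * \<eta>)"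
  define E where "E = exp (2 * pi * n * \<eta>)"
  have r: "0 < r" "r < 1" using \<eta> by (auto simp: r_def)
  define a where "a = (\<lambda>k x. of_nat (partition_number k) * exp (- 2 * pi * Complex \<eta> x) ^ k * exp (2 * pi * n * Complex \<eta> x))"
  define F where "F = (\<lambda>x. partition_gf (exp (- 2 * pi * Complex \<eta> x)) * exp (2 * pi * n * Complex \<eta> x))"
  have norm1: "norm (exp (- 2 * pi * Complex \<eta> x)) = r" for x
    by (simp add: r_def)
  have norm2: "norm (exp (2 * pi * n * Complex \<eta> x)) = E" for x
    by (simp add: E_def)
  have summ: "summable (\<lambda>k. partition_number k * r ^ k)"
    using r by (intro summable_partition_number) auto
  have "uniform_limit {-1/2..1/2} (\<lambda>N x. \<Sum>k<N. a k x) (\<lambda>x. \<Sum>k. a k x) sequentially"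
  proof (rule Weierstrass_m_test)
    show "norm (a k x) \<le> partition_number k * r ^ k * E" for k x
      unfolding a_def norm_mult norm_power norm1 norm2 by simp
    show "summable (\<lambda>k. partition_number k * r ^ k * E)"
      using summ by (rule summable_mult2)
  qed
  also have "(\<lambda>x. \<Sum>k. a k x) = F"
  proof
    fix x
    have "summable (\<lambda>k. of_nat (partition_number k) * exp (- 2 * pi * Complex \<eta> x) ^ k)"
      by (rule summable_comparison_test'[OF summ]) (unfold norm_mult norm_power norm1, simp)
    thus "(\<Sum>k. a k x) = F x"
      by (simp add: a_def F_def partition_gf_def suminf_mult2 [symmetric])
  qed
  finally have ul: "uniform_limit {-1/2..1/2} (\<lambda>N x. \<Sum>k<N. a k x) F sequentially" .
  have ak: "(a k has_integral (if k = n then of_nat (partition_number n) else 0)) {-1/2..1/2}" for k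
  proof -
    let ?c = "of_nat (partition_number k) * exp (complex_of_real (2 * pi * (real n - real k) * \<eta>))"
    have eq: "a k x = ?c * exp (2 * pi * \<i> * (int n - int k) * x)" for x
    proof -
      have "exp (- 2 * pi * Complex \<eta> x) ^ k * exp (2 * pi * n * Complex \<eta> x) =
            exp (of_nat k * (- 2 * pi * Complex \<eta> x) + 2 * pi * n * Complex \<eta> x)"
        by (simp only: exp_add exp_of_nat_mult)
      also have "of_nat k * (- 2 * pi * Complex \<eta> x) + 2 * pi * n * Complex \<eta> x =
            2 * pi * (real n - real k) * \<eta> + 2 * pi * \<i> * (int n - int k) * x"
        by (simp add: Complex_eq algebra_simps)
      finally show ?thesis
        by (simp only: a_def exp_add mult.assoc)
    qed
    have "((\<lambda>x::real. ?c * exp (2 * pi * \<i> * (int n - int k) * x)) has_integral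
             (?c * (if int n - int k = 0 then 1 else 0))) {-1/2..1/2}"
      by (intro has_integral_mult_right has_integral_exp_period)
    moreover have "a k = (\<lambda>x::real. ?c * exp (2 * pi * \<i> * (int n - int k) * x))"
      by (rule ext) (rule eq)
    ultimately show ?thesis by (cases "k = n") auto
  qed
  have part: "((\<lambda>x. \<Sum>k<N. a k x) has_integral (if n < N then of_nat (partition_number n) else 0)) {-1/2..1/2}" for N
  proof -
    have "((\<lambda>x. \<Sum>k<N. a k x) has_integral (\<Sum>k<N. if k = n then of_nat (partition_number n) else 0)) {-1/2..1/2}"
      by (intro has_integral_sum ak) auto
    thus ?thesis by simp
  qed
  have cont: "continuous_on {-1/2..1/2} (\<lambda>x. \<Sum>k<N. a k x)" for N
    unfolding a_def Complex_eq by (intro continuous_intros)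
  obtain I J where IJ: "\<And>N. ((\<lambda>x. \<Sum>k<N. a k x) has_integral I N) {-1/2..1/2}"
    "(F has_integral J) {-1/2..1/2}" "I \<longlonglongrightarrow> J"
    using uniform_limit_integral[OF ul cont] by auto
  have "I N = (if n < N then of_nat (partition_number n) else 0)" for N
    using IJ(1) part has_integral_unique by blast
  hence "eventually (\<lambda>N. I N = of_nat (partition_number n)) sequentially"
    by (intro eventually_mono[OF eventually_gt_at_top[of n]]) simp
  hence "I \<longlonglongrightarrow> of_nat (partition_number n)" by (rule tendsto_eventually)
  with IJ(3) have "J = of_nat (partition_number n)" using LIMSEQ_unique by blast
  thus ?thesis using IJ(2) by (simp add: F_def)
qed

section \<open>The Gaussian integral and its truncation\<close>

lemma gaussian_has_integral: "((\<lambda>x::real. exp (- x\<^sup>2)) has_integral (sqrt pi / 2)) {0..}"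
proof -
  let ?g = "\<lambda>x::real. indicator {0..} x *\<^sub>R exp (- x\<^sup>2) :: real"
  have "integrable lborel ?g" "integral\<^sup>L lborel ?g = sqrt pi / 2"
    using gaussian_moment_0 unfolding has_bochner_integral_iff by blast+
  with has_integral_integral_lborel[of ?g] have "(?g has_integral (sqrt pi / 2)) UNIV"
    by (simp only:)
  also have "(\<lambda>x::real. indicator {0..} x *\<^sub>R exp (- x\<^sup>2)) = (\<lambda>x. if x \<in> {0..} then exp (- x\<^sup>2) else 0)"
    by (auto simp: indicator_def)
  finally show ?thesis by (simp only: has_integral_restrict_UNIV)
qed

text \<open>Beyond T the integrand is at most exp (- T x), whose integral is elementary.\<close>

lemma gaussian_truncated:
  fixes T :: real
  assumes T: "T > 0"
  shows "\<bar>integral {0..T} (\<lambda>x. exp (- x\<^sup>2)) - sqrt pi / 2\<bar> \<le> exp (- T\<^sup>2) / T"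
proof -
  let ?f = "\<lambda>x::real. exp (- x\<^sup>2)"
  have i1: "?f integrable_on {0..T}" by (intro integrable_continuous_interval continuous_intros)
  have i0: "?f integrable_on {0..}" using gaussian_has_integral by blast
  have i2: "?f integrable_on {T..}"
  proof -
    have "?f absolutely_integrable_on {0..}"
      by (rule nonnegative_absolutely_integrable_1) (use i0 in auto)
    hence "?f absolutely_integrable_on {T..}"
      by (rule set_integrable_subset) (use T in auto)
    thus ?thesis by (rule set_lebesgue_integral_eq_integral(1))
  qed
  have "(?f has_integral (integral {0..T} ?f + integral {T..} ?f)) ({0..T} \<union> {T..})"
  proof (intro has_integral_Un integrable_integral i1 i2)
    have "{0..T} \<inter> {T..} = {T}" using T by auto
    thus "negligible ({0..T} \<inter> {T..})" by simp
  qed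
  moreover have "{0..T} \<union> {T..} = {0..}" using T by auto
  ultimately have eq: "integral {0..T} ?f + integral {T..} ?f = sqrt pi / 2"
    using gaussian_has_integral has_integral_unique by metis
  have "integral {T..} ?f \<ge> 0" using i2 by (intro integral_nonneg) auto
  moreover have "integral {T..} ?f \<le> exp (- T * T) / T"
  proof (rule has_integral_le[OF integrable_integral[OF i2] has_integral_exp_minus_to_infinity[OF T]])
    fix x assume "x \<in> {T..}"
    thus "exp (- x\<^sup>2) \<le> exp (- T * x)" using T by (simp add: power2_eq_square)
  qed
  ultimately show ?thesis using eq by (simp add: power2_eq_square)
qed

section \<open>The saddle point integral\<close>

definition saddle_radius :: "real \<Rightarrow> real" where
  "saddle_radius \<mu> = pi / (6 * \<mu>)"

text \<open>For \<open>\<mu> = (\<pi> / 6) sqrt (24 n - 1)\<close> and \<open>\<rho> = \<pi> / (6 \<mu>)\<close> the exponent is \<open>\<pi> / (12 z) + 2 \<pi> (n - 1/24) z\<close>,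
  which is \<open>\<mu> cos t\<close> at \<open>z = \<rho> cis t\<close>.\<close>
definition saddle_integrand :: "real \<Rightarrow> complex \<Rightarrow> complex" where
  "saddle_integrand \<mu> z =
     csqrt z * exp (of_real (\<mu> / 2) * (of_real (saddle_radius \<mu>) / z + z / of_real (saddle_radius \<mu>)))"

lemma saddle_integrand_arc:
  assumes \<mu>: "\<mu> > 0" and t: "\<bar>t\<bar> < pi"
  shows "saddle_integrand \<mu> (of_real (saddle_radius \<mu>) * cis t) =
           of_real (sqrt (saddle_radius \<mu>) * exp (\<mu> * cos t)) * cis (t / 2)"
proof -
  define \<rho> where "\<rho> = saddle_radius \<mu>"
  let ?\<rho> = "complex_of_real \<rho>"
  have \<rho>: "\<rho> > 0" using \<mu> by (simp add: \<rho>_def saddle_radius_def)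
  have "csqrt (?\<rho> * cis t) = of_real (sqrt \<rho>) * cis (t / 2)"
  proof (rule csqrt_unique)
    show "(of_real (sqrt \<rho>) * cis (t / 2))\<^sup>2 = ?\<rho> * cis t"
      using \<rho> by (simp add: power_mult_distrib Complex.DeMoivre flip: of_real_power)
    have "cos (t / 2) > 0" using t by (intro cos_gt_zero_pi) auto
    thus "0 < Re (of_real (sqrt \<rho>) * cis (t / 2)) \<or>
      Re (of_real (sqrt \<rho>) * cis (t / 2)) = 0 \<and> 0 \<le> Im (of_real (sqrt \<rho>) * cis (t / 2))"
      using \<rho> by simp
  qed
  moreover have "?\<rho> / (?\<rho> * cis t) + ?\<rho> * cis t / ?\<rho> = of_real (2 * cos t)"
  proof -
    have "?\<rho> / (?\<rho> * cis t) = cis (- t)" using \<rho> by (simp add: divide_inverse cis_inverse)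
    moreover have "?\<rho> * cis t / ?\<rho> = cis t" using \<rho> by simp
    moreover have "cis (- t) + cis t = of_real (2 * cos t)" by (simp add: complex_eq_iff)
    ultimately show ?thesis by simp
  qed
  hence "exp (of_real (\<mu> / 2) * (?\<rho> / (?\<rho> * cis t) + ?\<rho> * cis t / ?\<rho>)) = of_real (exp (\<mu> * cos t))"
    by (simp only: of_real_mult [symmetric] exp_of_real) simp
  ultimately show ?thesis
    unfolding saddle_integrand_def \<rho>_def [symmetric] by (simp only: of_real_mult mult_ac)
qed

text \<open>The substitution \<open>u = sin (t / 2)\<close> makes the arc integral a Gaussian one.\<close>
lemma gaussian_arc_integral:
  fixes \<mu> \<theta> :: real
  assumes \<mu>: "\<mu> > 0" and \<theta>: "0 < \<theta>" "\<theta> < pi"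
  defines "u \<equiv> sin (\<theta> / 2)"
  shows "((\<lambda>t. cos (3 * t / 2) * exp (\<mu> * cos t)) has_integral
           2 * exp \<mu> * ((1 - 1 / \<mu>) * (2 / sqrt (2 * \<mu>) * integral {0..sqrt (2 * \<mu>) * u} (\<lambda>x. exp (- x\<^sup>2))) +
             2 * u / \<mu> * exp (- 2 * \<mu> * u\<^sup>2))) {- \<theta>..\<theta>}"
proof -
  define s where "s = sqrt (2 * \<mu>)"
  have s: "s > 0" "s\<^sup>2 = 2 * \<mu>" using \<mu> by (auto simp: s_def)
  have u: "u > 0" "u \<le> 1" unfolding u_def using \<theta> by (auto intro!: sin_gt_zero)
  let ?g = "\<lambda>x::real. exp (- x\<^sup>2)"
  \<comment> \<open>The base point \<open>- B\<close> lies outside [-s, s], so that \<open>W\<close>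
    has a two-sided derivative wherever it is evaluated.\<close>
  define B where "B = s + 1"
  define W where "W = (\<lambda>x. integral {- B..x} ?g)"
  have B: "B > 0" using s by (simp add: B_def)
  have derW: "(W has_real_derivative ?g x) (at x)" if "\<bar>x\<bar> \<le> s" for x
  proof -
    have "(W has_real_derivative ?g x) (at x within {- B..B})"
      unfolding W_def using that by (intro integral_has_real_derivative continuous_intros) (auto simp: B_def)
    moreover have "at x within {- B..B} = at x"
      using that by (intro at_within_Icc_at) (auto simp: B_def)
    ultimately show ?thesis by simp
  qed
  \<comment> \<open>With v = sin (t / 2) the integrand becomes 2 exp \<mu> (1 - 4 v^2) exp (- 2
    \<mu> v^2) dv. Integrating the part with v^2 by parts produces the coefficient 1 - 1/\<mu> and
    the boundary term with v / \<mu>.\<close>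
  define H where "H = (\<lambda>t. 2 * exp \<mu> * ((1 - 1 / \<mu>) * (W (s * sin (t / 2)) / s) +
                        1 / \<mu> * (sin (t / 2) * exp (- 2 * \<mu> * (sin (t / 2))\<^sup>2))))"
  have "((\<lambda>t. cos (3 * t / 2) * exp (\<mu> * cos t)) has_integral (H \<theta> - H (- \<theta>))) {- \<theta>..\<theta>}"
  proof (rule fundamental_theorem_of_calculus)
    fix t assume "t \<in> {- \<theta>..\<theta>}"
    define v where "v = sin (t / 2)"
    define c where "c = cos (t / 2)"
    have "\<bar>s * v\<bar> \<le> s" using s by (simp add: abs_mult v_def mult_left_le)
    have D1: "((\<lambda>t. W (s * sin (t / 2))) has_real_derivative ?g (s * v) * (s * (c * (1 / 2)))) (at t)"
    proof (rule DERIV_chain2[where f = W and g = "\<lambda>t. s * sin (t / 2)"])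
      show "(W has_real_derivative ?g (s * v)) (at (s * sin (t / 2)))"
        using derW[of "s * v"] \<open>\<bar>s * v\<bar> \<le> s\<close> by (simp add: v_def)
      show "((\<lambda>t. s * sin (t / 2)) has_real_derivative s * (c * (1 / 2))) (at t)"
        by (auto intro!: derivative_eq_intros simp: c_def)
    qed
    have D2: "((\<lambda>t. sin (t / 2) * exp (- 2 * \<mu> * (sin (t / 2))\<^sup>2)) has_real_derivative
                c / 2 * exp (- 2 * \<mu> * v\<^sup>2) * (1 - 4 * \<mu> * v\<^sup>2)) (at t)"
      by (auto intro!: derivative_eq_intros simp: v_def c_def algebra_simps power2_eq_square)
    have e: "?g (s * v) = exp (- 2 * \<mu> * v\<^sup>2)" using s(2) by (simp add: power_mult_distrib)
    have "(H has_real_derivative 2 * exp \<mu> * ((1 - 1 / \<mu>) * (?g (s * v) * (s * (c * (1 / 2))) / s) +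
             1 / \<mu> * (c / 2 * exp (- 2 * \<mu> * v\<^sup>2) * (1 - 4 * \<mu> * v\<^sup>2)))) (at t)"
      unfolding H_def by (intro DERIV_cmult DERIV_add DERIV_cdivide D1 D2)
    also have "2 * exp \<mu> * ((1 - 1 / \<mu>) * (?g (s * v) * (s * (c * (1 / 2))) / s) +
             1 / \<mu> * (c / 2 * exp (- 2 * \<mu> * v\<^sup>2) * (1 - 4 * \<mu> * v\<^sup>2))) =
          c * (1 - 4 * v\<^sup>2) * (exp \<mu> * exp (- 2 * \<mu> * v\<^sup>2))"
      unfolding e using s \<mu> by (simp add: field_simps)
    also have "c * (1 - 4 * v\<^sup>2) = cos (3 * t / 2)"
    proof -
      have "cos (3 * (t / 2)) = 4 * c ^ 3 - 3 * c" unfolding c_def by (rule cos_treble_cos)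
      also have "\<dots> = c * (4 * c\<^sup>2 - 3)" by (simp add: algebra_simps power2_eq_square power3_eq_cube)
      also have "c\<^sup>2 = 1 - v\<^sup>2" unfolding c_def v_def by (rule cos_squared_eq)
      finally show ?thesis by simp
    qed
    also have "exp \<mu> * exp (- 2 * \<mu> * v\<^sup>2) = exp (\<mu> * cos t)"
    proof -
      have "cos t = 1 - 2 * v\<^sup>2" using cos_double_sin[of "t / 2"] by (simp add: v_def)
      hence "\<mu> + - 2 * \<mu> * v\<^sup>2 = \<mu> * cos t" by (simp add: right_diff_distrib)
      thus ?thesis by (simp only: exp_add [symmetric])
    qed
    finally show "(H has_vector_derivative cos (3 * t / 2) * exp (\<mu> * cos t)) (at t within {- \<theta>..\<theta>})"
      by (simp add: has_real_derivative_iff_has_vector_derivative has_vector_derivative_at_within)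
  qed (use \<theta> in auto)
  moreover have "H \<theta> - H (- \<theta>) = 2 * exp \<mu> * ((1 - 1 / \<mu>) * (2 / s * integral {0..s * u} ?g) +
             2 * u / \<mu> * exp (- 2 * \<mu> * u\<^sup>2))"
  proof -
    have "s * u \<le> s * 1" using u s by (intro mult_left_mono) auto
    hence su: "s * u \<le> B" unfolding B_def by linarith
    have su0: "s * u \<ge> 0" using u s by simp
    have int: "?g integrable_on {a..b}" for a b :: real
      by (intro integrable_continuous_interval continuous_intros)
    have "W (s * u) = W (- (s * u)) + integral {- (s * u)..s * u} ?g"
      unfolding W_def using su su0 int by (intro Henstock_Kurzweil_Integration.integral_combine [symmetric]) auto
    moreover have "integral {- (s * u)..s * u} ?g = integral {- (s * u)..0} ?g + integral {0..s * u} ?g"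
      using su su0 int by (intro Henstock_Kurzweil_Integration.integral_combine [symmetric]) auto
    moreover have "integral {- (s * u)..0} ?g = integral {0..s * u} ?g"
      using Henstock_Kurzweil_Integration.integral_reflect_real[of "s * u" 0 ?g] by simp
    ultimately have W: "W (s * u) - W (- (s * u)) = 2 * integral {0..s * u} ?g" by simp
    have "H \<theta> - H (- \<theta>) = 2 * exp \<mu> * ((1 - 1 / \<mu>) * ((W (s * u) - W (- (s * u))) / s) +
             2 * u / \<mu> * exp (- 2 * \<mu> * u\<^sup>2))"
      unfolding H_def u_def by (simp add: algebra_simps diff_divide_distrib)
    thus ?thesis unfolding W by simp
  qed
  ultimately show ?thesis by (simp add: s_def)
qed

lemma holomorphic_saddle_integrand: "saddle_integrand \<mu> holomorphic_on {z. Re z > 0}"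
proof -
  have "z \<notin> \<real>\<^sub>\<le>\<^sub>0" "z \<noteq> 0" if "Re z > 0" for z
    using that by (auto simp: complex_nonpos_Reals_iff)
  thus ?thesis
    unfolding saddle_integrand_def by (intro holomorphic_intros) auto
qed

text \<open>Cauchy's theorem in the right half-plane, where \<open>csqrt\<close> is holomorphic: the
  vertical chord and the arc have the same endpoints, and \<theta> < pi / 2 keeps the arc in that
  half-plane.\<close>

lemma saddle_integral_line:
  fixes \<mu> \<theta> :: real
  assumes \<mu>: "\<mu> > 0" and \<theta>: "0 < \<theta>" "\<theta> < pi / 2"
  defines "\<rho> \<equiv> saddle_radius \<mu>"
  obtains J where "((\<lambda>x. saddle_integrand \<mu> (Complex (\<rho> * cos \<theta>) x)) has_integral J) {- (\<rho> * sin \<theta>)..\<rho> * sin \<theta>}"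
    "((\<lambda>t. cos (3 * t / 2) * exp (\<mu> * cos t)) has_integral (Re J / (\<rho> * sqrt \<rho>))) {- \<theta>..\<theta>}"
proof -
  define f where "f = saddle_integrand \<mu>"
  have \<rho>: "\<rho> > 0" using \<mu> by (simp add: \<rho>_def saddle_radius_def)
  define a where "a = Complex (\<rho> * cos \<theta>) (- (\<rho> * sin \<theta>))"
  define b where "b = Complex (\<rho> * cos \<theta>) (\<rho> * sin \<theta>)"
  define S where "S = {z. Re z > 0}"
  have cos: "cos t > 0" if "t \<in> {- \<theta>..\<theta>}" for t using \<theta> that by (intro cos_gt_zero_pi) auto
  have sin: "sin \<theta> > 0" using \<theta> by (intro sin_gt_zero) auto
  have conv: "convex S" unfolding S_def by (rule convex_halfspace_Re_gt)
  have hol: "f holomorphic_on S" unfolding f_def S_def by (rule holomorphic_saddle_integrand)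
  have ab: "a \<in> S" "b \<in> S" using \<rho> cos[of \<theta>] \<theta> by (auto simp: a_def b_def S_def)
  let ?arc = "part_circlepath 0 \<rho> (- \<theta>) \<theta>"
  have ends: "pathstart ?arc = a" "pathfinish ?arc = b"
    by (simp_all add: a_def b_def complex_eq_iff pathstart_def pathfinish_def part_circlepath_def linepath_def
          Re_exp Im_exp)
  have arcS: "path_image ?arc \<subseteq> S"
    using \<rho> cos \<theta> by (auto simp: path_image_part_circlepath' S_def closed_segment_eq_real_ivl)
  have seg: "closed_segment a b \<subseteq> S" "closed_segment b a \<subseteq> S"
    using ab conv closed_segment_subset by blast+
  have "(f has_contour_integral 0) (?arc +++ linepath b a)"
  proof (rule Cauchy_theorem_convex_simple[OF hol conv])
    show "path_image (?arc +++ linepath b a) \<subseteq> S"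
      using arcS seg by (intro subset_path_image_join) auto
    show "valid_path (?arc +++ linepath b a)"
      by (rule valid_path_join) (auto simp: ends(2) simp del: pathfinish_part_circlepath)
    show "pathfinish (?arc +++ linepath b a) = pathstart (?arc +++ linepath b a)"
      by (simp add: ends(1) del: pathstart_part_circlepath)
  qed
  moreover have i1: "f contour_integrable_on ?arc"
    by (rule contour_integrable_holomorphic_simple[OF hol]) (use arcS in \<open>auto simp: S_def open_halfspace_Re_gt\<close>)
  moreover have i2: "f contour_integrable_on linepath b a"
    by (rule contour_integrable_holomorphic_simple[OF hol])
       (use seg in \<open>auto simp: S_def open_halfspace_Re_gt\<close>)
  ultimately have "contour_integral ?arc f + contour_integral (linepath b a) f = 0"
    using contour_integral_join[OF i1 i2] contour_integral_unique[of f 0 "?arc +++ linepath b a"]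
    by (simp add: ends(2) del: pathfinish_part_circlepath)
  hence "contour_integral (linepath a b) f = contour_integral ?arc f"
    using contour_integral_reverse_linepath[of a b f]
      continuous_on_subset[OF holomorphic_on_imp_continuous_on[OF hol] seg(1)]
    by (simp add: add_eq_0_iff)
  moreover have "(f has_contour_integral contour_integral (linepath a b) f) (linepath a b)"
  proof (rule has_contour_integral_integral, rule contour_integrable_holomorphic_simple[OF hol])
    show "path_image (linepath a b) \<subseteq> S" using seg by simp
  qed (auto simp: S_def open_halfspace_Re_gt)
  ultimately have line: "(f has_contour_integral contour_integral ?arc f) (linepath a b)" by simp
  define I where "I = contour_integral ?arc f"
  \<comment> \<open>On the vertical chord dz = i dx, hence the factor \<open>- \<i>\<close>.\<close>
  have 1: "((\<lambda>x. f (Complex (\<rho> * cos \<theta>) x)) has_integral (- \<i> * I)) {- (\<rho> * sin \<theta>)..\<rho> * sin \<theta>}"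
    using line by (subst (asm) has_contour_integral_linepath_same_Re_iff)
                  (use \<rho> sin in \<open>auto simp: a_def b_def I_def\<close>)
  have "(f has_contour_integral I) ?arc"
    unfolding I_def using i1 by (rule has_contour_integral_integral)
  hence "((\<lambda>t. f (0 + \<rho> * cis t) * \<rho> * \<i> * cis t) has_integral I) {- \<theta>..\<theta>}"
    using \<theta> by (subst (asm) has_contour_integral_part_circlepath_iff) auto
  hence "((\<lambda>t. - \<i> * (f (0 + \<rho> * cis t) * \<rho> * \<i> * cis t)) has_integral (- \<i> * I)) {- \<theta>..\<theta>}"
    by (rule has_integral_mult_right)
  from has_integral_linear[OF this bounded_linear_Re]
  have "((\<lambda>t. Re (- \<i> * (f (0 + \<rho> * cis t) * \<rho> * \<i> * cis t))) has_integral Re (- \<i> * I)) {- \<theta>..\<theta>}"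
    unfolding o_def .
  \<comment> \<open>The square root contributes the angle t / 2 and dz the angle t; this is the
    source of cos (3 t / 2).\<close>
  moreover have "Re (- \<i> * (f (0 + \<rho> * cis t) * \<rho> * \<i> * cis t)) = \<rho> * sqrt \<rho> * (cos (3 * t / 2) * exp (\<mu> * cos t))"
    if "t \<in> {- \<theta>..\<theta>}" for t
  proof -
    have "f (0 + \<rho> * cis t) = of_real (sqrt \<rho> * exp (\<mu> * cos t)) * cis (t / 2)"
    proof -
      have "\<bar>t\<bar> < pi" using that \<theta> unfolding atLeastAtMost_iff by linarith
      from saddle_integrand_arc[OF \<mu> this] show ?thesis by (simp add: f_def \<rho>_def)
    qed
    hence "- \<i> * (f (0 + \<rho> * cis t) * \<rho> * \<i> * cis t) =
             - \<i> * (of_real (sqrt \<rho> * exp (\<mu> * cos t)) * cis (t / 2) * \<rho> * \<i> * cis t)"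
      by (simp only:)
    also have "\<dots> = of_real (\<rho> * sqrt \<rho> * exp (\<mu> * cos t)) * (cis (t / 2) * cis t)"
    proof -
      have "\<i> * \<i> = -1" by simp
      hence "- \<i> * (x * c * y * \<i> * d) = (y * x) * (c * d)" for x y c d :: complex by algebra
      from this[of "of_real (sqrt \<rho> * exp (\<mu> * cos t))"] show ?thesis by (simp only: of_real_mult mult.assoc)
    qed
    also have "cis (t / 2) * cis t = cis (3 * t / 2)" by (simp add: cis_mult)
    finally show ?thesis by simp
  qed
  ultimately have "((\<lambda>t. \<rho> * sqrt \<rho> * (cos (3 * t / 2) * exp (\<mu> * cos t))) has_integral Re (- \<i> * I)) {- \<theta>..\<theta>}"
    by (rule has_integral_eq[rotated])
  hence "((\<lambda>t. 1 / (\<rho> * sqrt \<rho>) * (\<rho> * sqrt \<rho> * (cos (3 * t / 2) * exp (\<mu> * cos t)))) has_integral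
           1 / (\<rho> * sqrt \<rho>) * Re (- \<i> * I)) {- \<theta>..\<theta>}"
    by (rule has_integral_mult_right)
  hence 2: "((\<lambda>t. cos (3 * t / 2) * exp (\<mu> * cos t)) has_integral (Re (- \<i> * I) / (\<rho> * sqrt \<rho>))) {- \<theta>..\<theta>}"
    using \<rho> by (simp add: mult.assoc [symmetric])
  show ?thesis using that[of "- \<i> * I"] 1 2 by (simp add: f_def)
qed

section \<open>Bounds on the vertical line\<close>

lemma sin_ge_two_over_pi:
  fixes y :: real
  assumes "0 \<le> y" "y \<le> pi / 2"
  shows "2 * y / pi \<le> sin y"
proof -
  have "concave_on {0..pi} (sin :: real \<Rightarrow> real)"
    by (rule f''_le0_imp_concave[where f' = cos and f'' = "\<lambda>x. - sin x"])
       (auto intro!: derivative_eq_intros sin_ge_zero)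
  from concave_onD[OF this, of "2 * y / pi" 0 "pi / 2"] show ?thesis
    using assms by (simp add: field_simps)
qed

text \<open>With a = exp (2 pi \<eta>) the squared norm is (a - 1)^2 + 4 a sin^2 (pi x), and a >= 1
  makes the bound independent of \<eta>. Jordan's inequality finishes.\<close>

lemma norm_exp_minus_one_ge:
  assumes "\<bar>x\<bar> \<le> 1 / 2" "\<eta> > 0"
  shows "4 * \<bar>x\<bar> \<le> norm (exp (2 * pi * Complex \<eta> x) - 1)"
proof -
  define a where "a = exp (2 * pi * \<eta>)"
  have a: "a \<ge> 1" using assms by (simp add: a_def)
  have "(sin (pi * x))\<^sup>2 = (sin (pi * \<bar>x\<bar>))\<^sup>2" by (cases "x \<ge> 0") auto
  moreover have "2 * \<bar>x\<bar> \<le> sin (pi * \<bar>x\<bar>)"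
    using sin_ge_two_over_pi[of "pi * \<bar>x\<bar>"] assms by (simp add: mult_left_le field_simps)
  ultimately have s: "(2 * \<bar>x\<bar>)\<^sup>2 \<le> (sin (pi * x))\<^sup>2"
    using power_mono[of "2 * \<bar>x\<bar>" "sin (pi * \<bar>x\<bar>)" 2] by simp
  have "exp (2 * pi * Complex \<eta> x) = of_real a * cis (2 * (pi * x))"
    by (simp add: exp_eq_polar a_def mult_ac)
  hence "(norm (exp (2 * pi * Complex \<eta> x) - 1))\<^sup>2 = (a * cos (2 * (pi * x)) - 1)\<^sup>2 + (a * sin (2 * (pi * x)))\<^sup>2"
    by (simp add: cmod_power2)
  also have "\<dots> = a\<^sup>2 * ((sin (2 * (pi * x)))\<^sup>2 + (cos (2 * (pi * x)))\<^sup>2) - 2 * a * cos (2 * (pi * x)) + 1"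
  proof -
    have "(a * c - 1)\<^sup>2 + (a * d)\<^sup>2 = a\<^sup>2 * (d\<^sup>2 + c\<^sup>2) - 2 * a * c + 1" for c d
      by (simp add: power2_eq_square algebra_simps)
    thus ?thesis .
  qed
  also have "\<dots> = (a - 1)\<^sup>2 + 4 * a * (sin (pi * x))\<^sup>2"
    unfolding sin_cos_squared_add unfolding cos_double_sin[of "pi * x"] by (simp add: power2_eq_square algebra_simps)
  also have "\<dots> \<ge> 0 + 4 * 1 * (2 * \<bar>x\<bar>)\<^sup>2"
    using a s by (intro add_mono mult_mono) auto
  finally have "(4 * \<bar>x\<bar>)\<^sup>2 \<le> (norm (exp (2 * pi * Complex \<eta> x) - 1))\<^sup>2"
    by (simp add: power_mult_distrib)
  thus ?thesis by (rule power2_le_imp_le) auto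
qed

text \<open>The inequality exp u - 1 >= u reduces the Lambert series to the sum of 1/k^2.\<close>

lemma suminf_minus_ln_le:
  fixes t :: real
  assumes t: "t > 0"
  shows "(\<Sum>k. - ln (1 - exp (- 2 * pi * t) ^ Suc k)) \<le> pi / (12 * t)"
proof -
  have 1: "(\<lambda>j. 1 / (2 * pi * t) * (1 / (real j + 1)\<^sup>2)) sums (1 / (2 * pi * t) * (pi\<^sup>2 / 6))"
    using inverse_squares_sums by (intro sums_mult) (simp add: add.commute)
  have 2: "1 / real (Suc j) * (1 / (exp (2 * pi * Suc j * t) - 1)) \<le> 1 / (2 * pi * t) * (1 / (real j + 1)\<^sup>2)" for j
  proof -
    have "2 * pi * Suc j * t \<le> exp (2 * pi * Suc j * t) - 1"
      using exp_ge_add_one_self[of "2 * pi * Suc j * t"] by linarith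
    hence "1 / (exp (2 * pi * Suc j * t) - 1) \<le> 1 / (2 * pi * Suc j * t)"
      using t by (intro divide_left_mono mult_pos_pos) auto
    hence "1 / real (Suc j) * (1 / (exp (2 * pi * Suc j * t) - 1)) \<le> 1 / real (Suc j) * (1 / (2 * pi * Suc j * t))"
      by (intro mult_left_mono) auto
    also have "\<dots> = 1 / (2 * pi * t) * (1 / (real j + 1)\<^sup>2)" by (simp add: power2_eq_square add_ac mult_ac)
    finally show ?thesis .
  qed
  have "(\<Sum>k. - ln (1 - exp (- 2 * pi * t) ^ Suc k)) \<le> 1 / (2 * pi * t) * (pi\<^sup>2 / 6)"
    by (rule sums_le[OF 2 ln_partition_gf_lambert[OF t] 1])
  also have "\<dots> = pi / (12 * t)" using t by (simp add: power2_eq_square)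
  finally show ?thesis .
qed

text \<open>On this disc - ln (1 - x) <= 4 x / 3, so ln P(1/4) is at most 4/3 times the geometric
  sum 1/3, and exp (4/9) <= 2. The factor 4 is 1/r for r = 1/4.\<close>

lemma partition_gf_quarter:
  fixes w :: complex
  assumes w: "norm w \<le> 1 / 4"
  shows "norm (partition_gf w) \<le> 2" "norm (partition_gf w - 1) \<le> 4 * norm w"
proof -
  define P where "P = (\<Sum>n. partition_number n * (1 / 4 :: real) ^ n)"
  have sumle: "(\<Sum>k. - ln (1 - (1 / 4 :: real) ^ Suc k)) \<le> 4 / 9"
  proof (rule sums_le[OF _ summable_sums])
    show "summable (\<lambda>k. - ln (1 - (1 / 4 :: real) ^ Suc k))" by (rule summable_minus_ln_power) auto
    show "(\<lambda>k. (1 / 4 :: real) ^ Suc k / (1 - 1 / 4)) sums (4 / 9)"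
      using sums_mult[OF geometric_sums[of "1 / 4 :: real"], of "1 / 3"] by simp
    fix k
    have "(1 / 4 :: real) ^ k \<le> 1" by (rule power_le_one) auto
    thus "- ln (1 - (1 / 4 :: real) ^ Suc k) \<le> (1 / 4) ^ Suc k / (1 - 1 / 4)"
      by (intro minus_ln_one_minus_le) auto
  qed
  have "complex_of_real P = of_real (exp (\<Sum>k. - ln (1 - (1 / 4 :: real) ^ Suc k)))"
    unfolding P_def using partition_gf_of_real_eq_suminf[of "1 / 4"] partition_gf_of_real[of "1 / 4"] by simp
  hence "P = exp (\<Sum>k. - ln (1 - (1 / 4 :: real) ^ Suc k))" by (simp only: of_real_eq_iff)
  also have "\<dots> \<le> exp (4 / 9)" using sumle by simp
  also have "\<dots> \<le> 2"
    using exp_bound_half[of "4 / 9 :: real"] exp_bound[of "4 / 9 :: real"] by (simp add: power2_eq_square)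
  finally have P: "P \<le> 2" .
  show "norm (partition_gf w) \<le> 2"
    using norm_partition_gf_le[OF w] P by (simp add: P_def)
  have "norm (partition_gf w - 1) \<le> norm w / (1 / 4) * (P - 1)"
    unfolding P_def using w by (intro norm_partition_gf_minus_one_le) auto
  also have "\<dots> \<le> norm w / (1 / 4) * 1" using P by (intro mult_left_mono) auto
  finally show "norm (partition_gf w - 1) \<le> 4 * norm w" by simp
qed

lemma Re_inverse_Complex: "Re (1 / Complex \<eta> x) = \<eta> / (\<eta>\<^sup>2 + x\<^sup>2)"
  by (simp add: Re_divide)

lemma norm_saddle_integrand:
  assumes "z \<noteq> 0"
  shows "norm (saddle_integrand \<mu> z) =
     sqrt (norm z) * exp (\<mu> / 2 * (saddle_radius \<mu> * Re (1 / z) + Re z / saddle_radius \<mu>))"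
proof -
  have "Re (of_real a * (of_real b / z + z / of_real b)) = a * (b * Re (1 / z) + Re z / b)" for a b
  proof -
    have *: "Re (of_real c * w) = c * Re w" for c w by simp
    have "of_real b / z = of_real b * (1 / z)" by simp
    hence "Re (of_real b / z) = b * Re (1 / z)" by (simp only: *)
    thus ?thesis by (simp only: * plus_complex.sel Re_divide_of_real)
  qed
  thus ?thesis unfolding saddle_integrand_def by (simp add: norm_mult)
qed

lemma partition_integrand_eq:
  fixes n :: nat and z :: complex
  assumes z: "Re z > 0" and \<mu>: "\<mu> = pi / 6 * sqrt (24 * real n - 1)" and n: "n > 0"
  shows "partition_gf (exp (- 2 * pi * z)) * exp (2 * pi * n * z) =
           saddle_integrand \<mu> z * partition_gf (exp (- 2 * pi / z))"
proof -
  have \<mu>0: "\<mu> > 0" using n by (simp add: \<mu>)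
  have "\<mu>\<^sup>2 = pi\<^sup>2 / 36 * (24 * real n - 1)" using n by (simp add: \<mu> power_mult_distrib power_divide)
  hence m: "\<mu> * \<mu> * 36 = pi * pi * (24 * real n - 1)" by (simp add: power2_eq_square)
  have c1: "\<mu> / 2 * saddle_radius \<mu> = pi / 12" using \<mu>0 by (simp add: saddle_radius_def)
  have c2: "\<mu> / 2 / saddle_radius \<mu> = 2 * pi * n - pi / 12"
    using \<mu>0 m by (simp add: saddle_radius_def field_simps)
  have "exp (pi / 12 * (1 / z - z)) * exp (2 * pi * n * z) =
        exp (of_real (pi / 12) * (1 / z) + of_real (2 * pi * n - pi / 12) * z)"
  proof -
    have *: "k * (1 / z - z) + m * z = k * (1 / z) + (m - k) * z" for k m :: complex
      by (simp add: algebra_simps)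
    show ?thesis by (simp only: exp_add [symmetric] of_real_diff *)
  qed
  also have "of_real (pi / 12) * (1 / z) + of_real (2 * pi * n - pi / 12) * z =
     of_real (\<mu> / 2) * (of_real (saddle_radius \<mu>) / z + z / of_real (saddle_radius \<mu>))"
  proof -
    have "k * (r / z + z / r) = (k * r) * (1 / z) + (k / r) * z" for k r :: complex
      by (simp add: distrib_left)
    from this[of "of_real (\<mu> / 2)" "of_real (saddle_radius \<mu>)"] show ?thesis
      by (simp only: c1 c2 flip: of_real_mult of_real_divide)
  qed
  finally show ?thesis
    unfolding partition_gf_transform[OF z] saddle_integrand_def by (simp only: mult_ac)
qed


text \<open>Places exp (- 2 pi / z) in the disc of radius 1/4. The 12 comes from 2 pi = 12 \<mu>
  \<rho>, where \<rho> is the saddle radius.\<close>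

lemma exp_minus_le_quarter:
  fixes x :: real
  assumes "x \<ge> 1 / 5"
  shows "exp (- (12 * x)) \<le> 1 / 4"
proof -
  have "4 \<le> exp (12 / 5 :: real)"
    using exp_lower_Taylor_quadratic[of "12 / 5 :: real"] by (simp add: power2_eq_square)
  also have "\<dots> \<le> exp (12 * x)" using assms by simp
  finally have "4 \<le> exp (12 * x)" .
  thus ?thesis by (simp add: exp_minus field_simps)
qed

text \<open>The line Re z = 2 \<rho> / 3 leaves the circle |z| = \<rho> at x^2 = 5/9 \<rho>^2.
  Inside, \<rho> Re (1/z) >= 2/3 makes exp (- 2 pi / z) tiny. Outside, \<rho> Re (1/z) <= 2/3, so
  the exponent is at most \<mu>/2 (2/3 + 2/3).\<close>

lemma saddle_integrand_ray_bounds: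
  fixes \<mu> x :: real and z :: complex
  assumes \<mu>: "\<mu> \<ge> 72"
  defines "\<rho> \<equiv> saddle_radius \<mu>"
  defines "\<eta> \<equiv> 2 / 3 * \<rho>"
  defines "z \<equiv> Complex \<eta> x"
  shows "x\<^sup>2 \<le> 5 / 9 * \<rho>\<^sup>2 \<Longrightarrow>
           norm (saddle_integrand \<mu> z * partition_gf (exp (- 2 * pi / z)) - saddle_integrand \<mu> z) \<le>
             4 * sqrt \<rho> * exp (\<mu> / 3)"
    and "5 / 9 * \<rho>\<^sup>2 \<le> x\<^sup>2 \<Longrightarrow> \<bar>x\<bar> \<le> 20 * \<eta> \<Longrightarrow>
           norm (saddle_integrand \<mu> z * partition_gf (exp (- 2 * pi / z))) \<le> exp (2 / 3 * \<mu>)"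
proof -
  have \<rho>0: "\<rho> > 0" using \<mu> by (simp add: \<rho>_def saddle_radius_def)
  have \<mu>\<rho>: "\<mu> * \<rho> = pi / 6" using \<mu> by (simp add: \<rho>_def saddle_radius_def)
  have \<rho>_le: "\<rho> \<le> 1 / 100"
  proof -
    have "72 * \<rho> \<le> \<mu> * \<rho>" using \<mu> \<rho>0 by (intro mult_right_mono) auto
    thus ?thesis unfolding \<mu>\<rho> using pi_approx(2) by simp
  qed
  have \<eta>0: "\<eta> > 0" using \<rho>0 by (simp add: \<eta>_def)
  define N where "N = \<eta>\<^sup>2 + x\<^sup>2"
  define R where "R = \<eta> / N"
  have N0: "N > 0" using \<eta>0 by (auto simp: N_def intro!: add_pos_nonneg)
  have R0: "R > 0" using \<eta>0 N0 by (simp add: R_def)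
  have \<eta>2: "\<eta>\<^sup>2 = 4 / 9 * \<rho>\<^sup>2" by (simp add: \<eta>_def power_mult_distrib power_divide)
  have z0: "z \<noteq> 0" using \<eta>0 by (auto simp: z_def complex_eq_iff)
  have Rz: "Re (1 / z) = R" unfolding z_def R_def N_def by (rule Re_inverse_Complex)
  have nz: "norm z = sqrt N" by (simp add: z_def N_def cmod_def)
  define w where "w = exp (- 2 * pi / z)"
  have nw: "norm w = exp (- (12 * (\<mu> * \<rho> * R)))"
  proof -
    have "- 2 * pi / z = of_real (- 2 * pi) * (1 / z)" by simp
    hence "Re (- 2 * pi / z) = - 2 * pi * Re (1 / z)" by (simp only: times_complex.sel Re_complex_of_real Im_complex_of_real mult_zero_left diff_zero)
    thus ?thesis by (simp add: w_def Rz \<mu>\<rho> norm_exp_eq_Re)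
  qed
  have nS: "norm (saddle_integrand \<mu> z) = sqrt (sqrt N) * exp (\<mu> * \<rho> * R / 2 + \<mu> / 3)"
  proof -
    have "\<mu> / 2 * (\<rho> * R + \<eta> / \<rho>) = \<mu> * \<rho> * R / 2 + \<mu> / 3" using \<rho>0 by (simp add: \<eta>_def field_simps)
    thus ?thesis unfolding norm_saddle_integrand[OF z0] Rz nz \<rho>_def [symmetric] by (simp add: z_def)
  qed
  show "norm (saddle_integrand \<mu> z * partition_gf (exp (- 2 * pi / z)) - saddle_integrand \<mu> z) \<le>
          4 * sqrt \<rho> * exp (\<mu> / 3)" if x: "x\<^sup>2 \<le> 5 / 9 * \<rho>\<^sup>2"
  proof -
    have N: "N \<le> \<rho>\<^sup>2" using x \<eta>2 by (simp add: N_def)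
    have "\<rho> * R \<ge> 2 / 3"
    proof -
      have "\<rho> * R = 2 / 3 * (\<rho>\<^sup>2 / N)" by (simp add: R_def \<eta>_def power2_eq_square)
      moreover have "\<rho>\<^sup>2 / N \<ge> 1" using N N0 by simp
      ultimately show ?thesis by simp
    qed
    hence "72 * (2 / 3) \<le> \<mu> * (\<rho> * R)" using \<mu> by (intro mult_mono) auto
    hence big: "\<mu> * \<rho> * R \<ge> 48" by (simp add: mult.assoc)
    have w4: "norm w \<le> 1 / 4" unfolding nw by (rule exp_minus_le_quarter) (use big in linarith)
    have "norm (saddle_integrand \<mu> z * partition_gf w - saddle_integrand \<mu> z) =
            norm (saddle_integrand \<mu> z) * norm (partition_gf w - 1)"
      by (simp add: norm_mult [symmetric] algebra_simps)
    also have "\<dots> \<le> (sqrt \<rho> * exp (\<mu> * \<rho> * R / 2 + \<mu> / 3)) * (4 * norm w)"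
    proof (intro mult_mono partition_gf_quarter w4)
      have "sqrt N \<le> \<rho>" using N \<rho>0 by (intro real_le_lsqrt) auto
      thus "norm (saddle_integrand \<mu> z) \<le> sqrt \<rho> * exp (\<mu> * \<rho> * R / 2 + \<mu> / 3)"
        unfolding nS by (intro mult_right_mono real_sqrt_le_mono) auto
    qed (use \<rho>0 in auto)
    also have "\<dots> = 4 * sqrt \<rho> * exp (\<mu> * \<rho> * R / 2 + \<mu> / 3 + - (12 * (\<mu> * \<rho> * R)))"
      unfolding nw exp_add by simp
    \<comment> \<open>The growth 1/2 and the decay 12 are rates in the same quantity \<mu> \<rho> R,
      so only exp (\<mu>/3) from the real part of z is left.\<close>
    also have "\<dots> \<le> 4 * sqrt \<rho> * exp (\<mu> / 3)"
    proof (rule mult_left_mono)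
      have "\<mu> * \<rho> * R / 2 + \<mu> / 3 + - (12 * (\<mu> * \<rho> * R)) \<le> \<mu> / 3" using big by linarith
      thus "exp (\<mu> * \<rho> * R / 2 + \<mu> / 3 + - (12 * (\<mu> * \<rho> * R))) \<le> exp (\<mu> / 3)"
        by (simp only: exp_le_cancel_iff)
    qed (use \<rho>0 in simp)
    finally show ?thesis by (simp add: w_def)
  qed
  show "norm (saddle_integrand \<mu> z * partition_gf (exp (- 2 * pi / z))) \<le> exp (2 / 3 * \<mu>)"
    if x: "5 / 9 * \<rho>\<^sup>2 \<le> x\<^sup>2" "\<bar>x\<bar> \<le> 20 * \<eta>"
  proof -
    have N: "N \<ge> \<rho>\<^sup>2" using x \<eta>2 by (simp add: N_def)
    have x2: "x\<^sup>2 \<le> 400 * \<eta>\<^sup>2"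
      using power_mono[OF x(2), of 2] by (simp add: power_mult_distrib)
    hence N': "N \<le> 401 * \<eta>\<^sup>2" by (simp add: N_def)
    have le: "\<rho> * R \<le> 2 / 3"
    proof -
      have "\<rho> * R = 2 / 3 * (\<rho>\<^sup>2 / N)" by (simp add: R_def \<eta>_def power2_eq_square)
      moreover have "\<rho>\<^sup>2 / N \<le> 1" using N N0 by simp
      ultimately show ?thesis by simp
    qed
    \<comment> \<open>401 = 20^2 + 1 reflects |x| <= 20 \<eta>. With \<mu> >= 72 it leaves \<mu>
      \<rho> R >= 0.24, just enough for |w| <= 1/4.\<close>
    have "1 / 401 \<le> \<eta> * R"
      using N' N0 by (simp add: R_def field_simps power2_eq_square)
    hence "1 / 300 \<le> \<rho> * R" by (simp add: \<eta>_def)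
    hence "72 * (1 / 300) \<le> \<mu> * (\<rho> * R)" using \<mu> by (intro mult_mono) auto
    hence big: "\<mu> * \<rho> * R \<ge> 1 / 5" by (simp add: mult.assoc)
    have w4: "norm w \<le> 1 / 4" unfolding nw by (rule exp_minus_le_quarter) (use big in linarith)
    have "norm (saddle_integrand \<mu> z * partition_gf w) = norm (saddle_integrand \<mu> z) * norm (partition_gf w)"
      by (rule norm_mult)
    \<comment> \<open>The factor sqrt |z|, at most 1/2, absorbs the bound 2 for the generating
      function.\<close>
    also have "\<dots> \<le> (1 / 2 * exp (2 / 3 * \<mu>)) * 2"
    proof (intro mult_mono partition_gf_quarter w4)
      have "N \<le> 401 * (4 / 9 * \<rho>\<^sup>2)" using N' by (simp add: \<eta>2)
      moreover have "\<rho>\<^sup>2 \<le> (1 / 100)\<^sup>2" using \<rho>_le \<rho>0 by (intro power_mono) auto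
      moreover have "401 * (4 / 9 * (1 / 100)\<^sup>2) \<le> ((1 / 4)\<^sup>2 :: real)" by (simp add: power2_eq_square)
      ultimately have "N \<le> (1 / 4)\<^sup>2" by linarith
      hence "sqrt N \<le> 1 / 4" using N0 by (intro real_le_lsqrt) auto
      hence "sqrt (sqrt N) \<le> sqrt (1 / 4)" by (rule real_sqrt_le_mono)
      hence s: "sqrt (sqrt N) \<le> 1 / 2" by (simp add: real_sqrt_divide)
      have "\<mu> * (\<rho> * R) \<le> \<mu> * (2 / 3)" using le \<mu> by (intro mult_left_mono) auto
      hence "\<mu> * \<rho> * R / 2 + \<mu> / 3 \<le> 2 / 3 * \<mu>" unfolding mult.assoc by linarith
      hence "exp (\<mu> * \<rho> * R / 2 + \<mu> / 3) \<le> exp (2 / 3 * \<mu>)" by (simp only: exp_le_cancel_iff)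
      with s show "norm (saddle_integrand \<mu> z) \<le> 1 / 2 * exp (2 / 3 * \<mu>)"
        unfolding nS by (rule mult_mono) (use N0 in auto)
    qed auto
    finally show ?thesis by (simp add: w_def)
  qed
qed

text \<open>In units of \<mu> the exponent is 3/4 - 9/(2 pi^2) + 9/(80 pi) + 1/3, about 0.663 and so
  just below 2/3. The terms are the maximal size of ln P on the line, the removed linear terms,
  their actual size at x, and the growth of exp (2 pi n z). The cut at 20 \<eta> keeps the third
  term small enough.\<close>

lemma minor_arc_bound:
  fixes n :: nat and \<mu> x :: real
  assumes \<mu>: "\<mu> = pi / 6 * sqrt (24 * real n - 1)" and \<mu>72: "\<mu> \<ge> 72"
  defines "\<eta> \<equiv> 2 / 3 * saddle_radius \<mu>"
  assumes x: "20 * \<eta> \<le> \<bar>x\<bar>" "\<bar>x\<bar> \<le> 1 / 2"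
  shows "norm (partition_gf (exp (- 2 * pi * Complex \<eta> x)) * exp (2 * pi * n * Complex \<eta> x)) \<le> 2 * exp (2 / 3 * \<mu>)"
proof -
  define z where "z = Complex \<eta> x"
  define w where "w = exp (- 2 * pi * z)"
  define r where "r = exp (- 2 * pi * \<eta>)"
  have \<eta>: "\<eta> = pi / (9 * \<mu>)" by (simp add: \<eta>_def saddle_radius_def)
  have \<eta>0: "\<eta> > 0" using \<mu>72 by (simp add: \<eta>)
  have nw: "norm w = r" by (simp add: w_def r_def z_def)
  \<comment> \<open>The real \<open>sqrt\<close> is odd, so n = 0 would give \<mu> = - pi /
    6.\<close>
  have n: "n > 0"
  proof (rule ccontr)
    assume "\<not> n > 0"
    hence "\<mu> = - (pi / 6)" using \<mu> by (simp add: real_sqrt_minus)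
    thus False using \<mu>72 pi_gt_zero by linarith
  qed
  have r: "0 < r" "r < 1" using \<eta>0 by (auto simp: r_def)
  have "norm (w / (1 - w)) = 1 / norm (exp (2 * pi * z) - 1)"
  proof -
    have "w / (1 - w) = 1 / (1 / w - 1)"
      using r nw by (cases "w = 1") (auto simp: field_simps)
    also have "1 / w = exp (2 * pi * z)" by (simp add: w_def exp_minus field_simps)
    finally show ?thesis by (simp add: norm_divide)
  qed
  also have "\<dots> \<le> 1 / (80 * \<eta>)"
  proof (rule divide_left_mono)
    show le: "80 * \<eta> \<le> norm (exp (2 * pi * z) - 1)"
      using norm_exp_minus_one_ge[OF x(2) \<eta>0] x(1) by (simp add: z_def)
    show "0 < norm (exp (2 * pi * z) - 1) * (80 * \<eta>)"
      using le \<eta>0 by (intro mult_pos_pos) linarith+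
  qed auto
  finally have b1: "norm (w / (1 - w)) \<le> 1 / (80 * \<eta>)" .
  have b2: "(\<Sum>k. - ln (1 - r ^ Suc k)) \<le> pi / (12 * \<eta>)"
    unfolding r_def using suminf_minus_ln_le[OF \<eta>0] by simp
  \<comment> \<open>This is 1 / (exp v - 1) >= 1/v - 1/2 for v = 2 pi \<eta>, read off from the
    partial fractions of coth with k = 1, whose terms are nonnegative.\<close>
  have b3: "r / (1 - r) \<ge> 1 / (2 * pi * \<eta>) - 1 / 2"
  proof -
    have s: "(\<lambda>m. transform_term \<eta> 1 (Suc m)) sums
       (1 / (exp (2 * pi * \<eta>) - 1) - 1 / (2 * pi * \<eta>) + 1 / 2)"
      using transform_term_sums[OF \<eta>0, of 1] by simp
    have "transform_term \<eta> 1 (Suc m) \<ge> 0" for m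
      using \<eta>0 by (simp add: transform_term_def)
    from sums_le[OF this sums_zero s]
    have "0 \<le> 1 / (exp (2 * pi * \<eta>) - 1) - 1 / (2 * pi * \<eta>) + 1 / 2" .
    moreover have "r / (1 - r) = 1 / (exp (2 * pi * \<eta>) - 1)"
      using \<eta>0 by (simp add: r_def exp_minus field_simps)
    ultimately show ?thesis by simp
  qed
  have "norm (exp (2 * pi * n * z)) = exp (2 * pi * n * \<eta>)" by (simp add: z_def)
  also have "2 * pi * n * \<eta> = \<mu> / 3 + pi * \<eta> / 12"
  proof -
    have "\<mu>\<^sup>2 = pi\<^sup>2 / 36 * (24 * real n - 1)" using n by (simp add: \<mu> power_mult_distrib power_divide)
    hence "\<mu> * \<mu> * 36 = pi * pi * (24 * real n - 1)" by (simp add: power2_eq_square)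
    thus ?thesis using \<mu>72 by (simp add: \<eta> field_simps)
  qed
  finally have b4: "norm (exp (2 * pi * n * z)) = exp (\<mu> / 3 + pi * \<eta> / 12)" .
  have "norm (partition_gf w) \<le> exp ((\<Sum>k. - ln (1 - r ^ Suc k)) - r / (1 - r) + norm (w / (1 - w)))"
    using norm_partition_gf_minor_le[of w] nw r by auto
  also have "\<dots> \<le> exp (pi / (12 * \<eta>) - (1 / (2 * pi * \<eta>) - 1 / 2) + 1 / (80 * \<eta>))"
    using b1 b2 b3 by simp
  finally have "norm (partition_gf w * exp (2 * pi * n * z)) \<le>
     exp (pi / (12 * \<eta>) - (1 / (2 * pi * \<eta>) - 1 / 2) + 1 / (80 * \<eta>)) * exp (\<mu> / 3 + pi * \<eta> / 12)"
    unfolding norm_mult b4 by (rule mult_right_mono) auto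
  also have "\<dots> = exp (pi / (12 * \<eta>) - (1 / (2 * pi * \<eta>) - 1 / 2) + 1 / (80 * \<eta>) + (\<mu> / 3 + pi * \<eta> / 12))"
    by (simp only: exp_add)
  \<comment> \<open>The slack in the coefficient of \<mu> is small, hence the sharp bounds for pi.
    The constants 1/2 and 1/6 make up the summand 2/3.\<close>
  also have "\<dots> \<le> exp (2 / 3 * \<mu> + 2 / 3)"
  proof -
    have e1: "pi / (12 * \<eta>) = 3 / 4 * \<mu>" using \<mu>72 by (simp add: \<eta> field_simps)
    have e2: "1 / (2 * pi * \<eta>) = 9 / (2 * pi\<^sup>2) * \<mu>" using \<mu>72 by (simp add: \<eta> field_simps power2_eq_square)
    have e3: "1 / (80 * \<eta>) = 9 / (80 * pi) * \<mu>" using \<mu>72 by (simp add: \<eta> field_simps)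
    have "pi\<^sup>2 \<le> 3.1416\<^sup>2" using pi_approx(2) by (intro power_mono) auto
    hence "9 / (2 * pi\<^sup>2) \<ge> 9 / (2 * 3.1416\<^sup>2)" by (intro divide_left_mono) auto
    hence c2: "9 / (2 * pi\<^sup>2) \<ge> (4559 / 10000::real)" by (simp add: power2_eq_square)
    have "9 / (80 * pi) \<le> 9 / (80 * 3.14)" using pi_approx(1) by (intro divide_left_mono) auto
    hence c3: "9 / (80 * pi) \<le> (9 / 250::real)" by simp
    have "9 / (2 * pi\<^sup>2) * \<mu> \<ge> 4559 / 10000 * \<mu>"
      by (rule mult_right_mono[OF c2]) (use \<mu>72 in simp)
    moreover have "9 / (80 * pi) * \<mu> \<le> 9 / 250 * \<mu>"
      by (rule mult_right_mono[OF c3]) (use \<mu>72 in simp)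
    moreover have "pi * \<eta> / 12 \<le> 1 / 6"
    proof -
      have "\<eta> \<le> pi / (9 * 72)" unfolding \<eta> using \<mu>72 by (intro divide_left_mono) auto
      also have "\<dots> \<le> 1 / 100" using pi_approx(2) by simp
      finally have "pi * \<eta> \<le> 4 * (1 / 100)" using pi_approx(2) \<eta>0 by (intro mult_mono) auto
      thus ?thesis by simp
    qed
    ultimately show ?thesis unfolding e1 e2 e3 exp_le_cancel_iff using \<mu>72 by linarith
  qed
  also have "\<dots> = exp (2 / 3 * \<mu>) * exp (2 / 3)" by (rule exp_add)
  also have "exp (2 / 3 :: real) \<le> 2"
  proof -
    have "exp (2 / 3 :: real) ^ 3 = exp 1 ^ 2"
      by (simp add: power3_eq_cube power2_eq_square flip: exp_add)
    also have "\<dots> \<le> 2.72 ^ 2" using e_less_272 by (intro power_mono) auto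
    also have "\<dots> \<le> (2 :: real) ^ 3" by (simp add: power2_eq_square)
    finally show ?thesis by (subst (asm) power_mono_iff) auto
  qed
  finally show ?thesis by (simp add: w_def z_def mult.commute)
qed

section \<open>The asymptotic estimate and log-concavity for large arguments\<close>

text \<open>In terms of n this is sqrt 12 / (24 n - 1) * (1 - 1/\<mu>) * exp \<mu>, the growing part
  of the first term of Rademacher's series.\<close>

definition partition_main_term :: "real \<Rightarrow> real" where
  "partition_main_term \<mu> = pi\<^sup>2 / (6 * sqrt 3) * ((\<mu> - 1) / \<mu> ^ 3 * exp \<mu>)"

lemma saddle_radius_bounds:
  assumes "\<mu> \<ge> 72"
  shows "0 < saddle_radius \<mu>" "saddle_radius \<mu> \<le> 1 / 100" "sqrt (saddle_radius \<mu>) \<le> 1 / 10"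
proof -
  show 0: "0 < saddle_radius \<mu>" using assms by (simp add: saddle_radius_def)
  have "saddle_radius \<mu> \<le> pi / (6 * 72)"
    unfolding saddle_radius_def using assms by (intro divide_left_mono) auto
  also have "\<dots> \<le> 1 / 100" using pi_approx(2) by simp
  finally show 1: "saddle_radius \<mu> \<le> 1 / 100" .
  have "sqrt (saddle_radius \<mu>) \<le> sqrt (1 / 100)" using 1 by (rule real_sqrt_le_mono)
  also have "sqrt (1 / 100) = 1 / 10" by (rule real_sqrt_unique) (auto simp: power2_eq_square)
  finally show "sqrt (saddle_radius \<mu>) \<le> 1 / 10" .
qed

text \<open>The angle arccos (2/3) puts the ends of the arc on the line Re z = 2 \<rho> / 3. The
  Gaussian is then cut at T with T^2 = 2 \<mu> sin^2 (\<theta>/2) = \<mu> (1 - cos \<theta>) =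
  \<mu>/3, so the tails cost exp \<mu> * exp (- \<mu>/3).\<close>

lemma saddle_line_integral_approx:
  fixes \<mu> :: real
  assumes \<mu>: "\<mu> \<ge> 72"
  defines "\<rho> \<equiv> saddle_radius \<mu>"
  obtains J y where
    "((\<lambda>x. saddle_integrand \<mu> (Complex (2 / 3 * \<rho>) x)) has_integral J) {- y..y}"
    "0 < y" "y\<^sup>2 = 5 / 9 * \<rho>\<^sup>2"
    "\<bar>Re J - partition_main_term \<mu>\<bar> \<le> 1 / 100 * exp (2 / 3 * \<mu>)"
proof -
  define \<theta> :: real where "\<theta> = arccos (2 / 3)"
  have cos: "cos \<theta> = 2 / 3" by (simp add: \<theta>_def cos_arccos)
  have "arccos (2 / 3) < arccos (0 :: real)" "arccos 1 < arccos (2 / 3 :: real)"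
    by (rule arccos_less_arccos; simp)+
  hence \<theta>: "0 < \<theta>" "\<theta> < pi / 2" by (auto simp: \<theta>_def)
  have \<mu>0: "\<mu> > 0" using \<mu> by simp
  note \<rho> = saddle_radius_bounds[OF \<mu>, folded \<rho>_def]
  have sin0: "sin \<theta> > 0" using \<theta> by (intro sin_gt_zero) auto
  have sin2: "(sin \<theta>)\<^sup>2 = 5 / 9" unfolding sin_squared_eq cos by (simp add: power2_eq_square)
  obtain J where J: "((\<lambda>x. saddle_integrand \<mu> (Complex (\<rho> * cos \<theta>) x)) has_integral J) {- (\<rho> * sin \<theta>)..\<rho> * sin \<theta>}"
    "((\<lambda>t. cos (3 * t / 2) * exp (\<mu> * cos t)) has_integral (Re J / (\<rho> * sqrt \<rho>))) {- \<theta>..\<theta>}"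
    using saddle_integral_line[OF \<mu>0 \<theta>] unfolding \<rho>_def by blast
  define u where "u = sin (\<theta> / 2)"
  define s where "s = sqrt (2 * \<mu>)"
  define T where "T = s * u"
  define I where "I = integral {0..T} (\<lambda>x. exp (- x\<^sup>2))"
  have u0: "u > 0" unfolding u_def using \<theta> by (intro sin_gt_zero) auto
  have u2: "u\<^sup>2 = 1 / 6"
    using cos_double_sin[of "\<theta> / 2"] cos by (simp add: u_def)
  have s2: "s\<^sup>2 = 2 * \<mu>" using \<mu>0 by (simp add: s_def)
  have s: "s \<ge> 2" unfolding s_def using \<mu> by (intro real_le_rsqrt) (simp add: power2_eq_square)
  have T2: "T\<^sup>2 = \<mu> / 3" by (simp add: T_def power_mult_distrib s2 u2)
  have T0: "T > 0" using s u0 by (simp add: T_def)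
  have T1: "T \<ge> 1" by (rule power2_le_imp_le) (use T2 \<mu> T0 in auto)
  have "Re J / (\<rho> * sqrt \<rho>) = 2 * exp \<mu> * ((1 - 1 / \<mu>) * (2 / s * I) + 2 * u / \<mu> * exp (- 2 * \<mu> * u\<^sup>2))"
    using has_integral_unique[OF J(2) gaussian_arc_integral[OF \<mu>0 \<theta>(1)]] \<theta>
    by (simp add: I_def T_def s_def u_def)
  hence ReJ: "Re J = \<rho> * sqrt \<rho> * (2 * exp \<mu> * ((1 - 1 / \<mu>) * (2 / s * I) + 2 * u / \<mu> * exp (- (\<mu> / 3))))"
    using \<rho>(1) by (simp add: field_simps u2)
  have main: "partition_main_term \<mu> = \<rho> * sqrt \<rho> * (2 * exp \<mu> * ((1 - 1 / \<mu>) * (2 / s * (sqrt pi / 2))))"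
  proof -
    have "sqrt \<rho> * sqrt pi / s = sqrt (\<rho> * pi / (2 * \<mu>))"
      by (simp add: s_def real_sqrt_mult real_sqrt_divide)
    also have "\<rho> * pi / (2 * \<mu>) = (pi / (2 * sqrt 3 * \<mu>))\<^sup>2"
      using \<mu>0 by (simp add: \<rho>_def saddle_radius_def power_mult_distrib power_divide power2_eq_square)
    also have "sqrt \<dots> = pi / (2 * sqrt 3 * \<mu>)" using \<mu>0 by (simp only: real_sqrt_abs) simp
    finally have e: "sqrt \<rho> * sqrt pi / s = pi / (2 * sqrt 3 * \<mu>)" .
    have "\<rho> * sqrt \<rho> * (2 * exp \<mu> * ((1 - 1 / \<mu>) * (2 / s * (sqrt pi / 2)))) =
          2 * \<rho> * exp \<mu> * (1 - 1 / \<mu>) * (sqrt \<rho> * sqrt pi / s)" by simp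
    also have "\<dots> = 2 * \<rho> * exp \<mu> * (1 - 1 / \<mu>) * (pi / (2 * sqrt 3 * \<mu>))" unfolding e ..
    also have "\<dots> = partition_main_term \<mu>"
      using \<mu>0 by (simp add: partition_main_term_def \<rho>_def saddle_radius_def field_simps
        power2_eq_square power3_eq_cube)
    finally show ?thesis ..
  qed
  define e where "e = exp (- (\<mu> / 3))"
  have e0: "e > 0" by (simp add: e_def)
  have I: "\<bar>I - sqrt pi / 2\<bar> \<le> e"
  proof -
    have "\<bar>I - sqrt pi / 2\<bar> \<le> e / T"
      using gaussian_truncated[OF T0] by (simp add: I_def T2 e_def)
    also have "\<dots> \<le> e / 1" using T1 e0 by (intro divide_left_mono) auto
    finally show ?thesis by simp
  qed
  have D: "Re J - partition_main_term \<mu> =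
     \<rho> * sqrt \<rho> * (2 * exp \<mu> * ((1 - 1 / \<mu>) * (2 / s) * (I - sqrt pi / 2) + 2 * u / \<mu> * e))"
  proof -
    have *: "a * (b * (c * (d * x) + k)) - a * (b * (c * (d * y))) = a * (b * (c * d * (x - y) + k))"
      for a b c d k x y :: real
      by (simp add: algebra_simps)
    show ?thesis unfolding ReJ main e_def by (rule *)
  qed
  have "\<bar>Re J - partition_main_term \<mu>\<bar> = \<rho> * sqrt \<rho> * (2 * exp \<mu>) * \<bar>(1 - 1 / \<mu>) * (2 / s) * (I - sqrt pi / 2) + 2 * u / \<mu> * e\<bar>"
    unfolding D using \<rho>(1) by (simp add: abs_mult)
  also have "\<dots> \<le> 1 / 100 * (1 / 10) * (2 * exp \<mu>) * (e + e)"
  proof (intro mult_mono)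
    have "\<bar>(1 - 1 / \<mu>) * (2 / s) * (I - sqrt pi / 2)\<bar> \<le> 1 * 1 * e"
      unfolding abs_mult using \<mu> s I by (intro mult_mono) auto
    moreover have "\<bar>2 * u / \<mu> * e\<bar> \<le> 1 * e"
    proof -
      have "u \<le> 1" by (simp add: u_def)
      hence "2 * u / \<mu> \<le> 1" using \<mu> by (simp add: field_simps)
      thus ?thesis unfolding abs_mult using u0 \<mu>0 e0 by (intro mult_mono) auto
    qed
    ultimately have "\<bar>(1 - 1 / \<mu>) * (2 / s) * (I - sqrt pi / 2) + 2 * u / \<mu> * e\<bar> \<le> 1 * 1 * e + 1 * e"
      by (rule order_trans[OF abs_triangle_ineq add_mono])
    thus "\<bar>(1 - 1 / \<mu>) * (2 / s) * (I - sqrt pi / 2) + 2 * u / \<mu> * e\<bar> \<le> e + e"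
      by simp
  qed (use \<rho> in auto)
  also have "\<dots> \<le> 1 / 100 * (exp \<mu> * e)" using e0 by simp
  also have "exp \<mu> * e = exp (2 / 3 * \<mu>)" by (simp add: e_def flip: exp_add)
  finally have "\<bar>Re J - partition_main_term \<mu>\<bar> \<le> 1 / 100 * exp (2 / 3 * \<mu>)" .
  moreover have "((\<lambda>x. saddle_integrand \<mu> (Complex (2 / 3 * \<rho>) x)) has_integral J) {- (\<rho> * sin \<theta>)..\<rho> * sin \<theta>}"
    using J(1) by (simp add: cos mult.commute)
  moreover have "0 < \<rho> * sin \<theta>" using \<rho> sin0 by simp
  moreover have "(\<rho> * sin \<theta>)\<^sup>2 = 5 / 9 * \<rho>\<^sup>2" by (simp add: power_mult_distrib sin2)
  ultimately show ?thesis using that by blast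
qed

text \<open>The segment of length 1 is split at the exits +-y from the circle and at +-X. Apart from
  J each piece costs at most 2 E times its length, where E = exp (2/3 \<mu>), so 2 E in total. Only
  the real part of J is controlled, which is enough because p(n) is real.\<close>

lemma partition_number_approx:
  fixes n :: nat and \<mu> :: real
  assumes \<mu>: "\<mu> = pi / 6 * sqrt (24 * real n - 1)" and \<mu>72: "\<mu> \<ge> 72" and n: "n > 0"
  shows "\<bar>partition_number n - partition_main_term \<mu>\<bar> \<le> 3 * exp (2 / 3 * \<mu>)"
proof -
  define \<rho> where "\<rho> = saddle_radius \<mu>"
  define \<eta> where "\<eta> = 2 / 3 * \<rho>"
  define X where "X = 20 * \<eta>"
  define E where "E = exp (2 / 3 * \<mu>)"
  note \<rho> = saddle_radius_bounds[OF \<mu>72, folded \<rho>_def]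
  have \<eta>0: "\<eta> > 0" using \<rho> by (simp add: \<eta>_def)
  define F where "F = (\<lambda>x. partition_gf (exp (- 2 * pi * Complex \<eta> x)) * exp (2 * pi * n * Complex \<eta> x))"
  define S where "S = (\<lambda>x. saddle_integrand \<mu> (Complex \<eta> x))"
  obtain J y where J: "(S has_integral J) {- y..y}" and y: "0 < y" "y\<^sup>2 = 5 / 9 * \<rho>\<^sup>2"
    and ReJ: "\<bar>Re J - partition_main_term \<mu>\<bar> \<le> 1 / 100 * E"
    using saddle_line_integral_approx[OF \<mu>72] unfolding \<rho>_def \<eta>_def S_def E_def by metis
  have "y\<^sup>2 \<le> \<rho>\<^sup>2" using y(2) zero_le_power2[of \<rho>] by linarith
  hence y\<rho>: "y \<le> \<rho>" by (rule power2_le_imp_le) (use \<rho> in simp)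
  have X: "y \<le> X" "X \<le> 1 / 2" "X > 0" using y\<rho> \<rho> by (auto simp: X_def \<eta>_def)
  have E0: "E > 0" by (simp add: E_def)
  have F: "(F has_integral of_nat (partition_number n)) {-1/2..1/2}"
    unfolding F_def by (rule partition_number_has_integral[OF \<eta>0])
  have intF: "F integrable_on {a..b}" if "-1/2 \<le> a" "b \<le> 1/2" for a b
    using integrable_on_subinterval[of F "{-1/2..1/2}" a b] F that by (auto simp: integrable_on_def)
  have comb: "integral {a..b} F = integral {a..c} F + integral {c..b} F"
    if "-1/2 \<le> a" "a \<le> c" "c \<le> b" "b \<le> 1/2" for a b c
    using that by (intro Henstock_Kurzweil_Integration.integral_combine [symmetric] intF) auto
  have bnd: "norm (integral {a..b} F) \<le> B * (b - a)"
    if "-1/2 \<le> a" "a \<le> b" "b \<le> 1/2" "0 \<le> B" "\<And>x. x \<in> {a..b} \<Longrightarrow> norm (F x) \<le> B" for a b B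
    using has_integral_bound_real[OF that(4) finite.emptyI integrable_integral[OF intF[OF that(1,3)]]] that
    by simp
  have F_eq: "F x = S x * partition_gf (exp (- 2 * pi / Complex \<eta> x))" for x
    unfolding F_def S_def using \<eta>0 by (intro partition_integrand_eq[OF _ \<mu> n]) simp
  have y_le: "y\<^sup>2 \<le> x\<^sup>2 \<longleftrightarrow> y \<le> \<bar>x\<bar>" "x\<^sup>2 \<le> y\<^sup>2 \<longleftrightarrow> \<bar>x\<bar> \<le> y" for x
    using abs_le_square_iff[of y x] abs_le_square_iff[of x y] y by auto
  have minor: "norm (F x) \<le> 2 * E" if "X \<le> \<bar>x\<bar>" "\<bar>x\<bar> \<le> 1 / 2" for x
    using minor_arc_bound[OF \<mu> \<mu>72, of x] that by (simp add: F_def E_def X_def \<eta>_def \<rho>_def)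
  have middle: "norm (F x) \<le> E" if "y \<le> \<bar>x\<bar>" "\<bar>x\<bar> \<le> X" for x
    using saddle_integrand_ray_bounds(2)[OF \<mu>72, of x] that y_le(1)[of x]
    by (simp add: F_eq S_def E_def X_def \<eta>_def \<rho>_def y(2))
  have central: "norm (F x - S x) \<le> E" if "\<bar>x\<bar> \<le> y" for x
  proof -
    have "norm (F x - S x) \<le> 4 * sqrt \<rho> * exp (\<mu> / 3)"
      using saddle_integrand_ray_bounds(1)[OF \<mu>72, of x] that y_le(2)[of x]
      by (simp add: F_eq S_def \<eta>_def \<rho>_def y(2))
    also have "\<dots> \<le> 1 * E" unfolding E_def using \<rho> \<mu>72 by (intro mult_mono) auto
    finally show ?thesis by simp
  qed
  have "integral {-1/2..1/2} F = integral {-1/2..-X} F + (integral {-X..-y} F +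
          (integral {-y..y} F + (integral {y..X} F + integral {X..1/2} F)))"
    using X y comb[of "-1/2" "-X" "1/2"] comb[of "-X" "-y" "1/2"] comb[of "-y" y "1/2"] comb[of y X "1/2"]
    by simp
  hence p_eq: "of_nat (partition_number n) - J = integral {-1/2..-X} F + (integral {-X..-y} F +
          ((integral {-y..y} F - J) + (integral {y..X} F + integral {X..1/2} F)))"
    using integral_unique[OF F] by simp
  have n1: "norm (integral {-1/2..-X} F) \<le> 2 * E * (- X - (-1/2))"
    using X E0 by (intro bnd minor) auto
  have n5: "norm (integral {X..1/2} F) \<le> 2 * E * (1/2 - X)"
    using X E0 by (intro bnd minor) auto
  have n2: "norm (integral {-X..-y} F) \<le> E * (- y - (- X))"
    using X y E0 by (intro bnd middle) auto
  have n4: "norm (integral {y..X} F) \<le> E * (X - y)"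
    using X y E0 by (intro bnd middle) auto
  have n3: "norm (integral {-y..y} F - J) \<le> E * (y - (-y))"
  proof -
    have "(F has_integral integral {-y..y} F) {-y..y}"
      using X y by (intro integrable_integral intF) auto
    from has_integral_diff[OF this J]
    have "((\<lambda>x. F x - S x) has_integral (integral {-y..y} F - J)) {-y..y}" .
    moreover have "norm (F x - S x) \<le> E" if "x \<in> {-y..y} - {}" for x
      using central[of x] that by (auto simp: abs_le_iff)
    ultimately have "norm (integral {-y..y} F - J) \<le> E * measure lborel {-y..y}"
      using E0 by (intro has_integral_bound_real[OF _ finite.emptyI]) auto
    thus ?thesis using y by simp
  qed
  have "norm (of_nat (partition_number n) - J) \<le>
          2 * E * (- X - (-1/2)) + (E * (- y - (- X)) + (E * (y - (-y)) + (E * (X - y) + 2 * E * (1/2 - X))))"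
    unfolding p_eq by (intro norm_triangle_le add_mono n1 n2 n3 n4 n5)
  also have "\<dots> = E * (2 - 2 * X)" by (simp add: algebra_simps)
  also have "\<dots> \<le> E * 2" using E0 X by (intro mult_left_mono) auto
  finally have "\<bar>Re (of_nat (partition_number n) - J)\<bar> \<le> 2 * E"
    using abs_Re_le_cmod[of "of_nat (partition_number n) - J"] by linarith
  hence "\<bar>partition_number n - Re J\<bar> \<le> 2 * E" by simp
  thus ?thesis using ReJ E0 unfolding E_def [symmetric] by linarith
qed

text \<open>From 72 <= exp (9/2) and the tangent to exp at 0 follows \<mu> <= exp (7/2 + \<mu>/72).
  Hence 4 \<mu>^5 is at most exp (19 + 5 \<mu>/72), and 19 + 5 \<mu>/72 <= \<mu>/3 holds exactly
  from \<mu> = 72 on.\<close>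

lemma four_power5_le_exp:
  fixes \<mu> :: real
  assumes "\<mu> \<ge> 72"
  shows "4 * \<mu> ^ 5 \<le> exp (\<mu> / 3)"
proof -
  have half: "13 / 8 \<le> exp (1 / 2 :: real)"
    using exp_lower_Taylor_quadratic[of "1 / 2 :: real"] by (simp add: power2_eq_square)
  have "(13 / 8) ^ 9 \<le> exp (1 / 2 :: real) ^ 9" using half by (intro power_mono) auto
  moreover have "exp (1 / 2 :: real) ^ 9 = exp (9 / 2)" using exp_of_nat_mult[of 9 "1 / 2 :: real"] by simp
  moreover have "(72::real) \<le> (13 / 8) ^ 9" by (simp add: power_divide)
  ultimately have "72 \<le> exp (9 / 2 :: real)" by linarith
  moreover have "\<mu> / 72 \<le> exp (\<mu> / 72 - 1)"
    using exp_ge_add_one_self[of "\<mu> / 72 - 1"] by simp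
  ultimately have "72 * (\<mu> / 72) \<le> exp (9 / 2) * exp (\<mu> / 72 - 1)"
    using assms by (intro mult_mono) auto
  hence "\<mu> \<le> exp (7 / 2 + \<mu> / 72)" by (simp flip: exp_add)
  hence "\<mu> ^ 5 \<le> exp (7 / 2 + \<mu> / 72) ^ 5" using assms by (intro power_mono) auto
  also have "\<dots> = exp (35 / 2 + 5 * \<mu> / 72)"
    using exp_of_nat_mult[of 5 "7 / 2 + \<mu> / 72"] by (simp add: algebra_simps)
  finally have 1: "\<mu> ^ 5 \<le> exp (35 / 2 + 5 * \<mu> / 72)" .
  have "(13 / 8) ^ 3 \<le> exp (1 / 2 :: real) ^ 3"
    using half by (intro power_mono) auto
  also have "\<dots> = exp (3 / 2)" by (simp add: power3_eq_cube flip: exp_add)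
  finally have 2: "4 \<le> exp (3 / 2 :: real)" by (simp add: power3_eq_cube)
  have "4 * \<mu> ^ 5 \<le> exp (3 / 2) * exp (35 / 2 + 5 * \<mu> / 72)"
    using 1 2 assms by (intro mult_mono) auto
  also have "\<dots> = exp (3 / 2 + (35 / 2 + 5 * \<mu> / 72))" by (simp only: exp_add)
  also have "\<dots> \<le> exp (\<mu> / 3)" using assms by simp
  finally show ?thesis .
qed

text \<open>The main term divided by \<mu>^3 exceeds 4/5 (\<mu> - 1) exp \<mu> / \<mu>^6. Against
  the absolute error 3 exp (2/3 \<mu>) this leaves a comparison of \<mu>^5 with exp
  (\<mu>/3).\<close>

lemma partition_number_relative_error:
  fixes n :: nat and \<mu> :: real
  assumes \<mu>: "\<mu> = pi / 6 * sqrt (24 * real n - 1)" and \<mu>72: "\<mu> \<ge> 72" and n: "n > 0"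
  shows "\<bar>partition_number n - partition_main_term \<mu>\<bar> \<le> partition_main_term \<mu> * (1 / \<mu> ^ 3)"
proof -
  have c: "pi\<^sup>2 / (6 * sqrt 3) \<ge> 4 / 5"
  proof -
    have "sqrt 3 \<le> (2::real)" by (rule real_le_lsqrt) auto
    hence "4 / 5 * (6 * sqrt 3) \<le> 4 / 5 * (6 * 2)" by simp
    also have "\<dots> \<le> 3.14\<^sup>2" by (simp add: power2_eq_square)
    also have "\<dots> \<le> pi\<^sup>2" using pi_approx(1) by (intro power_mono) auto
    finally show ?thesis by (simp add: pos_le_divide_eq)
  qed
  have "3 * \<mu> ^ 6 \<le> 4 / 5 * ((\<mu> - 1) * (4 * \<mu> ^ 5))"
  proof -
    have "3 * \<mu> \<le> 4 / 5 * ((\<mu> - 1) * 4)" using \<mu>72 by simp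
    hence "3 * \<mu> * \<mu> ^ 5 \<le> 4 / 5 * ((\<mu> - 1) * 4) * \<mu> ^ 5" using \<mu>72 by (intro mult_right_mono) auto
    thus ?thesis by (simp add: power_numeral_reduce mult_ac)
  qed
  also have "\<dots> \<le> pi\<^sup>2 / (6 * sqrt 3) * ((\<mu> - 1) * exp (\<mu> / 3))"
    using c four_power5_le_exp[OF \<mu>72] \<mu>72 by (intro mult_mono) auto
  finally have "3 * \<mu> ^ 6 * exp (2 / 3 * \<mu>) \<le> pi\<^sup>2 / (6 * sqrt 3) * ((\<mu> - 1) * exp (\<mu> / 3)) * exp (2 / 3 * \<mu>)"
    by (intro mult_right_mono) auto
  also have "\<dots> = pi\<^sup>2 / (6 * sqrt 3) * ((\<mu> - 1) * exp \<mu>)"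
    by (simp add: mult.assoc flip: exp_add)
  finally have "3 * exp (2 / 3 * \<mu>) \<le> pi\<^sup>2 / (6 * sqrt 3) * ((\<mu> - 1) * exp \<mu>) / \<mu> ^ 6"
    using \<mu>72 by (simp add: pos_le_divide_eq mult_ac)
  also have "\<dots> = partition_main_term \<mu> * (1 / \<mu> ^ 3)"
    by (simp add: partition_main_term_def flip: power_add)
  finally show ?thesis using partition_number_approx[OF assms] by linarith
qed


section \<open>The second difference of the logarithm of the main term\<close>

lemma saddle_parameter_derivative:
  fixes x :: real
  assumes "x > 1"
  shows "((\<lambda>x. pi / 6 * sqrt (24 * x - 1)) has_real_derivative pi\<^sup>2 / 3 / (pi / 6 * sqrt (24 * x - 1))) (at x)"
proof -
  have "((\<lambda>x. pi / 6 * sqrt (24 * x - 1)) has_real_derivative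
          pi / 6 * (inverse (sqrt (24 * x - 1)) / 2 * 24)) (at x)"
    using assms by (auto intro!: derivative_eq_intros)
  also have "pi / 6 * (inverse (sqrt (24 * x - 1)) / 2 * 24) = pi\<^sup>2 / 3 / (pi / 6 * sqrt (24 * x - 1))"
    using assms by (simp add: field_simps power2_eq_square)
  finally show ?thesis .
qed

text \<open>Up to an additive constant \<open>f\<close> is the logarithm of the main term. On the
  interval f'' <= - c, where c is the least value of 9 / m^3 there; so f + c a^2 / 2 is concave, and
  its midpoint inequality is the claim.\<close>

lemma main_term_second_difference:
  fixes x :: real
  assumes x: "x > 2" and big: "pi / 6 * sqrt (24 * (x - 1) - 1) \<ge> 72"
  defines "m \<equiv> (\<lambda>x. pi / 6 * sqrt (24 * x - 1))"
  defines "f \<equiv> (\<lambda>x. m x - 3 * ln (m x) + ln (m x - 1))"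
  shows "f (x - 1) + f (x + 1) + 9 / m (x + 1) ^ 3 \<le> 2 * f x"
proof -
  define \<kappa> where "\<kappa> = pi\<^sup>2 / 3"
  define h where "h = (\<lambda>m::real. 1 / m - 3 / m\<^sup>2 + 1 / (m * (m - 1)))"
  define c where "c = 9 / m (x + 1) ^ 3"
  have \<kappa>: "\<kappa> \<ge> 16 / 5"
  proof -
    have "3.14159\<^sup>2 \<le> pi\<^sup>2" using pi_approx(1) by (intro power_mono) auto
    thus ?thesis by (simp add: \<kappa>_def power2_eq_square)
  qed
  let ?C = "{x - 1..x + 1}"
  have m_mono: "m a \<le> m b" if "a \<le> b" for a b
    unfolding m_def using that by (intro mult_left_mono) auto
  have m72: "m a \<ge> 72" if "a \<in> ?C" for a
  proof -
    have "m (x - 1) \<le> m a" using that by (intro m_mono) auto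
    moreover have "m (x - 1) \<ge> 72" using big by (simp only: m_def)
    ultimately show ?thesis by linarith
  qed
  \<comment> \<open>m^2 is linear in the argument, so m' = \<kappa> / m and all derivatives become
    rational functions of m.\<close>
  have dm: "(m has_real_derivative \<kappa> / m a) (at a)" if "a \<in> ?C" for a
    unfolding m_def \<kappa>_def using that x by (intro saddle_parameter_derivative) auto
  have df: "(f has_real_derivative \<kappa> * h (m a)) (at a)" if "a \<in> ?C" for a
  proof -
    have d: "((\<lambda>y. y - 3 * ln y + ln (y - 1)) has_real_derivative (1 - 3 / y + 1 / (y - 1))) (at y)"
      if "y \<ge> 72" for y :: real
      using that by (auto intro!: derivative_eq_intros)
    from DERIV_chain2[OF d[OF m72[OF that]] dm[OF that]]
    have "(f has_real_derivative (1 - 3 / m a + 1 / (m a - 1)) * (\<kappa> / m a)) (at a)"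
      unfolding f_def .
    also have "(1 - 3 / m a + 1 / (m a - 1)) * (\<kappa> / m a) = \<kappa> * h (m a)"
      using m72[OF that] by (simp add: h_def field_simps power2_eq_square)
    finally show ?thesis .
  qed
  define h' where "h' = (\<lambda>m::real. - 1 / m\<^sup>2 + 6 / m ^ 3 - (2 * m - 1) / (m * (m - 1))\<^sup>2)"
  have dh: "((\<lambda>a. \<kappa> * h (m a)) has_real_derivative \<kappa> * (h' (m a) * (\<kappa> / m a))) (at a)" if "a \<in> ?C" for a
  proof (rule DERIV_cmult, rule DERIV_chain2[OF _ dm[OF that]])
    have "m a \<noteq> 0" "m a * (m a - 1) \<noteq> 0" using m72[OF that] by auto
    have d1: "((\<lambda>m. 1 / m) has_real_derivative - 1 / (m a)\<^sup>2) (at (m a))"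
      using \<open>m a \<noteq> 0\<close> by (auto intro!: derivative_eq_intros simp: power2_eq_square)
    have d2: "((\<lambda>m. 3 / m\<^sup>2) has_real_derivative - 6 / (m a) ^ 3) (at (m a))"
      using \<open>m a \<noteq> 0\<close> by (auto intro!: derivative_eq_intros simp: power2_eq_square power3_eq_cube field_simps)
    have d3: "((\<lambda>m. 1 / (m * (m - 1))) has_real_derivative - (2 * m a - 1) / (m a * (m a - 1))\<^sup>2) (at (m a))"
      using \<open>m a * (m a - 1) \<noteq> 0\<close> by (auto intro!: derivative_eq_intros simp: power2_eq_square)
    have "- 1 / (m a)\<^sup>2 - - 6 / m a ^ 3 + - (2 * m a - 1) / (m a * (m a - 1))\<^sup>2 = h' (m a)"
      unfolding h'_def minus_divide_left [symmetric] by simp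
    with DERIV_add[OF DERIV_diff[OF d1 d2] d3]
    show "(h has_real_derivative h' (m a)) (at (m a))"
      unfolding h_def by (simp only:)
  qed
  have neg: "\<kappa> * (h' (m a) * (\<kappa> / m a)) + c \<le> 0" if "a \<in> ?C" for a
  proof -
    define M where "M = m a"
    have M: "M \<ge> 72" using m72[OF that] by (simp add: M_def)
    have "(2 * M - 1) / (M * (M - 1))\<^sup>2 \<ge> 0" using M by auto
    moreover have "6 / M ^ 3 \<le> 6 / 72 * (1 / M\<^sup>2)"
    proof -
      have "6 / M ^ 3 = 6 / M * (1 / M\<^sup>2)" by (simp add: power2_eq_square power3_eq_cube)
      also have "\<dots> \<le> 6 / 72 * (1 / M\<^sup>2)" using M by (intro mult_right_mono divide_left_mono) auto
      finally show ?thesis .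
    qed
    ultimately have "h' M \<le> - (11 / 12) * (1 / M\<^sup>2)" unfolding h'_def by simp
    hence "\<kappa>\<^sup>2 / M * h' M \<le> \<kappa>\<^sup>2 / M * (- (11 / 12) * (1 / M\<^sup>2))"
      using M by (intro mult_left_mono) auto
    also have "\<dots> = - (11 / 12 * \<kappa>\<^sup>2) * (1 / M ^ 3)" by (simp add: power2_eq_square power3_eq_cube)
    \<comment> \<open>The factor 11/12 is 1 - 6/72, and 11/12 * (16/5)^2 = 9.38... still exceeds
      9.\<close>
    also have "\<dots> \<le> - 9 * (1 / M ^ 3)"
    proof (rule mult_right_mono)
      have "(16 / 5)\<^sup>2 \<le> \<kappa>\<^sup>2" using \<kappa> by (intro power_mono) auto
      thus "- (11 / 12 * \<kappa>\<^sup>2) \<le> - 9" by (simp add: power2_eq_square)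
    qed (use M in auto)
    finally have "\<kappa>\<^sup>2 / M * h' M \<le> - 9 * (1 / M ^ 3)" .
    moreover have "\<kappa> * (h' M * (\<kappa> / M)) = \<kappa>\<^sup>2 / M * h' M" by (simp add: power2_eq_square)
    moreover have "c \<le> 9 * (1 / M ^ 3)"
    proof -
      have "9 / m (x + 1) ^ 3 \<le> 9 / M ^ 3"
        using m_mono[of a "x + 1"] that M unfolding M_def
        by (intro divide_left_mono power_mono mult_pos_pos zero_less_power) auto
      thus ?thesis by (simp add: c_def)
    qed
    ultimately have "\<kappa> * (h' M * (\<kappa> / M)) + c \<le> 0" by linarith
    thus ?thesis by (simp only: M_def)
  qed
  have conc: "concave_on ?C (\<lambda>a. f a + c * a\<^sup>2 / 2)"
  proof (rule f''_le0_imp_concave)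
    show "((\<lambda>a. f a + c * a\<^sup>2 / 2) has_real_derivative (\<kappa> * h (m a) + c * a)) (at a)" if "a \<in> ?C" for a
      by (rule DERIV_add[OF df[OF that]]) (auto intro!: derivative_eq_intros)
    show "((\<lambda>a. \<kappa> * h (m a) + c * a) has_real_derivative (\<kappa> * (h' (m a) * (\<kappa> / m a)) + c)) (at a)" if "a \<in> ?C" for a
      by (rule DERIV_add[OF dh[OF that]]) (auto intro!: derivative_eq_intros)
  qed (use neg in auto)
  have "1 / 2 * (f (x - 1) + c * (x - 1)\<^sup>2 / 2) + 1 / 2 * (f (x + 1) + c * (x + 1)\<^sup>2 / 2) \<le> f x + c * x\<^sup>2 / 2"
  proof -
    have "(x - 1) / 2 + (1 + x) / 2 = x" by (simp add: field_simps)
    with concave_onD[OF conc, of "1 / 2" "x - 1" "x + 1"]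
    show ?thesis by (simp add: algebra_simps)
  qed
  moreover have "c * (x - 1)\<^sup>2 = c * x\<^sup>2 - 2 * (c * x) + c" "c * (x + 1)\<^sup>2 = c * x\<^sup>2 + 2 * (c * x) + c"
    by (simp_all add: power2_eq_square algebra_simps)
  ultimately have "1 / 2 * (f (x - 1) + (c * x\<^sup>2 - 2 * (c * x) + c) / 2) +
      1 / 2 * (f (x + 1) + (c * x\<^sup>2 + 2 * (c * x) + c) / 2) \<le> f x + c * x\<^sup>2 / 2"
    by (simp only:)
  hence "f (x - 1) + f (x + 1) + c \<le> 2 * f x" by (simp add: field_simps)
  thus ?thesis by (simp only: c_def)
qed

lemma main_term_eq_exp:
  assumes "\<mu> > 1"
  shows "partition_main_term \<mu> = pi\<^sup>2 / (6 * sqrt 3) * exp (\<mu> - 3 * ln \<mu> + ln (\<mu> - 1))"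
proof -
  have "exp (3 * ln \<mu>) = \<mu> ^ 3"
    using assms exp_of_nat_mult[of 3 "ln \<mu>"] by simp
  thus ?thesis
    using assms by (simp add: partition_main_term_def exp_add exp_diff)
qed

lemma saddle_parameter_power2:
  fixes x :: real
  assumes "x \<ge> 1"
  shows "(pi / 6 * sqrt (24 * x - 1))\<^sup>2 = pi\<^sup>2 / 36 * (24 * x - 1)"
  using assms by (simp add: power_mult_distrib power_divide)

text \<open>e bounds the relative errors of all three values of p, and 1/n^2 too. To first order the
  losses are 2 e + 2 e + e; the margin 8 e also absorbs the higher terms for e <= 1/100.\<close>

lemma perturbed_log_concavity:
  fixes e A B C :: real
  assumes e: "0 \<le> e" "e \<le> 1 / 100" and pos: "A \<ge> 0" "B \<ge> 0"
    and AB: "A * B * (1 + 8 * e) \<le> C\<^sup>2"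
  shows "A * B * (1 + e)\<^sup>2 \<le> (1 - e) * (C * (1 - e))\<^sup>2"
proof -
  have "(1 + e)\<^sup>2 \<le> (1 + 8 * e) * (1 - 3 * e)"
  proof -
    have "25 * (e * e) \<le> 25 * (e * (1 / 100))" using e by (intro mult_left_mono) auto
    hence "25 * (e * e) \<le> 3 * e" using e by simp
    thus ?thesis by (simp add: power2_eq_square algebra_simps)
  qed
  also have "1 - 3 * e \<le> (1 - e) ^ 3"
  proof -
    have "0 \<le> e * e * (3 - e)" using e by simp
    thus ?thesis by (simp add: power3_eq_cube algebra_simps)
  qed
  hence "(1 + 8 * e) * (1 - 3 * e) \<le> (1 + 8 * e) * (1 - e) ^ 3"
    using e by (intro mult_left_mono) auto
  finally have "A * B * (1 + e)\<^sup>2 \<le> A * B * ((1 + 8 * e) * (1 - e) ^ 3)"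
    using pos by (intro mult_left_mono) auto
  also have "\<dots> = A * B * (1 + 8 * e) * (1 - e) ^ 3" by (simp only: mult.assoc)
  also have "\<dots> \<le> C\<^sup>2 * (1 - e) ^ 3"
    using AB e by (intro mult_right_mono) auto
  finally show ?thesis by (simp add: power2_eq_square power3_eq_cube mult_ac)
qed

lemma partition_number_quotient_log_concave_large:
  fixes n :: nat
  assumes n: "n \<ge> 790"
  shows "(real n)\<^sup>2 * (partition_number (n - 1) * partition_number (n + 1)) \<le>
           ((real n)\<^sup>2 - 1) * (real (partition_number n))\<^sup>2"
proof -
  define m where "m = (\<lambda>x. pi / 6 * sqrt (24 * x - 1))"
  define a b c where "a = m (real n - 1)" and "b = m (real n)" and "c = m (real n + 1)"
  let ?M = partition_main_term
  have rn: "real (n - 1) = real n - 1" "real (n + 1) = real n + 1" using n by auto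
  have n790: "real n \<ge> 790" using n by simp
  \<comment> \<open>The smallest argument is n - 1 >= 789, and 24 * 789 - 1 = 18935 >
    137.6^2.\<close>
  have a72: "a \<ge> 72"
  proof -
    have "sqrt (24 * (real n - 1) - 1) \<ge> 1376 / 10"
      using n790 by (intro real_le_rsqrt) (simp add: power2_eq_square)
    hence "31415 / 10000 / 6 * (1376 / 10) \<le> a"
      unfolding a_def m_def using pi_approx(1) by (intro mult_mono divide_right_mono) auto
    thus ?thesis by simp
  qed
  have m_mono: "m x \<le> m y" if "x \<le> y" for x y
    unfolding m_def using that by (intro mult_left_mono) auto
  have ab: "a \<le> b" and bc: "b \<le> c" unfolding a_def b_def c_def by (rule m_mono; simp)+
  have err_a: "\<bar>partition_number (n - 1) - ?M a\<bar> \<le> ?M a * (1 / a ^ 3)"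
    by (rule partition_number_relative_error) (use a72 n in \<open>auto simp: a_def m_def rn\<close>)
  have err_b: "\<bar>partition_number n - ?M b\<bar> \<le> ?M b * (1 / b ^ 3)"
    by (rule partition_number_relative_error) (use a72 ab n in \<open>auto simp: b_def m_def\<close>)
  have err_c: "\<bar>partition_number (n + 1) - ?M c\<bar> \<le> ?M c * (1 / c ^ 3)"
    by (rule partition_number_relative_error) (use a72 ab bc n in \<open>auto simp: c_def m_def rn\<close>)
  define e where "e = 1 / a ^ 3"
  have Mpos: "?M x \<ge> 0" if "x \<ge> 72" for x
    using that by (simp add: partition_main_term_def)
  have e_ge: "1 / x ^ 3 \<le> e" if "x \<ge> a" for x
    unfolding e_def using that a72 by (intro divide_left_mono power_mono mult_pos_pos zero_less_power) auto
  have e0: "0 \<le> e" using a72 by (simp add: e_def)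
  have e1: "e \<le> 1 / 100"
  proof -
    have "72 ^ 3 \<le> a ^ 3" using a72 by (intro power_mono) auto
    hence "e \<le> 1 / 72 ^ 3"
      unfolding e_def using a72 by (intro divide_left_mono mult_pos_pos zero_less_power) auto
    thus ?thesis by simp
  qed
  have up: "real k \<le> ?M x * (1 + e)" if "\<bar>real k - ?M x\<bar> \<le> ?M x * (1 / x ^ 3)" "x \<ge> a" for k x
  proof -
    have "?M x * (1 / x ^ 3) \<le> ?M x * e"
      using that e_ge Mpos a72 by (intro mult_left_mono) auto
    thus ?thesis unfolding distrib_left using that(1) by linarith
  qed
  have lo: "?M x * (1 - e) \<le> real k" if "\<bar>real k - ?M x\<bar> \<le> ?M x * (1 / x ^ 3)" "x \<ge> a" for k x
  proof -
    have "?M x * (1 / x ^ 3) \<le> ?M x * e"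
      using that e_ge Mpos a72 by (intro mult_left_mono) auto
    thus ?thesis unfolding right_diff_distrib using that(1) by linarith
  qed
  have a2: "a\<^sup>2 = pi\<^sup>2 / 36 * (24 * (real n - 1) - 1)" and c2: "c\<^sup>2 = pi\<^sup>2 / 36 * (24 * (real n + 1) - 1)"
    unfolding a_def c_def m_def by (rule saddle_parameter_power2; use n790 in simp)+
  have pi2: "pi\<^sup>2 \<le> 10"
  proof -
    have "pi\<^sup>2 \<le> 3.15\<^sup>2" using pi_approx(2) by (intro power_mono) auto
    thus ?thesis by (simp add: power2_eq_square)
  qed
  \<comment> \<open>Since (41/40)^3 < 9/8, this turns the gain 9 / c^3 at the right end into 8 / a^3
    at the left end.\<close>
  have ca: "c \<le> 41 / 40 * a"
  proof (rule power2_le_imp_le)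
    have "c\<^sup>2 = a\<^sup>2 + 4 / 3 * pi\<^sup>2" unfolding a2 c2 by (simp add: algebra_simps)
    moreover have "72\<^sup>2 \<le> a\<^sup>2" using a72 by (intro power_mono) auto
    moreover have "(41 / 40)\<^sup>2 * a\<^sup>2 = a\<^sup>2 + 81 / 1600 * a\<^sup>2" by (simp add: power_divide)
    moreover have "(72::real)\<^sup>2 = 5184" by simp
    ultimately have "c\<^sup>2 \<le> (41 / 40)\<^sup>2 * a\<^sup>2" using pi2 by linarith
    thus "c\<^sup>2 \<le> (41 / 40 * a)\<^sup>2" by (simp only: power_mult_distrib)
  qed (use a72 in simp)
  have "8 * e \<le> 9 / c ^ 3"
  proof -
    have "c ^ 3 \<le> (41 / 40 * a) ^ 3" using ca a72 ab bc by (intro power_mono) auto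
    moreover have "a ^ 3 \<ge> 0" using a72 by simp
    moreover have "(41 / 40 * a) ^ 3 = 68921 / 64000 * a ^ 3" by (simp add: power_mult_distrib power_divide)
    ultimately have "8 * c ^ 3 \<le> 9 * a ^ 3" by linarith
    thus ?thesis unfolding e_def using a72 ab bc by (simp add: divide_simps)
  qed
  moreover have "1 + 9 / c ^ 3 \<le> exp (9 / c ^ 3)" by (rule exp_ge_add_one_self)
  ultimately have lam: "1 + 8 * e \<le> exp (9 / c ^ 3)" by linarith
  have AB: "?M a * ?M c * (1 + 8 * e) \<le> (?M b)\<^sup>2"
  proof -
    let ?g = "\<lambda>x. x - 3 * ln x + ln (x - 1)"
    let ?K = "pi\<^sup>2 / (6 * sqrt 3)"
    have "?g a + ?g c + 9 / c ^ 3 \<le> 2 * ?g b"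
    proof -
      have "real n > 2" using n790 by simp
      moreover have "pi / 6 * sqrt (24 * (real n - 1) - 1) \<ge> 72" using a72 by (simp only: a_def m_def)
      ultimately show ?thesis unfolding a_def b_def c_def m_def by (rule main_term_second_difference)
    qed
    hence "exp (?g a + ?g c + 9 / c ^ 3) \<le> exp (2 * ?g b)" by (simp only: exp_le_cancel_iff)
    hence "exp (?g a) * exp (?g c) * exp (9 / c ^ 3) \<le> (exp (?g b))\<^sup>2"
      by (simp only: exp_add exp_double)
    hence "?K\<^sup>2 * (exp (?g a) * exp (?g c) * exp (9 / c ^ 3)) \<le> ?K\<^sup>2 * (exp (?g b))\<^sup>2"
      by (intro mult_left_mono) auto
    moreover have M: "?M a = ?K * exp (?g a)" "?M b = ?K * exp (?g b)" "?M c = ?K * exp (?g c)"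
      by (rule main_term_eq_exp; use a72 ab bc in simp)+
    have "?M a * ?M c * exp (9 / c ^ 3) = ?K\<^sup>2 * (exp (?g a) * exp (?g c) * exp (9 / c ^ 3))"
      unfolding M power2_eq_square by (simp only: mult_ac)
    moreover have "(?M b)\<^sup>2 = ?K\<^sup>2 * (exp (?g b))\<^sup>2"
      unfolding M by (rule power_mult_distrib)
    ultimately have "?M a * ?M c * exp (9 / c ^ 3) \<le> (?M b)\<^sup>2" by (simp only:)
    moreover have "?M a * ?M c * (1 + 8 * e) \<le> ?M a * ?M c * exp (9 / c ^ 3)"
      using lam Mpos a72 ab bc by (intro mult_left_mono) auto
    ultimately show ?thesis by linarith
  qed
  have "real (partition_number (n - 1)) * real (partition_number (n + 1)) \<le> (?M a * (1 + e)) * (?M c * (1 + e))"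
    using up[OF err_a] up[OF err_c] Mpos a72 ab bc e0 by (intro mult_mono) auto
  also have "\<dots> = ?M a * ?M c * (1 + e)\<^sup>2" by (simp add: power2_eq_square mult_ac)
  also have "\<dots> \<le> (1 - e) * (?M b * (1 - e))\<^sup>2"
    using AB e0 e1 Mpos a72 ab bc by (intro perturbed_log_concavity) auto
  also have "\<dots> \<le> (1 - e) * (real (partition_number n))\<^sup>2"
    using lo[OF err_b ab] e1 Mpos a72 ab by (intro mult_left_mono power_mono) auto
  finally have fin: "real (partition_number (n - 1)) * real (partition_number (n + 1)) \<le>
    (1 - e) * (real (partition_number n))\<^sup>2" .
  \<comment> \<open>Gives 1/n^2 <= e, so the factor 1 - 1/n^2 costs no more than one further error
    e.\<close>
  have "a ^ 3 \<le> (real n)\<^sup>2"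
  proof (rule power2_le_imp_le)
    have "a\<^sup>2 \<le> 10 / 36 * (24 * (real n - 1) - 1)"
      unfolding a2 using pi2 n790 by (intro mult_right_mono) auto
    also have "\<dots> \<le> 7 * real n" using n790 by simp
    finally have "(a\<^sup>2) ^ 3 \<le> (7 * real n) ^ 3" by (intro power_mono) auto
    also have "\<dots> = 343 * real n ^ 3" by (simp add: power_mult_distrib)
    also have "\<dots> \<le> real n * real n ^ 3" using n790 by (intro mult_right_mono) auto
    finally show "(a ^ 3)\<^sup>2 \<le> ((real n)\<^sup>2)\<^sup>2" by (simp flip: power_mult power_Suc)
  qed auto
  hence "(real n)\<^sup>2 * e \<ge> 1" using a72 by (simp add: e_def)
  hence "(real n)\<^sup>2 * (1 - e) \<le> (real n)\<^sup>2 - 1" by (simp add: algebra_simps)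
  hence "(real n)\<^sup>2 * (1 - e) * (real (partition_number n))\<^sup>2 \<le> ((real n)\<^sup>2 - 1) * (real (partition_number n))\<^sup>2"
    by (intro mult_right_mono) auto
  moreover have "(real n)\<^sup>2 * (real (partition_number (n - 1)) * real (partition_number (n + 1))) \<le>
     (real n)\<^sup>2 * ((1 - e) * (real (partition_number n))\<^sup>2)"
    using fin by (intro mult_left_mono) auto
  ultimately show ?thesis by (simp only: mult.assoc of_nat_mult)
qed

section \<open>The pentagonal recurrence\<close>

primrec triangle :: "nat \<Rightarrow> nat" where
  "triangle 0 = 0"
| "triangle (Suc s) = triangle s + Suc s"

lemma triangle_mono: "a \<le> b \<Longrightarrow> triangle a \<le> triangle b"
  by (induction b) (auto simp: le_Suc_eq)

lemma triangle_eq: "triangle s = s * (s + 1) div 2"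
  by (induction s) auto

text \<open>Shanks' finite form of the pentagonal number theorem: modulo \<open>x ^ (m + 1)\<close> only the summand
  \<open>s = 0\<close> survives.\<close>
definition shanks_sum :: "'a :: comm_ring_1 \<Rightarrow> nat \<Rightarrow> 'a" where
  "shanks_sum x m = (\<Sum>s\<le>m. (-1) ^ s * x ^ triangle s * (\<Prod>j=Suc s..m. 1 - x ^ j) * x ^ (s * m))"

text \<open>Telescoping: passing from m to m + 1 turns \<open>c s\<close> into
  \<open>c s - c s * (1 - x ^ s) - V s\<close>, and
  \<open>c (Suc s) * (1 - x ^ Suc s) = - V s\<close>. Only \<open>V m\<close> and the new summand s
  = m + 1 are left.\<close>

lemma shanks_sum_Suc:
  fixes x :: "'a :: comm_ring_1"
  shows "shanks_sum x (Suc m) = shanks_sum x m +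
           (-1) ^ Suc m * (x ^ (triangle m + Suc m * Suc m) + x ^ (triangle (Suc m) + Suc m * Suc m))"
proof -
  define n where "n = Suc m"
  define T where "T = (\<lambda>s. (-1) ^ s * x ^ triangle s)"
  define A where "A = (\<lambda>s. \<Prod>j=Suc s..m. 1 - x ^ j)"
  define c where "c = (\<lambda>s. T s * A s * x ^ (s * m))"
  define V where "V = (\<lambda>s. T s * A s * x ^ (Suc s * n))"
  have "shanks_sum x n = (\<Sum>s\<le>m. (-1) ^ s * x ^ triangle s * (\<Prod>j=Suc s..n. 1 - x ^ j) * x ^ (s * n)) + T n * x ^ (n * n)"
    by (simp add: shanks_sum_def n_def T_def)
  also have "(\<Sum>s\<le>m. (-1) ^ s * x ^ triangle s * (\<Prod>j=Suc s..n. 1 - x ^ j) * x ^ (s * n)) =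
             (\<Sum>s\<le>m. c s - c s * (1 - x ^ s) - V s)"
  proof (rule sum.cong)
    fix s assume s: "s \<in> {..m}"
    have p: "(\<Prod>j=Suc s..n. 1 - x ^ j) = A s * (1 - x ^ n)"
      using s by (simp add: A_def n_def)
    have e: "x ^ (s * n) = x ^ (s * m) * x ^ s" "x ^ (Suc s * n) = x ^ (s * m) * x ^ s * x ^ n"
      by (simp_all add: n_def algebra_simps flip: power_add)
    show "(-1) ^ s * x ^ triangle s * (\<Prod>j=Suc s..n. 1 - x ^ j) * x ^ (s * n) = c s - c s * (1 - x ^ s) - V s"
      unfolding p e c_def V_def T_def by (simp add: algebra_simps)
  qed auto
  also have "\<dots> = shanks_sum x m - (\<Sum>s\<le>m. c s * (1 - x ^ s)) - (\<Sum>s\<le>m. V s)"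
    by (simp add: sum_subtractf shanks_sum_def c_def T_def A_def)
  also have "(\<Sum>s\<le>m. c s * (1 - x ^ s)) = (\<Sum>s<m. c (Suc s) * (1 - x ^ Suc s))"
  proof -
    have "(\<Sum>s\<le>m. c s * (1 - x ^ s)) = c 0 * (1 - x ^ 0) + (\<Sum>s<m. c (Suc s) * (1 - x ^ Suc s))"
      using sum.atMost_shift[of "\<lambda>s. c s * (1 - x ^ s)" m] by simp
    thus ?thesis by simp
  qed
  also have "\<dots> = (\<Sum>s<m. - V s)"
  proof (rule sum.cong)
    fix s assume s: "s \<in> {..<m}"
    have "A s = (1 - x ^ Suc s) * A (Suc s)"
      using s by (simp add: A_def prod.atLeast_Suc_atMost)
    moreover have "T (Suc s) = - (T s * x ^ Suc s)"
      by (simp add: T_def power_add mult_ac)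
    moreover have "x ^ (Suc s * n) = x ^ Suc s * x ^ (Suc s * m)"
    proof -
      have "Suc s * n = Suc s + Suc s * m" by (simp add: n_def)
      thus ?thesis by (simp only: power_add)
    qed
    ultimately show "c (Suc s) * (1 - x ^ Suc s) = - V s"
      unfolding c_def V_def by (simp only: mult_ac mult_minus_left mult_minus_right)
  qed auto
  also have "(\<Sum>s\<le>m. V s) = (\<Sum>s<m. V s) + V m"
    by (simp flip: lessThan_Suc_atMost)
  also have "V m = T m * x ^ (n * n)" by (simp add: V_def A_def n_def)
  finally have "shanks_sum x n = shanks_sum x m + (T n * x ^ (n * n) - T m * x ^ (n * n))"
    by (simp add: sum_negf)
  thus ?thesis by (simp add: n_def T_def power_add algebra_simps)
qed

text \<open>The two exponents are the generalized pentagonal numbers s (3 s - 1) / 2 and s (3 s + 1)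
  / 2.\<close>

lemma shanks_sum_eq_pentagonal:
  fixes x :: "'a :: comm_ring_1"
  shows "shanks_sum x m =
           1 + (\<Sum>s=1..m. (-1) ^ s * (x ^ (triangle (s - 1) + s * s) + x ^ (triangle s + s * s)))"
  by (induction m) (simp_all add: shanks_sum_Suc, simp add: shanks_sum_def)

section \<open>Formal power series and Euler's recurrence\<close>

definition bounded_partition_fps :: "nat \<Rightarrow> int fps" where
  "bounded_partition_fps m = Abs_fps (\<lambda>n. int (bounded_partition_number m n))"

lemma bounded_partition_fps_Suc:
  "bounded_partition_fps (Suc m) * (1 - fps_X ^ Suc m) = bounded_partition_fps m"
proof (rule fps_ext)
  fix n
  have "(bounded_partition_fps (Suc m) * (1 - fps_X ^ Suc m)) $ n =
        int (bounded_partition_number (Suc m) n) -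
        (if n < Suc m then 0 else int (bounded_partition_number (Suc m) (n - Suc m)))"
    by (simp add: right_diff_distrib fps_X_power_mult_right_nth bounded_partition_fps_def del: power_Suc)
  thus "(bounded_partition_fps (Suc m) * (1 - fps_X ^ Suc m)) $ n = bounded_partition_fps m $ n"
    by (subst (asm) bounded_partition_number_Suc[of m n]) (simp add: bounded_partition_fps_def split: if_splits)
qed

lemma bounded_partition_fps_times_product:
  "bounded_partition_fps m * (\<Prod>j=1..m. 1 - fps_X ^ j) = 1"
proof (induction m)
  case 0
  show ?case by (rule fps_ext) (simp add: bounded_partition_fps_def bounded_partition_number_0)
next
  case (Suc m)
  have "bounded_partition_fps (Suc m) * (\<Prod>j=1..Suc m. 1 - fps_X ^ j) =
        (bounded_partition_fps (Suc m) * (1 - fps_X ^ Suc m)) * (\<Prod>j=1..m. 1 - fps_X ^ j)"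
    by (simp add: mult_ac del: power_Suc)
  thus ?case by (simp only: bounded_partition_fps_Suc Suc)
qed

text \<open>Integer-valued because the recurrence subtracts; the computed values become rewrite
  rules for this constant.\<close>

definition int_partition_number :: "nat \<Rightarrow> int" where
  "int_partition_number n = int (partition_number n)"

text \<open>Multiply Shanks' identity by the inverse of the product over j <= m and compare
  coefficients of x^n for 0 < n <= m. The summand s = 0 becomes the constant 1, and the others have
  order at least m + 1. \<open>t\<close> encodes that p vanishes at negative arguments.\<close>

lemma euler_recurrence:
  assumes "0 < n" "n \<le> m"
  defines "t \<equiv> (\<lambda>g. if n < g then 0 else int_partition_number (n - g))"
  shows "int_partition_number n =
           - (\<Sum>s=1..m. (-1) ^ s * (t (triangle (s - 1) + s * s) + t (triangle s + s * s)))"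
proof -
  let ?P = "bounded_partition_fps m"
  let ?R = "\<lambda>s. (-1) ^ s * fps_X ^ triangle s * (\<Prod>j=Suc s..m. 1 - fps_X ^ j) * fps_X ^ (s * m) :: int fps"
  have tail: "(?P * ?R s) $ n = 0" if "s \<in> {1..m}" for s
  proof -
    have "n < triangle s + s * m"
    proof -
      have "m \<le> s * m" "triangle s \<ge> 1" using that triangle_mono[of 1 s] by auto
      thus ?thesis using assms by linarith
    qed
    moreover have "?P * ?R s = (?P * (-1) ^ s * (\<Prod>j=Suc s..m. 1 - fps_X ^ j)) * fps_X ^ (triangle s + s * m)"
      by (simp only: power_add mult_ac)
    ultimately show ?thesis by (simp only: fps_X_power_mult_right_nth if_True)
  qed
  have "shanks_sum fps_X m = ?R 0 + (\<Sum>s=1..m. ?R s)"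
    unfolding shanks_sum_def by (subst sum.atMost_shift) (auto intro!: sum.reindex_bij_witness[of _ "\<lambda>s. s - 1" Suc])
  also have "?R 0 = (\<Prod>j=1..m. 1 - fps_X ^ j)" by simp
  finally have "?P * shanks_sum fps_X m = 1 + (\<Sum>s=1..m. ?P * ?R s)"
    by (simp only: distrib_left bounded_partition_fps_times_product sum_distrib_left)
  hence "(?P * shanks_sum fps_X m) $ n = 0"
    using assms tail by (simp add: fps_sum_nth)
  moreover have P_nth: "?P $ k = int_partition_number k" if "k \<le> n" for k
    using that assms by (simp add: bounded_partition_fps_def int_partition_number_def bounded_partition_number_eq)
  have mono: "(?P * fps_X ^ g) $ n = t g" for g
    by (simp add: fps_X_power_mult_right_nth t_def P_nth)
  have "?P * shanks_sum fps_X m = ?P + (\<Sum>s=1..m. (-1) ^ s *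
           (?P * fps_X ^ (triangle (s - 1) + s * s) + ?P * fps_X ^ (triangle s + s * s)))"
    unfolding shanks_sum_eq_pentagonal by (simp add: distrib_left sum_distrib_left mult_ac)
  hence "(?P * shanks_sum fps_X m) $ n = int_partition_number n +
      (\<Sum>s=1..m. ((-1) ^ s * (?P * fps_X ^ (triangle (s - 1) + s * s) + ?P * fps_X ^ (triangle s + s * s))) $ n)"
    by (simp add: fps_sum_nth P_nth)
  also have "(\<Sum>s=1..m. ((-1) ^ s * (?P * fps_X ^ (triangle (s - 1) + s * s) + ?P * fps_X ^ (triangle s + s * s))) $ n) =
     (\<Sum>s=1..m. (-1) ^ s * (t (triangle (s - 1) + s * s) + t (triangle s + s * s)))"
  proof (rule sum.cong)
    fix s
    show "((-1) ^ s * (?P * fps_X ^ (triangle (s - 1) + s * s) + ?P * fps_X ^ (triangle s + s * s))) $ n =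
          (-1) ^ s * (t (triangle (s - 1) + s * s) + t (triangle s + s * s))"
      by (cases "even s") (simp_all add: mono)
  qed auto
  ultimately show ?thesis by linarith
qed

section \<open>The recurrence in a form suited to evaluation\<close>

definition signed_pentagonals :: "nat \<Rightarrow> (bool \<times> nat) list" where
  "signed_pentagonals k =
     concat (map (\<lambda>s. [(odd s, triangle (s - 1) + s * s), (odd s, triangle s + s * s)]) [1..<Suc k])"

text \<open>\<open>True\<close> marks a term to be added, that is s odd. On the increasing list of
  pentagonal numbers the evaluation can stop at the first entry above n, so no natural subtraction
  is ever cut off.\<close>

primrec pentagonal_sum :: "nat \<Rightarrow> (bool \<times> nat) list \<Rightarrow> int" where
  "pentagonal_sum n [] = 0"
| "pentagonal_sum n (x # xs) = (if n < snd x then 0 else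
     if fst x then int_partition_number (n - snd x) + pentagonal_sum n xs
     else pentagonal_sum n xs - int_partition_number (n - snd x))"

lemma pentagonal_sum_eq:
  assumes "sorted (map snd xs)"
  shows "pentagonal_sum n xs = (\<Sum>x\<leftarrow>xs. (if fst x then 1 else -1) *
           (if n < snd x then 0 else int_partition_number (n - snd x)))"
  using assms
proof (induction xs)
  case (Cons x xs)
  show ?case
  proof (cases "n < snd x")
    case True
    hence "\<forall>y\<in>set xs. n < snd y" using Cons.prems by auto
    hence "(\<Sum>y\<leftarrow>xs. (if fst y then 1 else -1) *
             (if n < snd y then 0 else int_partition_number (n - snd y))) = (\<Sum>y\<leftarrow>xs. 0)"
      by (intro arg_cong[of _ _ sum_list] map_cong) auto
    thus ?thesis using True by simp
  next
    case False
    thus ?thesis using Cons by simp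
  qed
qed auto

lemma sum_signed_pentagonals:
  fixes t :: "nat \<Rightarrow> int"
  shows "(\<Sum>x\<leftarrow>signed_pentagonals k. (if fst x then 1 else -1) * t (snd x)) =
           - (\<Sum>s=1..k. (-1) ^ s * (t (triangle (s - 1) + s * s) + t (triangle s + s * s)))"
  by (induction k) (auto simp: signed_pentagonals_def)

lemma signed_pentagonals_25:
  "signed_pentagonals 25 =
     [(True, 1), (True, 2), (False, 5), (False, 7), (True, 12), (True, 15), (False, 22),
      (False, 26), (True, 35), (True, 40), (False, 51), (False, 57), (True, 70), (True, 77),
      (False, 92), (False, 100), (True, 117), (True, 126), (False, 145), (False, 155),
      (True, 176), (True, 187), (False, 210), (False, 222), (True, 247), (True, 260),
      (False, 287), (False, 301), (True, 330), (True, 345), (False, 376), (False, 392),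
      (True, 425), (True, 442), (False, 477), (False, 495), (True, 532), (True, 551),
      (False, 590), (False, 610), (True, 651), (True, 672), (False, 715), (False, 737),
      (True, 782), (True, 805), (False, 852), (False, 876), (True, 925), (True, 950)]"
  by (simp add: signed_pentagonals_def triangle_eq upt_conv_Cons)

text \<open>The first pentagonal number beyond the list is 325 + 26^2 = 1001, which is why n may go
  up to 1000.\<close>

lemma int_partition_number_recurrence:
  assumes "0 < n" "n \<le> 1000"
  shows "int_partition_number n = pentagonal_sum n (signed_pentagonals 25)"
proof -
  define t where "t = (\<lambda>g. if n < g then 0 else int_partition_number (n - g))"
  let ?f = "\<lambda>s. (-1) ^ s * (t (triangle (s - 1) + s * s) + t (triangle s + s * s))"
  have "int_partition_number n = - (\<Sum>s=1..1000. ?f s)"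
    unfolding t_def using assms by (intro euler_recurrence)
  also have "(\<Sum>s=1..1000. ?f s) = (\<Sum>s=1..25. ?f s)"
  proof (rule sum.mono_neutral_right)
    show "\<forall>s\<in>{1..1000} - {1..25}. ?f s = 0"
    proof
      fix s :: nat assume "s \<in> {1..1000} - {1..25}"
      hence s: "26 \<le> s" by auto
      have "triangle 25 \<le> triangle (s - 1)" using s by (intro triangle_mono) simp
      hence "325 \<le> triangle (s - 1)" by (simp add: triangle_eq[of 25])
      moreover have "26 * 26 \<le> s * s" using s by (intro mult_le_mono)
      moreover have "triangle (s - 1) \<le> triangle s" by (rule triangle_mono) simp
      ultimately have "n < triangle (s - 1) + s * s" "n < triangle s + s * s" using assms by linarith+
      thus "?f s = 0" by (simp add: t_def)
    qed
  qed auto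
  also have "- (\<Sum>s=1..25. ?f s) = (\<Sum>x\<leftarrow>signed_pentagonals 25. (if fst x then 1 else -1) * t (snd x))"
    by (rule sum_signed_pentagonals [symmetric])
  also have "\<dots> = pentagonal_sum n (signed_pentagonals 25)"
    unfolding t_def by (rule pentagonal_sum_eq [symmetric]) (simp add: signed_pentagonals_25)
  finally show ?thesis .
qed

lemma int_partition_number_0_1 [simp]:
  "int_partition_number 0 = 1" "int_partition_number (Suc 0) = 1"
proof -
  show 0: "int_partition_number 0 = 1" by (simp add: int_partition_number_def)
  have "int_partition_number (Suc 0) = pentagonal_sum (Suc 0) (signed_pentagonals 25)"
    by (rule int_partition_number_recurrence) auto
  thus "int_partition_number (Suc 0) = 1" using 0 by (simp add: signed_pentagonals_25)
qed

section \<open>Testing log-concavity on truncated values\<close>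

definition truncate_bits :: "nat \<Rightarrow> int \<Rightarrow> int" where
  "truncate_bits s x = x div 2 ^ s"

text \<open>Numerals are binary, so dropping a bit strips one constructor and the simplifier never
  has to divide. The rules for \<open>Suc s\<close> serve the shift 1, which appears as
  \<open>Suc 0\<close>.\<close>

lemma truncate_bits_simps [simp]:
  "truncate_bits 0 x = x"
  "truncate_bits (Suc s) (numeral (Num.Bit0 k)) = truncate_bits s (numeral k)"
  "truncate_bits (Suc s) (numeral (Num.Bit1 k)) = truncate_bits s (numeral k)"
  "truncate_bits (numeral r) (numeral (Num.Bit0 k)) = truncate_bits (pred_numeral r) (numeral k)"
  "truncate_bits (numeral r) (numeral (Num.Bit1 k)) = truncate_bits (pred_numeral r) (numeral k)"
proof -
  have *: "truncate_bits (Suc s) x = truncate_bits s (x div 2)" for s x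
    by (simp add: truncate_bits_def zdiv_zmult2_eq)
  show "truncate_bits 0 x = x" by (simp add: truncate_bits_def)
  show "truncate_bits (Suc s) (numeral (Num.Bit0 k)) = truncate_bits s (numeral k)"
    "truncate_bits (Suc s) (numeral (Num.Bit1 k)) = truncate_bits s (numeral k)" for s
    by (simp_all add: *)
  thus "truncate_bits (numeral r) (numeral (Num.Bit0 k)) = truncate_bits (pred_numeral r) (numeral k)"
    "truncate_bits (numeral r) (numeral (Num.Bit1 k)) = truncate_bits (pred_numeral r) (numeral k)"
    by (simp_all only: numeral_eq_Suc)
qed

lemma truncate_bits_bounds:
  assumes "x \<ge> 0"
  shows "0 \<le> truncate_bits s x" "truncate_bits s x * 2 ^ s \<le> x" "x \<le> (truncate_bits s x + 1) * 2 ^ s"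
proof -
  show "0 \<le> truncate_bits s x" using assms by (simp add: truncate_bits_def pos_imp_zdiv_nonneg_iff)
  have "truncate_bits s x * 2 ^ s + x mod 2 ^ s = x"
    unfolding truncate_bits_def by (rule div_mult_mod_eq)
  moreover have "0 \<le> x mod 2 ^ s" "x mod 2 ^ s < 2 ^ s" by auto
  ultimately show "truncate_bits s x * 2 ^ s \<le> x" "x \<le> (truncate_bits s x + 1) * 2 ^ s"
    unfolding distrib_right by linarith+
qed

text \<open>Dropping the last \<open>s\<close> bits keeps the products small; when bits are dropped, the factors on the
  left are rounded up.\<close>
definition log_concave_test :: "nat \<Rightarrow> nat \<Rightarrow> bool" where
  "log_concave_test s n \<longleftrightarrow> (let d = if s = 0 then 0 else 1 in
     int n * int n * ((truncate_bits s (int_partition_number (n - 1)) + d) *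
       (truncate_bits s (int_partition_number (n + 1)) + d)) \<le>
     (int n * int n - 1) * (truncate_bits s (int_partition_number n) * truncate_bits s (int_partition_number n)))"

text \<open>Each value lies between its truncation and the rounded-up truncation, both scaled by
  2^s; the factor 2^(2 s) is common to both sides.\<close>

lemma log_concave_testD:
  assumes test: "log_concave_test s n" and n: "n > 0"
  shows "int n * int n * (int_partition_number (n - 1) * int_partition_number (n + 1)) \<le>
           (int n * int n - 1) * (int_partition_number n * int_partition_number n)"
proof -
  let ?P = int_partition_number
  let ?T = "truncate_bits s"
  define d :: int where "d = (if s = 0 then 0 else 1)"
  have P0: "?P k \<ge> 0" for k by (simp add: int_partition_number_def)
  have up: "?P k \<le> (?T (?P k) + d) * 2 ^ s" for k
    using truncate_bits_bounds(3)[OF P0] by (auto simp: d_def)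
  have d0: "d \<ge> 0" by (auto simp: d_def)
  have nn: "int n * int n \<ge> 1" using mult_mono[of 1 "int n" 1 "int n"] n by simp
  have "int n * int n * (?P (n - 1) * ?P (n + 1)) \<le>
          int n * int n * (((?T (?P (n - 1)) + d) * 2 ^ s) * ((?T (?P (n + 1)) + d) * 2 ^ s))"
    using up P0 d0 truncate_bits_bounds(1)[OF P0] by (intro mult_left_mono mult_mono) auto
  also have "\<dots> = (int n * int n * ((?T (?P (n - 1)) + d) * (?T (?P (n + 1)) + d))) * (2 ^ s * 2 ^ s)"
    by (simp only: mult_ac)
  also have "\<dots> \<le> ((int n * int n - 1) * (?T (?P n) * ?T (?P n))) * (2 ^ s * 2 ^ s)"
    using test unfolding log_concave_test_def Let_def d_def [symmetric] by (rule mult_right_mono) simp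
  also have "\<dots> = (int n * int n - 1) * ((?T (?P n) * 2 ^ s) * (?T (?P n) * 2 ^ s))"
    by (simp only: mult_ac)
  also have "\<dots> \<le> (int n * int n - 1) * (?P n * ?P n)"
    using nn P0 truncate_bits_bounds[OF P0] by (intro mult_left_mono mult_mono) auto
  finally show ?thesis .
qed

primrec log_concave_tests :: "nat \<Rightarrow> nat list \<Rightarrow> bool" where
  "log_concave_tests n [] = True"
| "log_concave_tests n (s # ss) \<longleftrightarrow>
     log_concave_test s n \<and> log_concave_test s (n + 1) \<and>
     log_concave_test s (n + 2) \<and> log_concave_test s (n + 3) \<and> log_concave_tests (n + 4) ss"

lemma log_concave_testsD:
  assumes "log_concave_tests m ss" "0 < m" "m \<le> n" "n < m + 4 * length ss"
  shows "int n * int n * (int_partition_number (n - 1) * int_partition_number (n + 1)) \<le>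
           (int n * int n - 1) * (int_partition_number n * int_partition_number n)"
  using assms
proof (induction ss arbitrary: m)
  case (Cons s ss)
  show ?case
  proof (cases "n < m + 4")
    case True
    hence "n = m \<or> n = m + 1 \<or> n = m + 2 \<or> n = m + 3" using Cons.prems by auto
    hence "log_concave_test s n" using Cons.prems by auto
    thus ?thesis using Cons.prems by (intro log_concave_testD) auto
  next
    case False
    thus ?thesis using Cons.IH[of "m + 4"] Cons.prems by auto
  qed
qed auto

text \<open>Shorthand for a block of consecutive values. Unfolded in the finished theorem, it
  becomes a conjunction of equations at numerals, which are then rewrite rules.\<close>

primrec partition_values :: "nat \<Rightarrow> int list \<Rightarrow> bool" where
  "partition_values n [] = True"
| "partition_values n (x # xs) \<longleftrightarrow> int_partition_number n = x \<and> partition_values (Suc n) xs"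

lemmas partition_values_unfold = partition_values.simps Suc_numeral add_num_simps simp_thms

text \<open>Through \<open>trans\<close> the recurrence is applied once, to the left-hand side of
  the goal; as a rewrite rule it would also expand the smaller arguments.\<close>

lemmas partition_value_eqI =
  trans[OF int_partition_number_recurrence[unfolded signed_pentagonals_25]]

section \<open>Values of the partition function up to 792\<close>

text \<open>The rule \<open>context_conjI\<close> makes the preceding values of a block available for the next one.\<close>
lemma partition_values_2 [unfolded partition_values_unfold, simp]:
  "partition_values 2
  [2, 3, 5, 7, 11, 15, 22, 30, 42, 56, 77, 101, 135, 176, 231, 297, 385, 490, 627, 792, 1002, 1255, 1575, 1958,
   2436, 3010, 3718, 4565, 5604, 6842, 8349, 10143, 12310, 14883, 17977, 21637, 26015, 31185, 37338, 44583,
   53174, 63261, 75175, 89134, 105558, 124754, 147273, 173525, 204226, 239943, 281589, 329931, 386155, 451276,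
   526823, 614154, 715220, 831820, 966467, 1121505, 1300156, 1505499, 1741630, 2012558, 2323520, 2679689,
   3087735, 3554345, 4087968, 4697205, 5392783, 6185689, 7089500, 8118264, 9289091, 10619863, 12132164,
   13848650, 15796476, 18004327, 20506255, 23338469, 26543660, 30167357, 34262962, 38887673, 44108109,
   49995925, 56634173, 64112359, 72533807, 82010177, 92669720, 104651419, 118114304, 133230930, 150198136,
   169229875, 190569292]"
  by (unfold partition_values_unfold) (intro context_conjI; rule partition_value_eqI; simp (no_asm_simp))

lemma partition_values_101 [unfolded partition_values_unfold, simp]:
  "partition_values 101
  [214481126, 241265379, 271248950, 304801365, 342325709, 384276336, 431149389, 483502844, 541946240, 607163746,
   679903203, 761002156, 851376628, 952050665, 1064144451, 1188908248, 1327710076, 1482074143, 1653668665,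
   1844349560, 2056148051, 2291320912, 2552338241, 2841940500, 3163127352, 3519222692, 3913864295, 4351078600,
   4835271870, 5371315400, 5964539504, 6620830889, 7346629512, 8149040695, 9035836076, 10015581680,
   11097645016, 12292341831, 13610949895, 15065878135, 16670689208, 18440293320, 20390982757, 22540654445,
   24908858009, 27517052599, 30388671978, 33549419497, 37027355200, 40853235313, 45060624582, 49686288421,
   54770336324, 60356673280, 66493182097, 73232243759, 80630964769, 88751778802, 97662728555, 107438159466,
   118159068427, 129913904637, 142798995930, 156919475295, 172389800255, 189334822579, 207890420102,
   228204732751, 250438925115, 274768617130, 301384802048, 330495499613, 362326859895, 397125074750,
   435157697830, 476715857290, 522115831195, 571701605655, 625846753120, 684957390936, 749474411781,
   819876908323, 896684817527, 980462880430, 1071823774337, 1171432692373, 1280011042268, 1398341745571,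
   1527273599625, 1667727404093, 1820701100652, 1987276856363, 2168627105469, 2366022741845, 2580840212973,
   2814570987591, 3068829878530, 3345365983698, 3646072432125, 3972999029388]"
  by (unfold partition_values_unfold) (intro context_conjI; rule partition_value_eqI; simp (no_asm_simp))

lemma partition_values_201 [unfolded partition_values_unfold, simp]:
  "partition_values 201
  [4328363658647, 4714566886083, 5134205287973, 5590088317495, 6085253859260, 6622987708040, 7206841706490,
   7840656226137, 8528581302375, 9275102575355, 10085065885767, 10963707205259, 11916681236278, 12950095925895,
   14070545699287, 15285151248481, 16601598107914, 18028182516671, 19573856161145, 21248279009367,
   23061871173849, 25025873760111, 27152408925615, 29454549941750, 31946390696157, 34643126322519,
   37561133582570, 40718063627362, 44132934884255, 47826239745920, 51820051838712, 56138148670947,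
   60806135438329, 65851585970275, 71304185514919, 77195892663512, 83561103925871, 90436839668817,
   97862933703585, 105882246722733, 114540884553038, 123888443077259, 133978259344888, 144867692496445,
   156618412527946, 169296722391554, 182973889854026, 197726516681672, 213636919820625, 230793554364681,
   249291451168559, 269232701252579, 290726957916112, 313891991306665, 338854264248680, 365749566870782,
   394723676655357, 425933084409356, 459545750448675, 495741934760846, 534715062908609, 576672674947168,
   621837416509615, 670448123060170, 722760953690372, 779050629562167, 839611730366814, 904760108316360,
   974834369944625, 1050197489931117, 1131238503938606, 1218374349844333, 1312051800816215, 1412749565173450,
   1520980492851175, 1637293969337171, 1762278433057269, 1896564103591584, 2040825852575075, 2195786311682516,
   2362219145337711, 2540952590045698, 2732873183547535, 2938929793929555, 3160137867148997, 3397584011986773,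
   3652430836071053, 3925922161489422, 4219388528587095, 4534253126900886, 4872038056472084, 5234371069753672,
   5622992691950605, 6039763882095515, 6486674127079088, 6965850144195831, 7479565078510584, 8030248384943040,
   8620496275465025, 9253082936723602]"
  by (unfold partition_values_unfold) (intro context_conjI; rule partition_value_eqI; simp (no_asm_simp))

lemma partition_values_301 [unfolded partition_values_unfold, simp]:
  "partition_values 301
  [9930972392403501, 10657331232548839, 11435542077822104, 12269218019229465, 13162217895057704,
   14118662665280005, 15142952738857194, 16239786535829663, 17414180133147295, 18671488299600364,
   20017426762576945, 21458096037352891, 23000006655487337, 24650106150830490, 26415807633566326,
   28305020340996003, 30326181989842964, 32488293351466654, 34800954869440830, 37274405776748077,
   39919565526999991, 42748078035954696, 45772358543578028, 49005643635237875, 52462044228828641,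
   56156602112874289, 60105349839666544, 64325374609114550, 68834885946073850, 73653287861850339,
   78801255302666615, 84300815636225119, 90175434980549623, 96450110192202760, 103151466321735325,
   110307860425292772, 117949491546113972, 126108517833796355, 134819180623301520, 144117936527873832,
   154043597379576030, 164637479165761044, 175943559810422753, 188008647052292980, 200882556287683159,
   214618299743286299, 229272286871217150, 244904537455382406, 261578907351144125, 279363328483702152,
   298330063062758076, 318555973788329084, 340122810048577428, 363117512048110005, 387632532919029223,
   413766180933342362, 441622981929358437, 471314064268398780, 502957566506000020, 536679070310691121,
   572612058898037559, 610898403751884101, 651688879997206959, 695143713458946040, 741433159884081684,
   790738119649411319, 843250788562528427, 899175348396088349, 958728697912338045, 1022141228367345362,
   1089657644424399782, 1161537834849962850, 1238057794119125085, 1319510599727473500, 1406207446561484054,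
   1498478743590581081, 1596675274490756791, 1701169427975813525, 1812356499739472950, 1930656072350465812,
   2056513475336633805, 2190401332423765131, 2332821198543892336, 2484305294265418180, 2645418340688763701,
   2816759503217942792, 2998964447736452194, 3192707518433532826, 3398704041358160275, 3617712763867604423,
   3850538434667429186, 4098034535626594791, 4361106170762284114, 4640713124699623515, 4937873096788191655,
   5253665124416975163, 5589233202595404488, 5945790114707874597, 6324621482504294325, 6727090051741041926]"
  by (unfold partition_values_unfold) (intro context_conjI; rule partition_value_eqI; simp (no_asm_simp))

lemma partition_values_401 [unfolded partition_values_unfold, simp]:
  "partition_values 401
  [7154640222653942321, 7608802843339879269, 8091200276484465581, 8603551759348655060, 9147679068859117602,
   9725512513742021729, 10339097267123947241, 10990600063775926994, 11682316277192317780, 12416677403151190382,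
   13196258966925435702, 14023788883518847344, 14902156290309948968, 15834420884488187770,
   16823822787139235544, 17873792969689876004, 18987964267331664557, 20170183018805933659,
   21424521360255636320, 22755290216580025259, 24167053021441363961, 25664640213837714846,
   27253164546230421739, 28938037257084798150, 30724985147095051099, 32620068617410232189,
   34629700713903575934, 36760667241831527309, 39020148000237259665, 41415739207102358378,
   43955477170518116534, 46647863284229267991, 49501890409405150715, 52527070729108240605,
   55733465144636286656, 59131714309169618645, 62733071376043079215, 66549436566966297367,
   70593393646562135510, 74878248419470886233, 79418069346443402240, 84227730407729499781,
   89322956321353645667, 94720370257893471820, 100437544171752847604, 106493051905239118581,
   112906525199196103354, 119698712782720205954, 126891542690981418000, 134508188001572923840,
   142573136155347404229, 151112262071917313678, 160152905244553715585, 169723951046458040965,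
   179855916453958267598, 190581040442651931034, 201933379285114688629, 213948907032733069132,
   226665621435831345565, 240123655613925192081, 254365395758574199975, 269435605212954994471,
   285381555241961986287, 302253162872576636605, 320103136152993290544, 338987127249525432549,
   358963893768162876613, 380095468763120598477, 402447339861711475160, 426088638015652413417,
   451092336355096099864, 477535459708164115593, 505499305314204629558, 535069675351607262125,
   566337121865805599675, 599397204782301852926, 634350763653787028583, 671304203896731807232,
   710369798236628238005, 751666004194993125591, 795317798414758232180, 841457028742823649455,
   890222784951928088294, 941761789114997698055, 996228806608573411012, 1053787078862455346513,
   1114608778936426484248, 1178875491155735802646, 1246778716001272919665, 1318520401612270233223,
   1394313503224447816939, 1474382572040363953132, 1558964374994977806173, 1648308547066172438760,
   1742678277747760981187, 1842351033503159891466, 1947619317987658064007, 2058791472042884901563,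
   2176192515439287461625, 2300165032574323995027]"
  by (unfold partition_values_unfold) (intro context_conjI; rule partition_value_eqI; simp (no_asm_simp))

lemma partition_values_501 [unfolded partition_values_unfold, simp]:
  "partition_values 501
  [2431070104309287327876, 2569288288377098289281, 2715220650772245313220, 2869289850802400662045,
   3031941282464413132742, 3203644275096202070012, 3384893356244349844341, 3576209579998154653671,
   3778141924035171537110, 3991268758958164118300, 4216199393504640098482, 4453575699570940947378,
   4704073821002175842062, 4968405970488126319775, 5247322318923878793976, 5541612982013113936133,
   5852110108921301661040, 6179690078238084808000, 6525275806549652788115, 6889839175409542385648,
   7274403582551733377346, 7680046623716094332553, 8107902911527474124146, 8559167038437716736150,
   9035096690829005915201, 9537015921990240021538, 10066318591787500106586, 10624471981512075020731,
   11213020592521695111580, 11833590138006300416410, 12487891737367521803652, 13177726323474524612308,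
   13904989273245567335012, 14671675272840783232475, 15479883428970761068959, 16331822638729701493803,
   17229817230617210720599, 18176312890390861435034, 19173882885687454484110, 20225234604409151266221,
   21333216422211708570598, 22500824915577356165493, 23731212437346370138355, 25027695072821279146420,
   26393760995005382968154, 27833079238879849385687, 29349508915133986374841, 30947108885217475101876,
   32630147920163234060900, 34403115367205050943160, 36270732348871285128752, 38237963520943177237554,
   40310029416409244587122, 42492419404397720872600, 44790905293907018009131, 47211555614160398040338,
   49760750604354432757376, 52445197947746313627407, 55271949286085137715955, 58248417552751868050007,
   61382395164161775318496, 64682073111542943380454, 68156060996536236172174, 71813408056839596203570,
   75663625229609055443637, 79716708303343130521599, 83983162210640880002321, 88474026517495817981253,
   93200902166643654187580, 98175979536033971312388, 103412067875563710992446, 108922626189067392956037,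
   114721795630860408658491, 120824433490320564237125, 127246148840551966562301, 134003339931725153597473,
   141113233412529912746558, 148593925468119890197615, 156464424966082817448060, 164744698707340387584240,
   173455718882380096095248, 182619512839056823919887, 192259215272078129526277, 202399122950629095580175,
   213064752104884207160129, 224282898599046831034631, 236081701023305130945921, 248490706844586261413858,
   261540941761240642265710, 275264982414934173206642, 289697032618827122974972, 304873003269975366031783,
   320830596120295386610807, 337609391590065169560935, 355250940815002702558187, 373798862128436852709430,
   393298942187883251157044, 413799241966727832978027, 435350207840317348270000, 458004788008144308553622]"
  by (unfold partition_values_unfold) (intro context_conjI; rule partition_value_eqI; simp (no_asm_simp))

lemma partition_values_601 [unfolded partition_values_unfold, simp]:
  "partition_values 601
  [481818554503286362923739, 506849831053734861481872, 533159827070679866278987, 560812778053476538349420,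
   589876092712502332463864, 620420507127059714307352, 652520246268116112057164, 686253193233019826880477,
   721701066553229757379480, 758949605954969709105721, 798088766967999186006767, 839212924798226411060795,
   882421087896683264554175, 927817121679723721849795, 975509982873756796925504, 1025613964982134990453294,
   1078248955392080004474789, 1133540704665979618906662, 1191621108583631746910145, 1252628503530795506440909,
   1316707975853817969920561, 1384011685831426958558879, 1454699206941558115141676, 1528937881135168275063375,
   1606903190858354689128371, 1688779148601189609516729, 1774758704783877366657989, 1865044174831202682776536,
   1959847686321528964669495, 2059391647140527228529479, 2163909235608484556362424, 2273644913597837330081136,
   2388854963699932382735982, 2509808051552031608082535, 2636785814481962651219075, 2770083477684418110395121,
   2910010499193691843303014, 3056891244979232231862474, 3211065695545980277248740, 3372890185488482409685019,
   3542738177508596708707874, 3721001072479541451508397, 3908089057205582486668934, 4104431991606013700457110,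
   4310480337124871462076948, 4526706128254173781044298, 4753603989138067267826945, 4991692197319220372390544,
   5241513796775816319683700, 5503637762499727151307095, 5778660218961559003723580, 6067205714919484306343541,
   6369928557132709817142929, 6687514205661440172553650, 7020680733548749464953877, 7370180353811425547662139,
   7736801016790889035132284, 8121368081058512888507057, 8524746061205131302394950, 8947840456000332817673697,
   9391599660555044587641517, 9857016966290401433259592, 10345132652677367520056676,
   10857036174895938656583295, 11393868451739000294452939, 11956824258286445517629485,
   12547154728067493595502055, 13166169969647255482980383, 13815241802783448943206160,
   14495806619536377005379418, 15209368375944215483241988, 15957501720133631304230773,
   16741855262985451980947171, 17564154997755650263621500, 18426207875324210441995136,
   19329905542049511423199336, 20277228247502764885900784, 21270248929688765106878025,
   22311137485682880566295780, 23402165235974892374954302, 24545709591163085124246501,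
   25744258930034131533263392, 27000417698448800353553865, 28316911738879831363625420,
   29696593860867277871605321, 31142449663120060247020395, 32657603618448918933404658,
   34245325433219728719773420, 35909036693513349075724695, 37652317810725762600765183,
   39478915279883795756623331, 41392749264546866860893416, 43397921522754943172592795,
   45498723689129703063649450, 47699645928878027716139269, 50005385980149860746062163,
   52420858601901549459658530, 54951205445179608281719072, 57601805366500810491219000,
   60378285202834474611028659]"
  by (unfold partition_values_unfold) (intro context_conjI; rule partition_value_eqI; simp (no_asm_simp))

lemma partition_values_701 [unfolded partition_values_unfold, simp]:
  "partition_values 701
  [63286531028521032840985510, 66332699915362724119980694, 69523232218023552371152320, 72864864407855341219969825,
   76364642479247406973532354, 80029935953661656574123574, 83868452507581852374822598,
   87888253251761884175130183, 92097768690318501305952845, 96505815389469697877049934,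
   101121613386982294887579670, 105954804374756131323439197, 111015470688345108146850290,
   116314155138696524440183805, 121861881722882938654960142, 127670177252209281782740521,
   133751093937700984130081285, 140117232974725477106760252, 146781769170263852819573505,
   153758476658245881594406593, 161061755750279477635534762, 168706660971164630122439117,
   176708930330666271859881567, 185085015885255746880625875, 193852115645795752984189381,
   203028206889569986197651315, 212632080937520072186590492, 222683379460186024851577401,
   233202632378520643600875145, 244211297428606706709925517, 255731801462210865865001525,
   267787583558210323920375877, 280403140023083872114273884, 293604071362025285843562670,
   307417131305664218954016427, 321870277981032622582593573, 336992727319136467572139095,
   352815008795455957133215652, 369369023603738655757458075, 386688105367749941220651375,
   404807083500032850651734059, 423762349321394151918928481, 443591925059596733749014862,
   464335535850798483634138280, 486034684872448271784326296, 508732731741838107613602755,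
   532474974320122372524707631, 557308734067567635805394638, 583283445101886813536239875,
   610450747117966916191771809, 638864582333908382360557376, 668581296635294279311393900,
   699659745096778286894322787, 732161402067670820574405230, 766150476015982127183457373,
   801694029333610862568750951, 838862103313805798709299373, 877727848520950325159242658,
   918367660781873199488134935, 960861323037560814483873080, 1005292153304074193879898920,
   1051747159001957690209588887, 1100317197924192833923669753, 1151097146124113726578727360,
   1204186073016375022219516992, 1259687423996378387111229150, 1317709210896221493178043552,
   1378364210608578997366598385, 1441770172223648126550509165, 1508050033038752490738311726,
   1577332143815074048889599022, 1649750503671651735806603894, 1725445005022910006140645612,
   1804561688982956164492944650, 1887253011677361609828822380, 1973678121921532286407950000,
   2064003150743712843868729636, 2158401513250589964731360493, 2257054223353982965849642005,
   2360150221898687182164777966, 2467886718753771981901721670, 2580469549453004933593920862,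
   2698113546994164480174756373, 2821042929432312216467202070, 2949491703928193388274450292,
   3083704087940340693022764503, 3223934948277725160271634798, 3370450258759473520427114109,
   3523527577258789108163787100, 3683456542940343404363084600, 3850539394533563994343413787,
   4025091510519029370421431033]"
  by (unfold partition_values_unfold) (intro context_conjI; rule partition_value_eqI; simp (no_asm_simp))

text \<open>The ten shifts 0 mean that the values are compared exactly up to n = 71.\<close>

lemma log_concave_tests_32:
  "log_concave_tests 32
     [0, 0, 0, 0, 0, 0, 0, 0, 0, 0, 1, 2, 2, 3, 4, 5, 5, 6, 7, 7, 8, 9, 9, 10, 11, 11, 12, 12, 13, 13]"
  by (simp (no_asm_simp) add: log_concave_test_def Let_def)

lemma log_concave_tests_152:
  "log_concave_tests 152
     [14, 15, 15, 16, 16, 17, 17, 18, 18, 19, 19, 20, 20, 21, 21, 22, 22, 23, 23, 24, 24, 25, 25, 26, 26,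
      26, 27, 27, 28, 28]"
  by (simp (no_asm_simp) add: log_concave_test_def Let_def)

lemma log_concave_tests_272:
  "log_concave_tests 272
     [29, 29, 29, 30, 30, 31, 31, 32, 32, 32, 33, 33, 34, 34, 34, 35, 35, 36, 36, 36, 37, 37, 37, 38, 38,
      39, 39, 39, 40, 40]"
  by (simp (no_asm_simp) add: log_concave_test_def Let_def)

lemma log_concave_tests_392:
  "log_concave_tests 392
     [40, 41, 41, 41, 42, 42, 42, 43, 43, 43, 44, 44, 45, 45, 45, 46, 46, 46, 47, 47, 47, 48, 48, 48, 48,
      49, 49, 49, 50, 50]"
  by (simp (no_asm_simp) add: log_concave_test_def Let_def)

lemma log_concave_tests_512:
  "log_concave_tests 512
     [50, 51, 51, 51, 52, 52, 52, 53, 53, 53, 54, 54, 54, 54, 55, 55, 55, 56, 56, 56, 57, 57, 57, 57, 58,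
      58, 58, 59, 59, 59]"
  by (simp (no_asm_simp) add: log_concave_test_def Let_def)

lemma log_concave_tests_632:
  "log_concave_tests 632
     [59, 60, 60, 60, 61, 61, 61, 61, 62, 62, 62, 62, 63, 63, 63, 64, 64, 64, 64, 65, 65, 65, 65, 66, 66,
      66, 67, 67, 67, 67]"
  by (simp (no_asm_simp) add: log_concave_test_def Let_def)

lemma log_concave_tests_752:
  "log_concave_tests 752
     [68, 68, 68, 68, 69, 69, 69, 69, 70, 70]"
  by (simp (no_asm_simp) add: log_concave_test_def Let_def)

section \<open>The theorem\<close>

lemma partition_number_quotient_log_concave_small:
  assumes "32 \<le> n" "n < 792"
  shows "int n * int n * (int_partition_number (n - 1) * int_partition_number (n + 1)) \<le> (int n * int n - 1) * (int_partition_number n * int_partition_number n)"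
proof -
  consider "n < 152" | "152 \<le> n" "n < 272" | "272 \<le> n" "n < 392"
    | "392 \<le> n" "n < 512" | "512 \<le> n" "n < 632" | "632 \<le> n" "n < 752" | "752 \<le> n"
    by linarith
  thus ?thesis
  proof cases
    case 1
    show ?thesis by (rule log_concave_testsD[OF log_concave_tests_32]) (use assms 1 in simp_all)
  next
    case 2
    show ?thesis by (rule log_concave_testsD[OF log_concave_tests_152]) (use assms 2 in simp_all)
  next
    case 3
    show ?thesis by (rule log_concave_testsD[OF log_concave_tests_272]) (use assms 3 in simp_all)
  next
    case 4
    show ?thesis by (rule log_concave_testsD[OF log_concave_tests_392]) (use assms 4 in simp_all)
  next
    case 5
    show ?thesis by (rule log_concave_testsD[OF log_concave_tests_512]) (use assms 5 in simp_all)
  next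
    case 6
    show ?thesis by (rule log_concave_testsD[OF log_concave_tests_632]) (use assms 6 in simp_all)
  next
    case 7
    show ?thesis by (rule log_concave_testsD[OF log_concave_tests_752]) (use assms 7 in simp_all)
  qed
qed

lemma partition_number_quotient_log_concave:
  assumes "32 \<le> n"
  shows "(real n)\<^sup>2 * (partition_number (n - 1) * partition_number (n + 1)) \<le>
           ((real n)\<^sup>2 - 1) * (real (partition_number n))\<^sup>2"
proof (cases "n < 792")
  case True
  let ?p = "\<lambda>k. int (partition_number k)"
  have "int n * int n * (?p (n - 1) * ?p (n + 1)) \<le> (int n * int n - 1) * (?p n * ?p n)"
    using partition_number_quotient_log_concave_small[OF assms True]
    unfolding int_partition_number_def .
  hence "real_of_int (int n * int n * (?p (n - 1) * ?p (n + 1))) \<le>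
         real_of_int ((int n * int n - 1) * (?p n * ?p n))"
    by (simp only: of_int_le_iff)
  thus ?thesis by (simp add: power2_eq_square)
next
  case False
  thus ?thesis by (intro partition_number_quotient_log_concave_large) simp
qed

theorem theorem6p1:
  fixes n :: nat
  assumes "n \<ge> 32"
  shows "q n ^ 2 \<ge> q (n - 1) * q (n + 1)"
proof -
  define N where "N = (real n)\<^sup>2"
  have "real n * real n \<ge> 32 * 32" using assms by (intro mult_mono) auto
  hence N: "N > 1" by (simp add: N_def power2_eq_square)
  \<comment> \<open>The outer denominators multiply to n^2 - 1; clearing all denominators leads to
    the integer form that was proved.\<close>
  have "real (n - 1) * real (n + 1) = N - 1"
    using assms by (simp add: N_def power2_eq_square of_nat_diff algebra_simps)
  hence "q (n - 1) * q (n + 1) = partition_number (n - 1) * partition_number (n + 1) / (N - 1)"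
    by (simp add: q_def)
  also have "\<dots> \<le> (real (partition_number n))\<^sup>2 / N"
    using partition_number_quotient_log_concave[OF assms] N
    by (simp add: N_def [symmetric] pos_divide_le_eq pos_le_divide_eq mult_ac)
  also have "\<dots> = q n ^ 2" by (simp add: q_def N_def power_divide)
  finally show ?thesis .
qed

end
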